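(* Let $(\mathcal{D},\mathcal{R})$ be a pre-proof of the cyclic proof system for $\mathrm{HFL}_{\mathbb{N}}$ described in the context. It is decidable whether $(\mathcal{D},\mathcal{R})$ satisfies the global trace condition, i.e. whether it is a cyclic proof.
   Context: $\mathrm{HFL}_{\mathbb{N}}$. Types: $A ::= \mathbf{N} \mid T$, $T ::= \mathbf{\Omega} \mid A \to T$. Terms: $s,t ::= x \mid \mathbf{Z} \mid \mathbf{S}t$. Formulas: $\varphi,\psi ::= s=t \mid \varphi\lor\psi \mid \varphi\land\psi \mid x \mid \lambda x^A.\varphi \mid \varphi\,\psi \mid \varphi\,t \mid \mu x^T.\varphi \mid \nu x^T.\varphi$. Formulas are simply typed in the usual way; $s=t$, $\lor$, $\land$ have type $\mathbf{\Omega}$, and $\mu x^T.\varphi$, $\nu x^T.\varphi$ require $\varphi:T$ under $x:T$ (fixed-point variables never have type $\mathbf{N}$). Semantics: $[\![\mathbf{N}]\!]=\mathbb{N}$ (discretely ordered), $[\![\mathbf{\Omega}]\!]=\{\bot\le\top\}$, $[\![A\to T]\!]$ = monotone functions ordered pointwise (each $[\![T]\!]$ is a complete lattice); connectives, $\lambda$, application are interpreted standardly, $\mu$/$\nu$ as least/greatest fixed points. A sequent $\Gamma\vdash\Delta$ is a pair of finite sequences of formulas of type $\mathbf{\Omega}$. Write $\exists x'.\theta$ for $(\mu Y^{\mathbf{N}\to\mathbf{\Omega}}.\lambda x'.\theta\lor Y(\mathbf{S}x'))\,\mathbf{Z}$ and $N \equiv \mu X.\lambda x.(x=\mathbf{Z})\lor(\exists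 x'.x=\mathbf{S}x'\land X\,x')$. Rules ($\sigma\in\{\mu,\nu\}$, $\vec\psi$ a possibly empty list of arguments): (Axiom) $\varphi\vdash\varphi$; (Cut) from $\Gamma\vdash\varphi,\Delta$ and $\Gamma,\varphi\vdash\Delta$ infer $\Gamma\vdash\Delta$; weakening, contraction and exchange on both sides; (Subst) from $\Gamma\vdash\Delta$ infer $\Gamma[\varphi/x]\vdash\Delta[\varphi/x]$; (Mono) from $k$ copies of $\Gamma,\psi\,\vec y\vdash\chi\,\vec y,\Delta$ (with $k$ the number of occurrences of $x$ in $\varphi$ and $\vec y$ fresh) infer $\Gamma,\varphi[\psi/x^T]\vdash\varphi[\chi/x^T],\Delta$; ($=L$) from $\Gamma[t/x,s/y]\vdash\Delta[t/x,s/y]$ infer $\Gamma[s/x,t/y],s=t\vdash\Delta[s/x,t/y]$; ($=R$) $\Gamma\vdash t=t,\Delta$; ($\lor L$) from $\Gamma,\varphi\vdash\Delta$ and $\Gamma,\psi\vdash\Delta$ infer $\Gamma,\varphi\lor\psi\vdash\Delta$; ($\lor R$) from $\Gamma\vdash\varphi,\psi,\Delta$ infer $\Gamma\vdash\varphi\lor\psi,\Delta$; ($\land L$) from $\Gamma,\varphi,\psi\vdash\Delta$ infer $\Gamma,\varphi\land\psi\vdash\Delta$; ($\land R$) from $\Gamma\vdash\varphi,\Delta$ and $\Gamma\vdash\psi,\Delta$ infer $\Gamma\vdash\varphi\land\psi,\Delta$; ($\lambda L$/$\lambda R$) replace $(\lambda x.\varphi)\,\psi\,\vec\psi$ on the left/right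 by $\varphi[\psi/x]\,\vec\psi$; ($\sigma L$/$\sigma R$) replace $(\sigma x.\varphi)\,\vec\psi$ on the left/right by $\varphi[\sigma x.\varphi/x]\,\vec\psi$; (Nat) from $\Gamma,N\,x^{\mathbf{N}}\vdash\Delta$ infer $\Gamma\vdash\Delta$; (P1) $\mathbf{S}s=\mathbf{Z}\vdash$; (P2) from $\Gamma,s=t\vdash\Delta$ infer $\Gamma,\mathbf{S}s=\mathbf{S}t\vdash\Delta$. The rules ($=L/R$), ($\lor L/R$), ($\land L/R$), ($\lambda L/R$), ($\sigma L/R$) are the logical rules; an occurrence in a conclusion is principal if it is not in $\Gamma$ or $\Delta$. A derivation tree is a finite tree built from these rules whose leaves need not be axioms; non-axiom leaves are open. A pre-proof $(\mathcal{D},\mathcal{R})$ is a finite derivation tree $\mathcal{D}$ with a map $\mathcal{R}$ assigning to each open leaf a non-leaf node with the same sequent. A path is a sequence of nodes $(n_i)$ with $n_{i+1}=\mathcal{R}(n_i)$ if $n_i$ is an open leaf and $n_{i+1}$ a premise of $n_i$ otherwise. Relevant occurrences: side formulas in $\Gamma,\Delta$ of a premise are relevant to the corresponding ones of the conclusion (through the substitution in (Subst), ($=L$)); both copies in contraction and the swapped formulas in exchange correspond; in ($\land L$),($\lor R$) both components are relevant to the principal formula, in ($\lor L$),($\land R$) the component in that premise; in ($\lambda$),($\sigma$) the reduct/unfolding; in (Mono) $\psi\vec y$, $\chi\vec y$ are relevant to $\varphi[\psi/x]$, $\varphi[\chi/x]$; in (P2) $s=t$ to $\mathbf{S}s=\mathbf{S}t$;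 the cut formula and the $N\,x$ of (Nat) are relevant to nothing. A trace along a path is a sequence $(\tau_i)$ of formula occurrences, $\tau_i$ in $n_i$ and $\tau_{i+1}$ relevant to $\tau_i$, such that infinitely often $\tau_i$ is principal in a logical rule. Annotation: each fixed-point operator occurrence in $\tau_0$ gets $\epsilon$; if $\tau_i=(\sigma_p x.\varphi)\vec\psi$ is principal in ($\sigma L/R$), then $\tau_{i+1}=\varphi[\sigma_{p.k}x.\varphi/x]\vec\psi$ with $k$ a natural number not yet used; if $\tau_i=\varphi[\psi_1/x_1,\dots,\psi_k/x_k]$ is principal in (Mono) (one $\psi_j$ per occurrence of $x$) and $\tau_{i+1}$ lies in the $j$-th premise, then $\tau_{i+1}=\psi_j\vec y$ keeps the annotations of $\psi_j$; otherwise annotations are inherited. The trace is a $\mu$-trace (resp. $\nu$-trace) if there is an infinite sequence $p$ of naturals such that for every $n$, the prefix $p[0:n]$ of length $n$ is assigned to some occurrence of $\mu$ (resp. $\nu$) in some $\tau_i$. It is a left (right) trace if $\tau_0$ is on the left (right) of $\vdash$. Global trace condition: every infinite path has a tail carrying a left $\mu$-trace or a right $\nu$-trace; a pre-proof satisfying it is a cyclic proof. *)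

theory Defs
  imports "HOL-Library.Nat_Bijection"
begin

section \<open>Total recursive functions and decidability\<close>

text \<open>
  Kleene's total recursive functions: \<open>recursive n f\<close> says that \<open>f\<close>, restricted to argument
  lists of length \<open>n\<close>, is obtained from zero, successor and projections by composition,
  primitive recursion (on the first argument) and minimization of regular functions.
\<close>

inductive recursive :: "nat \<Rightarrow> (nat list \<Rightarrow> nat) \<Rightarrow> bool" where
  zero: "recursive n (\<lambda>_. 0)"
| succ: "recursive 1 (\<lambda>xs. Suc (xs ! 0))"
| proj: "i < n \<Longrightarrow> recursive n (\<lambda>xs. xs ! i)"
| comp: "recursive (length gs) f \<Longrightarrow> (\<And>g. g \<in> set gs \<Longrightarrow> recursive n g) \<Longrightarrow>
    recursive n (\<lambda>xs. f (map (\<lambda>g. g xs) gs))"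
| prec: "recursive n f \<Longrightarrow> recursive (Suc (Suc n)) g \<Longrightarrow>
    recursive (Suc n) (\<lambda>xs. rec_nat (f (tl xs)) (\<lambda>y r. g (y # r # tl xs)) (hd xs))"
| mini: "recursive (Suc n) f \<Longrightarrow> (\<And>xs. length xs = n \<Longrightarrow> \<exists>y. f (y # xs) = 0) \<Longrightarrow>
    recursive n (\<lambda>xs. LEAST y. f (y # xs) = 0)"

text \<open>
  The decision problem with instances \<open>{x. I x}\<close>, presented through the Goedel numbering \<open>code\<close>,
  and question \<open>Q\<close>.
\<close>

definition decidable :: "('a \<Rightarrow> nat) \<Rightarrow> ('a \<Rightarrow> bool) \<Rightarrow> ('a \<Rightarrow> bool) \<Rightarrow> bool" where
  "decidable code I Q \<longleftrightarrow>
     (\<exists>f. recursive 1 f \<and> (\<forall>x. I x \<longrightarrow> f [code x] = (if Q x then 1 else 0)))"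


section \<open>Types, terms and formulas\<close>

datatype aty = NatT | FormT fty
     and fty = Omega | Arrow aty fty

text \<open>
  Formulas are taken up to renaming of bound variables, in locally nameless style: bound variables
  are de Bruijn indices, with one index space for variables of type \<open>NatT\<close> and of formula types;
  free variables are names together with their type (a variable \<open>(x, A)\<close>).
  The parameter \<open>'a\<close> is the type of annotations carried by fixed-point operators;
  ordinary formulas have \<open>'a = unit\<close>.
\<close>

type_synonym var = "nat \<times> aty"

datatype tm = TFree nat | TBound nat | Zero | Succ tm

datatype sgn = Mu | Nu

datatype 'a fm =
    Eq tm tm
  | Or "'a fm" "'a fm"
  | And "'a fm" "'a fm"
  | FFree nat fty
  | FBound nat
  | Lam aty "'a fm"
  | AppF "'a fm" "'a fm"
  | AppT "'a fm" tm
  | Fix sgn 'a fty "'a fm"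

datatype 'a arg = FArg "'a fm" | TArg tm

type_synonym form = "unit fm"

fun app :: "'a fm \<Rightarrow> 'a arg \<Rightarrow> 'a fm" where
  "app \<phi> (FArg \<psi>) = AppF \<phi> \<psi>"
| "app \<phi> (TArg t) = AppT \<phi> t"

definition apps :: "'a fm \<Rightarrow> 'a arg list \<Rightarrow> 'a fm" where
  "apps = foldl app"

fun var_arg :: "var \<Rightarrow> 'a arg" where
  "var_arg (x, NatT) = TArg (TFree x)"
| "var_arg (x, FormT T) = FArg (FFree x T)"

definition erase :: "'a fm \<Rightarrow> form" where
  "erase = map_fm (\<lambda>_. ())"

inductive typed_tm :: "aty list \<Rightarrow> tm \<Rightarrow> bool" where
  "typed_tm E (TFree x)"
| "i < length E \<Longrightarrow> E ! i = NatT \<Longrightarrow> typed_tm E (TBound i)"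
| "typed_tm E Zero"
| "typed_tm E t \<Longrightarrow> typed_tm E (Succ t)"

inductive typed :: "aty list \<Rightarrow> 'a fm \<Rightarrow> fty \<Rightarrow> bool" where
  "typed_tm E s \<Longrightarrow> typed_tm E t \<Longrightarrow> typed E (Eq s t) Omega"
| "typed E \<phi> Omega \<Longrightarrow> typed E \<psi> Omega \<Longrightarrow> typed E (Or \<phi> \<psi>) Omega"
| "typed E \<phi> Omega \<Longrightarrow> typed E \<psi> Omega \<Longrightarrow> typed E (And \<phi> \<psi>) Omega"
| "typed E (FFree x T) T"
| "i < length E \<Longrightarrow> E ! i = FormT T \<Longrightarrow> typed E (FBound i) T"
| "typed (A # E) \<phi> T \<Longrightarrow> typed E (Lam A \<phi>) (Arrow A T)"
| "typed E \<phi> (Arrow (FormT U) T) \<Longrightarrow> typed E \<psi> U \<Longrightarrow> typed E (AppF \<phi> \<psi>) T"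
| "typed E \<phi> (Arrow NatT T) \<Longrightarrow> typed_tm E t \<Longrightarrow> typed E (AppT \<phi> t) T"
| "typed (FormT T # E) \<phi> T \<Longrightarrow> typed E (Fix \<sigma> a T \<phi>) T"

primrec fv_tm :: "tm \<Rightarrow> var set" where
  "fv_tm (TFree x) = {(x, NatT)}"
| "fv_tm (TBound i) = {}"
| "fv_tm Zero = {}"
| "fv_tm (Succ t) = fv_tm t"

primrec fv :: "'a fm \<Rightarrow> var set" where
  "fv (Eq s t) = fv_tm s \<union> fv_tm t"
| "fv (Or \<phi> \<psi>) = fv \<phi> \<union> fv \<psi>"
| "fv (And \<phi> \<psi>) = fv \<phi> \<union> fv \<psi>"
| "fv (FFree x T) = {(x, FormT T)}"
| "fv (FBound i) = {}"
| "fv (Lam A \<phi>) = fv \<phi>"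
| "fv (AppF \<phi> \<psi>) = fv \<phi> \<union> fv \<psi>"
| "fv (AppT \<phi> t) = fv \<phi> \<union> fv_tm t"
| "fv (Fix \<sigma> a T \<phi>) = fv \<phi>"


subsection \<open>Substitution\<close>

text \<open>
  \<open>inst k a \<phi>\<close> replaces the dangling bound variable \<open>k\<close> of \<open>\<phi>\<close> by \<open>a\<close>; so \<open>inst 0 a \<phi>\<close> is the body
  \<open>\<phi>\<close> of a binder with the bound variable replaced by \<open>a\<close>. No shifting is needed because only closed
  (in the sense of bound variables) \<open>a\<close> and \<open>\<lambda>x.\<phi>\<close>, \<open>\<sigma>x.\<phi>\<close> are used.
\<close>

primrec inst_tm :: "nat \<Rightarrow> 'a arg \<Rightarrow> tm \<Rightarrow> tm" where
  "inst_tm k a (TFree x) = TFree x"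
| "inst_tm k a (TBound i) =
     (if i = k then (case a of TArg t \<Rightarrow> t | FArg _ \<Rightarrow> TBound i) else TBound i)"
| "inst_tm k a Zero = Zero"
| "inst_tm k a (Succ t) = Succ (inst_tm k a t)"

primrec inst :: "nat \<Rightarrow> 'a arg \<Rightarrow> 'a fm \<Rightarrow> 'a fm" where
  "inst k a (Eq s t) = Eq (inst_tm k a s) (inst_tm k a t)"
| "inst k a (Or \<phi> \<psi>) = Or (inst k a \<phi>) (inst k a \<psi>)"
| "inst k a (And \<phi> \<psi>) = And (inst k a \<phi>) (inst k a \<psi>)"
| "inst k a (FFree x T) = FFree x T"
| "inst k a (FBound i) =
     (if i = k then (case a of FArg \<psi> \<Rightarrow> \<psi> | TArg _ \<Rightarrow> FBound i) else FBound i)"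
| "inst k a (Lam A \<phi>) = Lam A (inst (Suc k) a \<phi>)"
| "inst k a (AppF \<phi> \<psi>) = AppF (inst k a \<phi>) (inst k a \<psi>)"
| "inst k a (AppT \<phi> t) = AppT (inst k a \<phi>) (inst_tm k a t)"
| "inst k a (Fix \<sigma> b T \<phi>) = Fix \<sigma> b T (inst (Suc k) a \<phi>)"

text \<open>
  Simultaneous substitution of terms for free variables of type \<open>NatT\<close>: \<open>[s/x, t/y]\<close> is
  \<open>TFree(x := s, y := t)\<close>.
\<close>

primrec subst_tm :: "(nat \<Rightarrow> tm) \<Rightarrow> tm \<Rightarrow> tm" where
  "subst_tm \<rho> (TFree x) = \<rho> x"
| "subst_tm \<rho> (TBound i) = TBound i"
| "subst_tm \<rho> Zero = Zero"
| "subst_tm \<rho> (Succ t) = Succ (subst_tm \<rho> t)"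

primrec tsubst :: "(nat \<Rightarrow> tm) \<Rightarrow> 'a fm \<Rightarrow> 'a fm" where
  "tsubst \<rho> (Eq s t) = Eq (subst_tm \<rho> s) (subst_tm \<rho> t)"
| "tsubst \<rho> (Or \<phi> \<psi>) = Or (tsubst \<rho> \<phi>) (tsubst \<rho> \<psi>)"
| "tsubst \<rho> (And \<phi> \<psi>) = And (tsubst \<rho> \<phi>) (tsubst \<rho> \<psi>)"
| "tsubst \<rho> (FFree x T) = FFree x T"
| "tsubst \<rho> (FBound i) = FBound i"
| "tsubst \<rho> (Lam A \<phi>) = Lam A (tsubst \<rho> \<phi>)"
| "tsubst \<rho> (AppF \<phi> \<psi>) = AppF (tsubst \<rho> \<phi>) (tsubst \<rho> \<psi>)"
| "tsubst \<rho> (AppT \<phi> t) = AppT (tsubst \<rho> \<phi>) (subst_tm \<rho> t)"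
| "tsubst \<rho> (Fix \<sigma> a T \<phi>) = Fix \<sigma> a T (tsubst \<rho> \<phi>)"

primrec fsubst :: "nat \<Rightarrow> fty \<Rightarrow> 'a fm \<Rightarrow> 'a fm \<Rightarrow> 'a fm" where
  "fsubst x T \<psi> (Eq s t) = Eq s t"
| "fsubst x T \<psi> (Or \<phi> \<chi>) = Or (fsubst x T \<psi> \<phi>) (fsubst x T \<psi> \<chi>)"
| "fsubst x T \<psi> (And \<phi> \<chi>) = And (fsubst x T \<psi> \<phi>) (fsubst x T \<psi> \<chi>)"
| "fsubst x T \<psi> (FFree y U) = (if y = x \<and> U = T then \<psi> else FFree y U)"
| "fsubst x T \<psi> (FBound i) = FBound i"
| "fsubst x T \<psi> (Lam A \<phi>) = Lam A (fsubst x T \<psi> \<phi>)"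
| "fsubst x T \<psi> (AppF \<phi> \<chi>) = AppF (fsubst x T \<psi> \<phi>) (fsubst x T \<psi> \<chi>)"
| "fsubst x T \<psi> (AppT \<phi> t) = AppT (fsubst x T \<psi> \<phi>) t"
| "fsubst x T \<psi> (Fix \<sigma> a U \<phi>) = Fix \<sigma> a U (fsubst x T \<psi> \<phi>)"

primrec occs :: "nat \<Rightarrow> fty \<Rightarrow> 'a fm \<Rightarrow> nat" where
  "occs x T (Eq s t) = 0"
| "occs x T (Or \<phi> \<chi>) = occs x T \<phi> + occs x T \<chi>"
| "occs x T (And \<phi> \<chi>) = occs x T \<phi> + occs x T \<chi>"
| "occs x T (FFree y U) = (if y = x \<and> U = T then 1 else 0)"
| "occs x T (FBound i) = 0"
| "occs x T (Lam A \<phi>) = occs x T \<phi>"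
| "occs x T (AppF \<phi> \<chi>) = occs x T \<phi> + occs x T \<chi>"
| "occs x T (AppT \<phi> t) = occs x T \<phi>"
| "occs x T (Fix \<sigma> a U \<phi>) = occs x T \<phi>"

text \<open>
  \<open>plug x T \<psi>s \<phi>\<close> replaces the occurrences of the free variable \<open>x\<close> of type \<open>T\<close> in \<open>\<phi>\<close>, from left
  to right, by the members of \<open>\<psi>s\<close> (one for each occurrence).
\<close>

primrec plug :: "nat \<Rightarrow> fty \<Rightarrow> 'a fm list \<Rightarrow> 'a fm \<Rightarrow> 'a fm" where
  "plug x T \<psi>s (Eq s t) = Eq s t"
| "plug x T \<psi>s (Or \<phi> \<chi>) =
     Or (plug x T (take (occs x T \<phi>) \<psi>s) \<phi>) (plug x T (drop (occs x T \<phi>) \<psi>s) \<chi>)"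
| "plug x T \<psi>s (And \<phi> \<chi>) =
     And (plug x T (take (occs x T \<phi>) \<psi>s) \<phi>) (plug x T (drop (occs x T \<phi>) \<psi>s) \<chi>)"
| "plug x T \<psi>s (FFree y U) = (if y = x \<and> U = T then hd \<psi>s else FFree y U)"
| "plug x T \<psi>s (FBound i) = FBound i"
| "plug x T \<psi>s (Lam A \<phi>) = Lam A (plug x T \<psi>s \<phi>)"
| "plug x T \<psi>s (AppF \<phi> \<chi>) =
     AppF (plug x T (take (occs x T \<phi>) \<psi>s) \<phi>) (plug x T (drop (occs x T \<phi>) \<psi>s) \<chi>)"
| "plug x T \<psi>s (AppT \<phi> t) = AppT (plug x T \<psi>s \<phi>) t"
| "plug x T \<psi>s (Fix \<sigma> a U \<phi>) = Fix \<sigma> a U (plug x T \<psi>s \<phi>)"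

lemma plug_replicate: "plug x T (replicate (occs x T \<phi>) \<psi>) \<phi> = fsubst x T \<psi> \<phi>"
  by (induction \<phi>) (simp_all add: replicate_add)


section \<open>Sequents and rules\<close>

type_synonym sequent = "form list \<times> form list"

definition wf_sequent :: "sequent \<Rightarrow> bool" where
  "wf_sequent S \<longleftrightarrow> (\<forall>\<phi> \<in> set (fst S) \<union> set (snd S). typed [] \<phi> Omega)"

text \<open>
  In \<open>exists_nat \<theta>\<close> the formula \<open>\<theta>\<close> lies under two binders, \<open>Y\<close> (index 1) and the quantified
  variable (index 0). Hence in \<open>nat_pred\<close> the indices 2 and 3 stand for \<open>x\<close> and \<open>X\<close>.
\<close>

definition exists_nat :: "form \<Rightarrow> form" where
  "exists_nat \<theta> =
     AppT (Fix Mu () (Arrow NatT Omega)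
            (Lam NatT (Or \<theta> (AppT (FBound 1) (Succ (TBound 0)))))) Zero"

definition nat_pred :: form where
  "nat_pred =
     Fix Mu () (Arrow NatT Omega)
       (Lam NatT (Or (Eq (TBound 0) Zero)
                     (exists_nat (And (Eq (TBound 2) (Succ (TBound 0)))
                                      (AppT (FBound 3) (TBound 0))))))"

text \<open>
  A rule instance carries all its parameters. Except for exchange, \<open>lctx\<close> and \<open>rctx\<close> are the
  side formulas \<open>\<Gamma>\<close> and \<open>\<Delta>\<close> of the rule.
\<close>

datatype rule =
    Axiom form
  | Cut (lctx: "form list") (rctx: "form list") form
  | WeakL (lctx: "form list") (rctx: "form list") form
  | WeakR (lctx: "form list") (rctx: "form list") form
  | ContrL (lctx: "form list") (rctx: "form list") form
  | ContrR (lctx: "form list") (rctx: "form list") form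
  | ExchL "form list" form form "form list" "form list"
  | ExchR "form list" "form list" form form "form list"
  | SubstF (lctx: "form list") (rctx: "form list") nat fty form
  | SubstT (lctx: "form list") (rctx: "form list") nat tm
  | Mono (lctx: "form list") (rctx: "form list") nat fty form form form "var list"
  | EqL (lctx: "form list") (rctx: "form list") nat nat tm tm
  | EqR (lctx: "form list") (rctx: "form list") tm
  | OrL (lctx: "form list") (rctx: "form list") form form
  | OrR (lctx: "form list") (rctx: "form list") form form
  | AndL (lctx: "form list") (rctx: "form list") form form
  | AndR (lctx: "form list") (rctx: "form list") form form
  | LamL (lctx: "form list") (rctx: "form list") aty form "unit arg" "unit arg list"
  | LamR (lctx: "form list") (rctx: "form list") aty form "unit arg" "unit arg list"
  | FixL (lctx: "form list") (rctx: "form list") sgn fty form "unit arg list"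
  | FixR (lctx: "form list") (rctx: "form list") sgn fty form "unit arg list"
  | NatRule (lctx: "form list") (rctx: "form list") nat
  | P1 tm
  | P2 (lctx: "form list") (rctx: "form list") tm tm
where
  "lctx (Axiom _) = []"
| "rctx (Axiom _) = []"
| "lctx (P1 _) = []"
| "rctx (P1 _) = []"
| "lctx (ExchL \<Gamma> _ _ _ _) = \<Gamma>"
| "rctx (ExchL _ _ _ _ \<Delta>) = \<Delta>"
| "lctx (ExchR \<Gamma> _ _ _ _) = \<Gamma>"
| "rctx (ExchR _ _ _ _ \<Delta>) = \<Delta>"

fun concl :: "rule \<Rightarrow> sequent" where
  "concl (Axiom \<phi>) = ([\<phi>], [\<phi>])"
| "concl (Cut \<Gamma> \<Delta> \<phi>) = (\<Gamma>, \<Delta>)"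
| "concl (WeakL \<Gamma> \<Delta> \<phi>) = (\<Gamma> @ [\<phi>], \<Delta>)"
| "concl (WeakR \<Gamma> \<Delta> \<phi>) = (\<Gamma>, \<phi> # \<Delta>)"
| "concl (ContrL \<Gamma> \<Delta> \<phi>) = (\<Gamma> @ [\<phi>], \<Delta>)"
| "concl (ContrR \<Gamma> \<Delta> \<phi>) = (\<Gamma>, \<phi> # \<Delta>)"
| "concl (ExchL \<Gamma> \<phi> \<psi> \<Gamma>' \<Delta>) = (\<Gamma> @ [\<phi>, \<psi>] @ \<Gamma>', \<Delta>)"
| "concl (ExchR \<Gamma> \<Delta> \<phi> \<psi> \<Delta>') = (\<Gamma>, \<Delta> @ [\<phi>, \<psi>] @ \<Delta>')"
| "concl (SubstF \<Gamma> \<Delta> x T \<phi>) = (map (fsubst x T \<phi>) \<Gamma>, map (fsubst x T \<phi>) \<Delta>)"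
| "concl (SubstT \<Gamma> \<Delta> x t) = (map (tsubst (TFree(x := t))) \<Gamma>, map (tsubst (TFree(x := t))) \<Delta>)"
| "concl (Mono \<Gamma> \<Delta> x T \<phi> \<psi> \<chi> ys) = (\<Gamma> @ [fsubst x T \<psi> \<phi>], fsubst x T \<chi> \<phi> # \<Delta>)"
| "concl (EqL \<Gamma> \<Delta> x y s t) =
     (map (tsubst (TFree(x := s, y := t))) \<Gamma> @ [Eq s t], map (tsubst (TFree(x := s, y := t))) \<Delta>)"
| "concl (EqR \<Gamma> \<Delta> t) = (\<Gamma>, Eq t t # \<Delta>)"
| "concl (OrL \<Gamma> \<Delta> \<phi> \<psi>) = (\<Gamma> @ [Or \<phi> \<psi>], \<Delta>)"
| "concl (OrR \<Gamma> \<Delta> \<phi> \<psi>) = (\<Gamma>, Or \<phi> \<psi> # \<Delta>)"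
| "concl (AndL \<Gamma> \<Delta> \<phi> \<psi>) = (\<Gamma> @ [And \<phi> \<psi>], \<Delta>)"
| "concl (AndR \<Gamma> \<Delta> \<phi> \<psi>) = (\<Gamma>, And \<phi> \<psi> # \<Delta>)"
| "concl (LamL \<Gamma> \<Delta> A \<phi> a as) = (\<Gamma> @ [apps (Lam A \<phi>) (a # as)], \<Delta>)"
| "concl (LamR \<Gamma> \<Delta> A \<phi> a as) = (\<Gamma>, apps (Lam A \<phi>) (a # as) # \<Delta>)"
| "concl (FixL \<Gamma> \<Delta> \<sigma> T \<phi> as) = (\<Gamma> @ [apps (Fix \<sigma> () T \<phi>) as], \<Delta>)"
| "concl (FixR \<Gamma> \<Delta> \<sigma> T \<phi> as) = (\<Gamma>, apps (Fix \<sigma> () T \<phi>) as # \<Delta>)"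
| "concl (NatRule \<Gamma> \<Delta> x) = (\<Gamma>, \<Delta>)"
| "concl (P1 s) = ([Eq (Succ s) Zero], [])"
| "concl (P2 \<Gamma> \<Delta> s t) = (\<Gamma> @ [Eq (Succ s) (Succ t)], \<Delta>)"

fun prems :: "rule \<Rightarrow> sequent list" where
  "prems (Axiom \<phi>) = []"
| "prems (Cut \<Gamma> \<Delta> \<phi>) = [(\<Gamma>, \<phi> # \<Delta>), (\<Gamma> @ [\<phi>], \<Delta>)]"
| "prems (WeakL \<Gamma> \<Delta> \<phi>) = [(\<Gamma>, \<Delta>)]"
| "prems (WeakR \<Gamma> \<Delta> \<phi>) = [(\<Gamma>, \<Delta>)]"
| "prems (ContrL \<Gamma> \<Delta> \<phi>) = [(\<Gamma> @ [\<phi>, \<phi>], \<Delta>)]"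
| "prems (ContrR \<Gamma> \<Delta> \<phi>) = [(\<Gamma>, \<phi> # \<phi> # \<Delta>)]"
| "prems (ExchL \<Gamma> \<phi> \<psi> \<Gamma>' \<Delta>) = [(\<Gamma> @ [\<psi>, \<phi>] @ \<Gamma>', \<Delta>)]"
| "prems (ExchR \<Gamma> \<Delta> \<phi> \<psi> \<Delta>') = [(\<Gamma>, \<Delta> @ [\<psi>, \<phi>] @ \<Delta>')]"
| "prems (SubstF \<Gamma> \<Delta> x T \<phi>) = [(\<Gamma>, \<Delta>)]"
| "prems (SubstT \<Gamma> \<Delta> x t) = [(\<Gamma>, \<Delta>)]"
| "prems (Mono \<Gamma> \<Delta> x T \<phi> \<psi> \<chi> ys) =
     replicate (occs x T \<phi>)
       (\<Gamma> @ [apps \<psi> (map var_arg ys)], apps \<chi> (map var_arg ys) # \<Delta>)"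
| "prems (EqL \<Gamma> \<Delta> x y s t) =
     [(map (tsubst (TFree(x := t, y := s))) \<Gamma>, map (tsubst (TFree(x := t, y := s))) \<Delta>)]"
| "prems (EqR \<Gamma> \<Delta> t) = []"
| "prems (OrL \<Gamma> \<Delta> \<phi> \<psi>) = [(\<Gamma> @ [\<phi>], \<Delta>), (\<Gamma> @ [\<psi>], \<Delta>)]"
| "prems (OrR \<Gamma> \<Delta> \<phi> \<psi>) = [(\<Gamma>, \<phi> # \<psi> # \<Delta>)]"
| "prems (AndL \<Gamma> \<Delta> \<phi> \<psi>) = [(\<Gamma> @ [\<phi>, \<psi>], \<Delta>)]"
| "prems (AndR \<Gamma> \<Delta> \<phi> \<psi>) = [(\<Gamma>, \<phi> # \<Delta>), (\<Gamma>, \<psi> # \<Delta>)]"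
| "prems (LamL \<Gamma> \<Delta> A \<phi> a as) = [(\<Gamma> @ [apps (inst 0 a \<phi>) as], \<Delta>)]"
| "prems (LamR \<Gamma> \<Delta> A \<phi> a as) = [(\<Gamma>, apps (inst 0 a \<phi>) as # \<Delta>)]"
| "prems (FixL \<Gamma> \<Delta> \<sigma> T \<phi> as) = [(\<Gamma> @ [apps (inst 0 (FArg (Fix \<sigma> () T \<phi>)) \<phi>) as], \<Delta>)]"
| "prems (FixR \<Gamma> \<Delta> \<sigma> T \<phi> as) = [(\<Gamma>, apps (inst 0 (FArg (Fix \<sigma> () T \<phi>)) \<phi>) as # \<Delta>)]"
| "prems (NatRule \<Gamma> \<Delta> x) = [(\<Gamma> @ [AppT nat_pred (TFree x)], \<Delta>)]"
| "prems (P1 s) = []"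
| "prems (P2 \<Gamma> \<Delta> s t) = [(\<Gamma> @ [Eq s t], \<Delta>)]"

fun side_condition :: "rule \<Rightarrow> bool" where
  "side_condition (SubstF \<Gamma> \<Delta> x T \<phi>) \<longleftrightarrow> typed [] \<phi> T"
| "side_condition (SubstT \<Gamma> \<Delta> x t) \<longleftrightarrow> typed_tm [] t"
| "side_condition (Mono \<Gamma> \<Delta> x T \<phi> \<psi> \<chi> ys) \<longleftrightarrow>
     typed [] \<phi> Omega \<and> typed [] \<psi> T \<and> typed [] \<chi> T \<and>
     T = foldr Arrow (map snd ys) Omega \<and> distinct ys \<and>
     (\<forall>\<theta> \<in> set \<Gamma> \<union> set \<Delta> \<union> {\<phi>, \<psi>, \<chi>}. set ys \<inter> fv \<theta> = {})"
| "side_condition (EqL \<Gamma> \<Delta> x y s t) \<longleftrightarrow> x \<noteq> y"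
| "side_condition _ \<longleftrightarrow> True"

definition wf_rule :: "rule \<Rightarrow> bool" where
  "wf_rule r \<longleftrightarrow> wf_sequent (concl r) \<and> (\<forall>S \<in> set (prems r). wf_sequent S) \<and> side_condition r"

fun logical :: "rule \<Rightarrow> bool" where
  "logical (EqL \<Gamma> \<Delta> x y s t) = True"
| "logical (EqR \<Gamma> \<Delta> t) = True"
| "logical (OrL \<Gamma> \<Delta> \<phi> \<psi>) = True"
| "logical (OrR \<Gamma> \<Delta> \<phi> \<psi>) = True"
| "logical (AndL \<Gamma> \<Delta> \<phi> \<psi>) = True"
| "logical (AndR \<Gamma> \<Delta> \<phi> \<psi>) = True"
| "logical (LamL \<Gamma> \<Delta> A \<phi> a as) = True"
| "logical (LamR \<Gamma> \<Delta> A \<phi> a as) = True"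
| "logical (FixL \<Gamma> \<Delta> \<sigma> T \<phi> as) = True"
| "logical (FixR \<Gamma> \<Delta> \<sigma> T \<phi> as) = True"
| "logical _ = False"

fun unfolding_rule :: "rule \<Rightarrow> bool" where
  "unfolding_rule (FixL \<Gamma> \<Delta> \<sigma> T \<phi> as) = True"
| "unfolding_rule (FixR \<Gamma> \<Delta> \<sigma> T \<phi> as) = True"
| "unfolding_rule _ = False"


section \<open>Formula occurrences and relevance\<close>

datatype side = Lft | Rgt

type_synonym occurrence = "side \<times> nat"

fun formulas :: "side \<Rightarrow> sequent \<Rightarrow> form list" where
  "formulas Lft S = fst S"
| "formulas Rgt S = snd S"

text \<open>
  In the conclusion and the premises of any rule other than exchange, the side formulas form a
  prefix of the left-hand side and a suffix of the right-hand side. \<open>side_index r d S i\<close> is the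
  number, counted within the side formulas, of the \<open>i\<close>-th formula on side \<open>d\<close> of \<open>S\<close>,
  and \<open>None\<close> if that formula is not a side formula.
\<close>

fun side_index :: "rule \<Rightarrow> side \<Rightarrow> sequent \<Rightarrow> nat \<Rightarrow> nat option" where
  "side_index r Lft S i = (if i < length (lctx r) then Some i else None)"
| "side_index r Rgt S i =
     (let k = length (snd S) - length (rctx r) in if k \<le> i then Some (i - k) else None)"

fun principal :: "rule \<Rightarrow> occurrence \<Rightarrow> bool" where
  "principal r (d, i) \<longleftrightarrow> side_index r d (concl r) i = None"

text \<open>
  \<open>relevant r j o o'\<close>: the occurrence \<open>o'\<close> in the \<open>j\<close>-th premise of \<open>r\<close> is relevant to the occurrence
  \<open>o\<close> in the conclusion. Side formulas correspond to each other. On each side, all formulas of a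
  premise that are not side formulas are relevant to the principal formula of that side, if
  there is one; (Cut) and (Nat) have none, and the premise of \<open>EqL\<close> has only side formulas.
\<close>

fun relevant :: "rule \<Rightarrow> nat \<Rightarrow> occurrence \<Rightarrow> occurrence \<Rightarrow> bool" where
  "relevant (ExchL \<Gamma> \<phi> \<psi> \<Gamma>' \<Delta>) j (d, i) (d', i') \<longleftrightarrow>
     d' = d \<and> i' = (if d = Lft then (id(length \<Gamma> := Suc (length \<Gamma>), Suc (length \<Gamma>) := length \<Gamma>)) i else i)"
| "relevant (ExchR \<Gamma> \<Delta> \<phi> \<psi> \<Delta>') j (d, i) (d', i') \<longleftrightarrow>
     d' = d \<and> i' = (if d = Rgt then (id(length \<Delta> := Suc (length \<Delta>), Suc (length \<Delta>) := length \<Delta>)) i else i)"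
| "relevant r j (d, i) (d', i') \<longleftrightarrow>
     d' = d \<and> side_index r d (concl r) i = side_index r d (prems r ! j) i'"


section \<open>Annotations\<close>

type_synonym annotated = "nat list fm"

primrec labels :: "sgn \<Rightarrow> 'a fm \<Rightarrow> 'a set" where
  "labels \<sigma> (Eq s t) = {}"
| "labels \<sigma> (Or \<phi> \<psi>) = labels \<sigma> \<phi> \<union> labels \<sigma> \<psi>"
| "labels \<sigma> (And \<phi> \<psi>) = labels \<sigma> \<phi> \<union> labels \<sigma> \<psi>"
| "labels \<sigma> (FFree x T) = {}"
| "labels \<sigma> (FBound i) = {}"
| "labels \<sigma> (Lam A \<phi>) = labels \<sigma> \<phi>"
| "labels \<sigma> (AppF \<phi> \<psi>) = labels \<sigma> \<phi> \<union> labels \<sigma> \<psi>"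
| "labels \<sigma> (AppT \<phi> t) = labels \<sigma> \<phi>"
| "labels \<sigma> (Fix \<tau> p T \<phi>) = (if \<tau> = \<sigma> then {p} else {}) \<union> labels \<sigma> \<phi>"

text \<open>
  \<open>\<alpha>\<close> annotates an occurrence in the conclusion, \<open>\<beta>\<close> the relevant occurrence in a premise.
  A side formula of a substitution rule keeps the annotations of the operators that do not
  come from the substituted formulas; the copies of the substituted formula in \<open>\<alpha>\<close> may be
  annotated differently from each other.
\<close>

fun ann_side :: "rule \<Rightarrow> annotated \<Rightarrow> annotated \<Rightarrow> bool" where
  "ann_side (SubstF \<Gamma> \<Delta> x T \<phi>) \<alpha> \<beta> \<longleftrightarrow>
     (\<exists>\<psi>s. length \<psi>s = occs x T \<beta> \<and> (\<forall>\<psi> \<in> set \<psi>s. erase \<psi> = \<phi>) \<and> \<alpha> = plug x T \<psi>s \<beta>)"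
| "ann_side (SubstT \<Gamma> \<Delta> x t) \<alpha> \<beta> \<longleftrightarrow> \<alpha> = tsubst (TFree(x := t)) \<beta>"
| "ann_side (EqL \<Gamma> \<Delta> x y s t) \<alpha> \<beta> \<longleftrightarrow>
     (\<exists>\<gamma>. \<alpha> = tsubst (TFree(x := s, y := t)) \<gamma> \<and> \<beta> = tsubst (TFree(x := t, y := s)) \<gamma>)"
| "ann_side _ \<alpha> \<beta> \<longleftrightarrow> \<beta> = \<alpha>"

definition ann_beta :: "annotated \<Rightarrow> annotated \<Rightarrow> bool" where
  "ann_beta \<alpha> \<beta> \<longleftrightarrow>
     (\<exists>A \<phi> a as. \<alpha> = apps (Lam A \<phi>) (a # as) \<and> \<beta> = apps (inst 0 a \<phi>) as)"

definition ann_unfold :: "nat \<Rightarrow> annotated \<Rightarrow> annotated \<Rightarrow> bool" where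
  "ann_unfold k \<alpha> \<beta> \<longleftrightarrow>
     (\<exists>\<sigma> p T \<phi> as. \<alpha> = apps (Fix \<sigma> p T \<phi>) as \<and>
        \<beta> = apps (inst 0 (FArg (Fix \<sigma> (p @ [k]) T \<phi>)) \<phi>) as)"

text \<open>
  The principal case. \<open>j\<close> is the number of the premise, \<open>(d, i)\<close> the occurrence in it, and
  \<open>k\<close> the number used if a fixed-point operator is unfolded.
\<close>

fun ann_principal :: "rule \<Rightarrow> nat \<Rightarrow> occurrence \<Rightarrow> nat \<Rightarrow> annotated \<Rightarrow> annotated \<Rightarrow> bool" where
  "ann_principal (OrL \<Gamma> \<Delta> \<phi> \<psi>) j (d, i) k \<alpha> \<beta> \<longleftrightarrow>
     (\<exists>\<alpha>1 \<alpha>2. \<alpha> = Or \<alpha>1 \<alpha>2 \<and> \<beta> = (if j = 0 then \<alpha>1 else \<alpha>2))"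
| "ann_principal (OrR \<Gamma> \<Delta> \<phi> \<psi>) j (d, i) k \<alpha> \<beta> \<longleftrightarrow>
     (\<exists>\<alpha>1 \<alpha>2. \<alpha> = Or \<alpha>1 \<alpha>2 \<and> \<beta> = (if i = 0 then \<alpha>1 else \<alpha>2))"
| "ann_principal (AndL \<Gamma> \<Delta> \<phi> \<psi>) j (d, i) k \<alpha> \<beta> \<longleftrightarrow>
     (\<exists>\<alpha>1 \<alpha>2. \<alpha> = And \<alpha>1 \<alpha>2 \<and> \<beta> = (if i = length \<Gamma> then \<alpha>1 else \<alpha>2))"
| "ann_principal (AndR \<Gamma> \<Delta> \<phi> \<psi>) j (d, i) k \<alpha> \<beta> \<longleftrightarrow>
     (\<exists>\<alpha>1 \<alpha>2. \<alpha> = And \<alpha>1 \<alpha>2 \<and> \<beta> = (if j = 0 then \<alpha>1 else \<alpha>2))"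
| "ann_principal (LamL \<Gamma> \<Delta> A \<phi> a as) j (d, i) k \<alpha> \<beta> \<longleftrightarrow> ann_beta \<alpha> \<beta>"
| "ann_principal (LamR \<Gamma> \<Delta> A \<phi> a as) j (d, i) k \<alpha> \<beta> \<longleftrightarrow> ann_beta \<alpha> \<beta>"
| "ann_principal (FixL \<Gamma> \<Delta> \<sigma> T \<phi> as) j (d, i) k \<alpha> \<beta> \<longleftrightarrow> ann_unfold k \<alpha> \<beta>"
| "ann_principal (FixR \<Gamma> \<Delta> \<sigma> T \<phi> as) j (d, i) k \<alpha> \<beta> \<longleftrightarrow> ann_unfold k \<alpha> \<beta>"
| "ann_principal (Mono \<Gamma> \<Delta> x T \<phi> \<psi> \<chi> ys) j (d, i) k \<alpha> \<beta> \<longleftrightarrow>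
     (\<exists>\<phi>' \<psi>s. erase \<phi>' = \<phi> \<and> length \<psi>s = occs x T \<phi> \<and>
        (\<forall>\<psi>' \<in> set \<psi>s. erase \<psi>' = (if d = Lft then \<psi> else \<chi>)) \<and>
        \<alpha> = plug x T \<psi>s \<phi>' \<and> \<beta> = apps (\<psi>s ! j) (map var_arg ys))"
| "ann_principal (P2 \<Gamma> \<Delta> s t) j (d, i) k \<alpha> \<beta> \<longleftrightarrow> \<beta> = Eq s t"
| "ann_principal _ j (d, i) k \<alpha> \<beta> \<longleftrightarrow> \<beta> = \<alpha>"

definition ann_rule ::
  "rule \<Rightarrow> nat \<Rightarrow> occurrence \<Rightarrow> occurrence \<Rightarrow> nat \<Rightarrow> annotated \<Rightarrow> annotated \<Rightarrow> bool" where
  "ann_rule r j oc oc' k \<alpha> \<beta> \<longleftrightarrow>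
     (if principal r oc then ann_principal r j oc' k \<alpha> \<beta> else ann_side r \<alpha> \<beta>)"


section \<open>Pre-proofs\<close>

datatype deriv = Open sequent | Inf rule "deriv list"

fun end_sequent :: "deriv \<Rightarrow> sequent" where
  "end_sequent (Open S) = S"
| "end_sequent (Inf r ds) = concl r"

fun derivation :: "deriv \<Rightarrow> bool" where
  "derivation (Open S) \<longleftrightarrow> wf_sequent S"
| "derivation (Inf r ds) \<longleftrightarrow> wf_rule r \<and> map end_sequent ds = prems r \<and> (\<forall>d \<in> set ds. derivation d)"

text \<open>A node is the list of premise numbers on the way from the root to it.\<close>

type_synonym node = "nat list"

fun subderiv :: "deriv \<Rightarrow> node \<Rightarrow> deriv option" where
  "subderiv d [] = Some d"
| "subderiv (Open S) (j # p) = None"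
| "subderiv (Inf r ds) (j # p) = (if j < length ds then subderiv (ds ! j) p else None)"

text \<open>
  In a pre-proof \<open>(D, R)\<close> only the values of \<open>R\<close> at the open leaves of \<open>D\<close> matter.
\<close>

type_synonym preproof = "deriv \<times> (node \<Rightarrow> node)"

fun pre_proof :: "preproof \<Rightarrow> bool" where
  "pre_proof (D, R) \<longleftrightarrow> derivation D \<and>
     (\<forall>p S. subderiv D p = Some (Open S) \<longrightarrow>
        (\<exists>r ds. subderiv D (R p) = Some (Inf r ds) \<and> ds \<noteq> [] \<and> concl r = S))"

fun sequent_at :: "preproof \<Rightarrow> node \<Rightarrow> sequent" where
  "sequent_at (D, R) p = end_sequent (the (subderiv D p))"

definition valid_occ :: "preproof \<Rightarrow> node \<Rightarrow> occurrence \<Rightarrow> bool" where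
  "valid_occ P p oc \<longleftrightarrow> snd oc < length (formulas (fst oc) (sequent_at P p))"

definition formula_at :: "preproof \<Rightarrow> node \<Rightarrow> occurrence \<Rightarrow> form" where
  "formula_at P p oc = formulas (fst oc) (sequent_at P p) ! snd oc"

text \<open>\<open>rule_at P p r\<close>: the node \<open>p\<close> is the conclusion of the rule instance \<open>r\<close>.\<close>

fun rule_at :: "preproof \<Rightarrow> node \<Rightarrow> rule \<Rightarrow> bool" where
  "rule_at (D, R) p r \<longleftrightarrow> (\<exists>ds. subderiv D p = Some (Inf r ds))"

fun path_step :: "preproof \<Rightarrow> node \<Rightarrow> node \<Rightarrow> bool" where
  "path_step (D, R) p q \<longleftrightarrow>
     (case subderiv D p of
        None \<Rightarrow> False
      | Some (Open S) \<Rightarrow> q = R p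
      | Some (Inf r ds) \<Rightarrow> (\<exists>j < length ds. q = p @ [j]))"

definition infinite_path :: "preproof \<Rightarrow> (nat \<Rightarrow> node) \<Rightarrow> bool" where
  "infinite_path P n \<longleftrightarrow> (\<forall>i. path_step P (n i) (n (Suc i)))"


section \<open>Traces and the global trace condition\<close>

text \<open>
  Relevance and inheritance of annotations along one step of a path. If \<open>p\<close> is not an open leaf,
  then \<open>q = p @ [j]\<close> is the \<open>j\<close>-th premise of \<open>p\<close> and \<open>j = last q\<close>; if \<open>p\<close> is an open leaf, then \<open>q\<close>
  has the same sequent as \<open>p\<close>.
\<close>

fun relevant_step :: "preproof \<Rightarrow> node \<Rightarrow> node \<Rightarrow> occurrence \<Rightarrow> occurrence \<Rightarrow> bool" where
  "relevant_step (D, R) p q oc oc' \<longleftrightarrow>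
     (case subderiv D p of
        None \<Rightarrow> False
      | Some (Open S) \<Rightarrow> oc' = oc
      | Some (Inf r ds) \<Rightarrow> relevant r (last q) oc oc')"

fun ann_step ::
  "preproof \<Rightarrow> node \<Rightarrow> node \<Rightarrow> occurrence \<Rightarrow> occurrence \<Rightarrow> nat \<Rightarrow> annotated \<Rightarrow> annotated \<Rightarrow> bool"
where
  "ann_step (D, R) p q oc oc' k \<alpha> \<beta> \<longleftrightarrow>
     (case subderiv D p of
        None \<Rightarrow> False
      | Some (Open S) \<Rightarrow> \<beta> = \<alpha>
      | Some (Inf r ds) \<Rightarrow> ann_rule r (last q) oc oc' k \<alpha> \<beta>)"

definition is_trace :: "preproof \<Rightarrow> (nat \<Rightarrow> node) \<Rightarrow> (nat \<Rightarrow> occurrence) \<Rightarrow> bool" where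
  "is_trace P n \<tau> \<longleftrightarrow>
     (\<forall>i. valid_occ P (n i) (\<tau> i) \<and> relevant_step P (n i) (n (Suc i)) (\<tau> i) (\<tau> (Suc i))) \<and>
     infinite {i. \<exists>r. rule_at P (n i) r \<and> logical r \<and> principal r (\<tau> i)}"

definition unfold_steps :: "preproof \<Rightarrow> (nat \<Rightarrow> node) \<Rightarrow> (nat \<Rightarrow> occurrence) \<Rightarrow> nat set" where
  "unfold_steps P n \<tau> = {i. \<exists>r. rule_at P (n i) r \<and> unfolding_rule r \<and> principal r (\<tau> i)}"

text \<open>
  \<open>\<kappa> i\<close> is the number used in the \<open>i\<close>-th step if a fixed-point operator is unfolded in that step;
  injectivity says that it has not been used before.
\<close>

definition annotation ::
  "preproof \<Rightarrow> (nat \<Rightarrow> node) \<Rightarrow> (nat \<Rightarrow> occurrence) \<Rightarrow> (nat \<Rightarrow> annotated) \<Rightarrow> bool" where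
  "annotation P n \<tau> \<alpha> \<longleftrightarrow>
     (\<forall>i. erase (\<alpha> i) = formula_at P (n i) (\<tau> i)) \<and>
     (\<forall>\<sigma>. labels \<sigma> (\<alpha> 0) \<subseteq> {[]}) \<and>
     (\<exists>\<kappa>. inj_on \<kappa> (unfold_steps P n \<tau>) \<and>
        (\<forall>i. ann_step P (n i) (n (Suc i)) (\<tau> i) (\<tau> (Suc i)) (\<kappa> i) (\<alpha> i) (\<alpha> (Suc i))))"

definition fix_trace ::
  "sgn \<Rightarrow> preproof \<Rightarrow> (nat \<Rightarrow> node) \<Rightarrow> (nat \<Rightarrow> occurrence) \<Rightarrow> bool" where
  "fix_trace \<sigma> P n \<tau> \<longleftrightarrow> is_trace P n \<tau> \<and>
     (\<exists>\<alpha> p. annotation P n \<tau> \<alpha> \<and> (\<forall>m. \<exists>i. map p [0..<m] \<in> labels \<sigma> (\<alpha> i)))"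

definition global_trace_condition :: "preproof \<Rightarrow> bool" where
  "global_trace_condition P \<longleftrightarrow>
     (\<forall>n. infinite_path P n \<longrightarrow>
        (\<exists>m \<tau>. (fst (\<tau> 0) = Lft \<and> fix_trace Mu P (\<lambda>i. n (m + i)) \<tau>) \<or>
               (fst (\<tau> 0) = Rgt \<and> fix_trace Nu P (\<lambda>i. n (m + i)) \<tau>)))"


section \<open>Goedel numbering of pre-proofs\<close>

fun aty_code :: "aty \<Rightarrow> nat" and fty_code :: "fty \<Rightarrow> nat" where
  "aty_code NatT = list_encode [0]"
| "aty_code (FormT T) = list_encode [1, fty_code T]"
| "fty_code Omega = list_encode [0]"
| "fty_code (Arrow A T) = list_encode [1, aty_code A, fty_code T]"

fun var_code :: "var \<Rightarrow> nat" where
  "var_code (x, A) = prod_encode (x, aty_code A)"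

primrec tm_code :: "tm \<Rightarrow> nat" where
  "tm_code (TFree x) = list_encode [0, x]"
| "tm_code (TBound i) = list_encode [1, i]"
| "tm_code Zero = list_encode [2]"
| "tm_code (Succ t) = list_encode [3, tm_code t]"

primrec sgn_code :: "sgn \<Rightarrow> nat" where
  "sgn_code Mu = 0"
| "sgn_code Nu = 1"

primrec fm_code :: "form \<Rightarrow> nat" where
  "fm_code (Eq s t) = list_encode [0, tm_code s, tm_code t]"
| "fm_code (Or \<phi> \<psi>) = list_encode [1, fm_code \<phi>, fm_code \<psi>]"
| "fm_code (And \<phi> \<psi>) = list_encode [2, fm_code \<phi>, fm_code \<psi>]"
| "fm_code (FFree x T) = list_encode [3, x, fty_code T]"
| "fm_code (FBound i) = list_encode [4, i]"
| "fm_code (Lam A \<phi>) = list_encode [5, aty_code A, fm_code \<phi>]"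
| "fm_code (AppF \<phi> \<psi>) = list_encode [6, fm_code \<phi>, fm_code \<psi>]"
| "fm_code (AppT \<phi> t) = list_encode [7, fm_code \<phi>, tm_code t]"
| "fm_code (Fix \<sigma> _ T \<phi>) = list_encode [8, sgn_code \<sigma>, fty_code T, fm_code \<phi>]"

primrec arg_code :: "unit arg \<Rightarrow> nat" where
  "arg_code (FArg \<phi>) = list_encode [0, fm_code \<phi>]"
| "arg_code (TArg t) = list_encode [1, tm_code t]"

definition fms_code :: "form list \<Rightarrow> nat" where
  "fms_code \<Gamma> = list_encode (map fm_code \<Gamma>)"

definition args_code :: "unit arg list \<Rightarrow> nat" where
  "args_code as = list_encode (map arg_code as)"

fun sequent_code :: "sequent \<Rightarrow> nat" where
  "sequent_code (\<Gamma>, \<Delta>) = prod_encode (fms_code \<Gamma>, fms_code \<Delta>)"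

primrec rule_code :: "rule \<Rightarrow> nat" where
  "rule_code (Axiom \<phi>) = list_encode [0, fm_code \<phi>]"
| "rule_code (Cut \<Gamma> \<Delta> \<phi>) = list_encode [1, fms_code \<Gamma>, fms_code \<Delta>, fm_code \<phi>]"
| "rule_code (WeakL \<Gamma> \<Delta> \<phi>) = list_encode [2, fms_code \<Gamma>, fms_code \<Delta>, fm_code \<phi>]"
| "rule_code (WeakR \<Gamma> \<Delta> \<phi>) = list_encode [3, fms_code \<Gamma>, fms_code \<Delta>, fm_code \<phi>]"
| "rule_code (ContrL \<Gamma> \<Delta> \<phi>) = list_encode [4, fms_code \<Gamma>, fms_code \<Delta>, fm_code \<phi>]"
| "rule_code (ContrR \<Gamma> \<Delta> \<phi>) = list_encode [5, fms_code \<Gamma>, fms_code \<Delta>, fm_code \<phi>]"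
| "rule_code (ExchL \<Gamma> \<phi> \<psi> \<Gamma>' \<Delta>) =
     list_encode [6, fms_code \<Gamma>, fm_code \<phi>, fm_code \<psi>, fms_code \<Gamma>', fms_code \<Delta>]"
| "rule_code (ExchR \<Gamma> \<Delta> \<phi> \<psi> \<Delta>') =
     list_encode [7, fms_code \<Gamma>, fms_code \<Delta>, fm_code \<phi>, fm_code \<psi>, fms_code \<Delta>']"
| "rule_code (SubstF \<Gamma> \<Delta> x T \<phi>) =
     list_encode [8, fms_code \<Gamma>, fms_code \<Delta>, x, fty_code T, fm_code \<phi>]"
| "rule_code (SubstT \<Gamma> \<Delta> x t) = list_encode [9, fms_code \<Gamma>, fms_code \<Delta>, x, tm_code t]"
| "rule_code (Mono \<Gamma> \<Delta> x T \<phi> \<psi> \<chi> ys) =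
     list_encode [10, fms_code \<Gamma>, fms_code \<Delta>, x, fty_code T, fm_code \<phi>, fm_code \<psi>, fm_code \<chi>,
       list_encode (map var_code ys)]"
| "rule_code (EqL \<Gamma> \<Delta> x y s t) =
     list_encode [11, fms_code \<Gamma>, fms_code \<Delta>, x, y, tm_code s, tm_code t]"
| "rule_code (EqR \<Gamma> \<Delta> t) = list_encode [12, fms_code \<Gamma>, fms_code \<Delta>, tm_code t]"
| "rule_code (OrL \<Gamma> \<Delta> \<phi> \<psi>) = list_encode [13, fms_code \<Gamma>, fms_code \<Delta>, fm_code \<phi>, fm_code \<psi>]"
| "rule_code (OrR \<Gamma> \<Delta> \<phi> \<psi>) = list_encode [14, fms_code \<Gamma>, fms_code \<Delta>, fm_code \<phi>, fm_code \<psi>]"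
| "rule_code (AndL \<Gamma> \<Delta> \<phi> \<psi>) = list_encode [15, fms_code \<Gamma>, fms_code \<Delta>, fm_code \<phi>, fm_code \<psi>]"
| "rule_code (AndR \<Gamma> \<Delta> \<phi> \<psi>) = list_encode [16, fms_code \<Gamma>, fms_code \<Delta>, fm_code \<phi>, fm_code \<psi>]"
| "rule_code (LamL \<Gamma> \<Delta> A \<phi> a as) =
     list_encode [17, fms_code \<Gamma>, fms_code \<Delta>, aty_code A, fm_code \<phi>, arg_code a, args_code as]"
| "rule_code (LamR \<Gamma> \<Delta> A \<phi> a as) =
     list_encode [18, fms_code \<Gamma>, fms_code \<Delta>, aty_code A, fm_code \<phi>, arg_code a, args_code as]"
| "rule_code (FixL \<Gamma> \<Delta> \<sigma> T \<phi> as) =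
     list_encode [19, fms_code \<Gamma>, fms_code \<Delta>, sgn_code \<sigma>, fty_code T, fm_code \<phi>, args_code as]"
| "rule_code (FixR \<Gamma> \<Delta> \<sigma> T \<phi> as) =
     list_encode [20, fms_code \<Gamma>, fms_code \<Delta>, sgn_code \<sigma>, fty_code T, fm_code \<phi>, args_code as]"
| "rule_code (NatRule \<Gamma> \<Delta> x) = list_encode [21, fms_code \<Gamma>, fms_code \<Delta>, x]"
| "rule_code (P1 s) = list_encode [22, tm_code s]"
| "rule_code (P2 \<Gamma> \<Delta> s t) = list_encode [23, fms_code \<Gamma>, fms_code \<Delta>, tm_code s, tm_code t]"

primrec deriv_code :: "deriv \<Rightarrow> nat" where
  "deriv_code (Open S) = list_encode [0, sequent_code S]"
| "deriv_code (Inf r ds) = list_encode [1, rule_code r, list_encode (map deriv_code ds)]"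

fun open_leaves :: "deriv \<Rightarrow> node list" where
  "open_leaves (Open S) = [[]]"
| "open_leaves (Inf r ds) =
     concat (map (\<lambda>(j, ps). map ((#) j) ps) (enumerate 0 (map open_leaves ds)))"

text \<open>The map \<open>R\<close> is presented by its finite graph on the open leaves.\<close>

fun preproof_code :: "preproof \<Rightarrow> nat" where
  "preproof_code (D, R) =
     prod_encode (deriv_code D,
       list_encode (map (\<lambda>p. prod_encode (list_encode p, list_encode (R p))) (open_leaves D)))"

end

theory Submission
  imports Defs "HOL-Library.Ramsey"
begin

text \<open>
  The numbers that a trace appends to annotations are pairwise different, so an infinite sequence
  whose prefixes all occur as labels singles out one line of descent among the occurrences of
  fixed-point operators in the formulas of the trace, and this line is unfolded infinitely often.
  Conversely, such a line spells out an infinite sequence. The global trace condition thus becomes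
  a thread condition on a finite graph whose edges carry finite relations between positions of
  operators, as in size-change termination. By Ramsey's theorem it holds iff some finite set of
  triples (source, target, relation) contains all edges, is closed under composition, and in it
  every idempotent relation from a node to itself relates some position to itself with progress.
  The existence of such a set is a bounded search over codes, hence recursive.
\<close>

section \<open>Recursive functions\<close>

text \<open>Labels grow without bound, so annotations are not finite-state data. What remains finite
  is which operator descends from which: this depends only on the rule and on positions in erased
  formulas (\<open>pos_step\<close>), and an unfolding lengthens only the label of the operator at
  the head of the principal formula. As a number is appended at one step only, a label ending in x
  points back to one step and one position. Hence the ancestors of the labels along \<open>p\<close>
  fit together, and no compactness argument is needed to find the infinite line. The relation
  \<open>thread_step\<close> also relates positions at which no operator stands. From a progress
  step on, the position is that of an operator of the sign that counts, so threads are cut at such a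
  step; only then are the positions bounded. Certificates spare programming a closure: whatever has
  the three properties contains the graphs of all finite paths, so some certificate below a bound
  suffices. Ramsey's theorem serves the direction from certificates to threads; the converse repeats
  one finite path forever.\<close>

text \<open>
  \<open>recursive n f\<close> fixes the values of \<open>f\<close> on lists of every length; here only length \<open>n\<close> counts.
\<close>

definition rec_n :: "nat \<Rightarrow> (nat list \<Rightarrow> nat) \<Rightarrow> bool" where
  "rec_n n f \<longleftrightarrow> (\<exists>g. recursive n g \<and> (\<forall>xs. length xs = n \<longrightarrow> g xs = f xs))"

text \<open>Almost all of what follows is stated for functions of one number; further arguments are
  packed with \<open>pair\<close>. Closure rules then speak of a single variable and can be chained
  by \<open>intro\<close>.\<close>

definition rec_fun :: "(nat \<Rightarrow> nat) \<Rightarrow> bool" where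
  "rec_fun f \<longleftrightarrow> rec_n 1 (\<lambda>xs. f (xs ! 0))"

definition rec_pred :: "(nat \<Rightarrow> bool) \<Rightarrow> bool" where
  "rec_pred P \<longleftrightarrow> rec_fun (\<lambda>z. if P z then 1 else 0)"

lemma rec_n_proj: "i < n \<Longrightarrow> rec_n n (\<lambda>xs. xs ! i)"
  unfolding rec_n_def using recursive.proj by blast

lemma rec_n_zero: "rec_n n (\<lambda>_. 0)"
  unfolding rec_n_def using recursive.zero by blast

lemma rec_n_comp1:
  assumes "rec_n 1 (\<lambda>ys. F (ys ! 0))" "rec_n n g"
  shows "rec_n n (\<lambda>xs. F (g xs))"
proof -
  obtain F' g' where *: "recursive 1 F'" "\<And>ys. length ys = 1 \<Longrightarrow> F' ys = F (ys ! 0)"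
    "recursive n g'" "\<And>ys. length ys = n \<Longrightarrow> g' ys = g ys"
    using assms unfolding rec_n_def by blast
  have "recursive n (\<lambda>xs. F' (map (\<lambda>g. g xs) [g']))"
    by (rule recursive.comp) (use * in auto)
  then show ?thesis
    unfolding rec_n_def using * by force
qed

lemma rec_n_comp2:
  assumes "rec_n 2 (\<lambda>ys. F (ys ! 0) (ys ! 1))" "rec_n n g" "rec_n n h"
  shows "rec_n n (\<lambda>xs. F (g xs) (h xs))"
proof -
  obtain F' g' h' where *: "recursive 2 F'" "\<And>ys. length ys = 2 \<Longrightarrow> F' ys = F (ys ! 0) (ys ! 1)"
    "recursive n g'" "\<And>ys. length ys = n \<Longrightarrow> g' ys = g ys"
    "recursive n h'" "\<And>ys. length ys = n \<Longrightarrow> h' ys = h ys"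
    using assms unfolding rec_n_def by blast
  have "recursive n (\<lambda>xs. F' (map (\<lambda>g. g xs) [g', h']))"
    by (rule recursive.comp) (use * in \<open>auto simp: numeral_2_eq_2\<close>)
  then show ?thesis
    unfolding rec_n_def using * by force
qed

lemma rec_n_Suc: "rec_n n g \<Longrightarrow> rec_n n (\<lambda>xs. Suc (g xs))"
  by (rule rec_n_comp1) (use recursive.succ in \<open>auto simp: rec_n_def\<close>)

lemma rec_n_prec:
  assumes "rec_n n f" "rec_n (Suc (Suc n)) (\<lambda>ys. G (ys ! 0) (ys ! 1) (drop 2 ys))" "rec_n n h"
  shows "rec_n n (\<lambda>xs. rec_nat (f xs) (\<lambda>y r. G y r xs) (h xs))"
proof -
  obtain f' G' h' where *: "recursive n f'" "\<And>ys. length ys = n \<Longrightarrow> f' ys = f ys"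
    "recursive (Suc (Suc n)) G'"
    "\<And>ys. length ys = Suc (Suc n) \<Longrightarrow> G' ys = G (ys ! 0) (ys ! 1) (drop 2 ys)"
    "recursive n h'" "\<And>ys. length ys = n \<Longrightarrow> h' ys = h ys"
    using assms unfolding rec_n_def by blast
  let ?R = "\<lambda>xs. rec_nat (f' (tl xs)) (\<lambda>y r. G' (y # r # tl xs)) (hd xs)"
  \<comment> \<open>\<open>prec\<close> recurses on its first argument. Composing it with
    \<open>h'\<close> and the projections puts \<open>h'\<close> there and keeps the whole list
    \<open>xs\<close> as parameters.\<close>
  let ?gs = "h' # map (\<lambda>i xs. xs ! i) [0..<n]"
  have R: "recursive (Suc n) ?R"
    by (rule recursive.prec) (use * in auto)
  have rec: "recursive n (\<lambda>xs. ?R (map (\<lambda>g. g xs) ?gs))"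
    by (rule recursive.comp) (use R * in \<open>auto intro: recursive.proj\<close>)
  have proj: "map (\<lambda>g. g xs) ?gs = h' xs # xs" if "length xs = n" for xs :: "nat list"
    using that by (auto simp: comp_def intro!: nth_equalityI)
  show ?thesis
    unfolding rec_n_def
  proof (rule exI, rule conjI[OF rec], intro allI impI)
    fix xs :: "nat list"
    assume len: "length xs = n"
    have "?R (h' xs # xs) = rec_nat (f xs) (\<lambda>y r. G y r xs) (h xs)"
      using len by (simp add: *)
    then show "?R (map (\<lambda>g. g xs) ?gs) = rec_nat (f xs) (\<lambda>y r. G y r xs) (h xs)"
      by (simp only: proj[OF len])
  qed
qed

lemma rec_n_add: "rec_n n f \<Longrightarrow> rec_n n g \<Longrightarrow> rec_n n (\<lambda>xs. f xs + g xs)"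
proof (rule rec_n_comp2[where F = "(+)"])
  have "rec_n 2 (\<lambda>ys. rec_nat (ys ! 0) (\<lambda>_ r. Suc r) (ys ! 1))"
    by (rule rec_n_prec) (auto intro!: rec_n_proj rec_n_Suc)
  moreover have "rec_nat a (\<lambda>_ r. Suc r) b = a + b" for a b :: nat
    by (induction b) auto
  ultimately show "rec_n 2 (\<lambda>ys. ys ! 0 + ys ! 1)" by simp
qed

lemma rec_n_pred: "rec_n n f \<Longrightarrow> rec_n n (\<lambda>xs. f xs - Suc 0)"
proof (rule rec_n_comp1[where F = "\<lambda>a. a - Suc 0"])
  have "rec_n 1 (\<lambda>ys. rec_nat 0 (\<lambda>y _. y) (ys ! 0))"
    by (rule rec_n_prec) (auto intro!: rec_n_proj rec_n_zero)
  moreover have "rec_nat 0 (\<lambda>y _. y) b = b - Suc 0" for b :: nat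
    by (cases b) auto
  ultimately show "rec_n 1 (\<lambda>ys. ys ! 0 - Suc 0)" by simp
qed

lemma rec_n_diff: "rec_n n f \<Longrightarrow> rec_n n g \<Longrightarrow> rec_n n (\<lambda>xs. f xs - g xs)"
proof (rule rec_n_comp2[where F = "(-)"])
  have "rec_n 2 (\<lambda>ys. rec_nat (ys ! 0) (\<lambda>_ r. r - Suc 0) (ys ! 1))"
    by (rule rec_n_prec) (auto intro!: rec_n_proj rec_n_pred)
  moreover have "rec_nat a (\<lambda>_ r. r - Suc 0) b = a - b" for a b :: nat
    by (induction b) auto
  ultimately show "rec_n 2 (\<lambda>ys. ys ! 0 - ys ! 1)" by simp
qed

lemma rec_n_triangle: "rec_n n f \<Longrightarrow> rec_n n (\<lambda>xs. triangle (f xs))"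
proof (rule rec_n_comp1[where F = triangle])
  have "rec_n 1 (\<lambda>ys. rec_nat 0 (\<lambda>y r. r + Suc y) (ys ! 0))"
    by (rule rec_n_prec) (auto intro!: rec_n_proj rec_n_Suc rec_n_add rec_n_zero)
  moreover have "rec_nat 0 (\<lambda>y r. r + Suc y) b = triangle b" for b
    by (induction b) auto
  ultimately show "rec_n 1 (\<lambda>ys. triangle (ys ! 0))" by simp
qed

section \<open>Cantor pairing and its projections\<close>

abbreviation pair :: "nat \<Rightarrow> nat \<Rightarrow> nat" where
  "pair a b \<equiv> prod_encode (a, b)"

definition pfst :: "nat \<Rightarrow> nat" where "pfst z = fst (prod_decode z)"
definition psnd :: "nat \<Rightarrow> nat" where "psnd z = snd (prod_decode z)"

lemma pfst_pair [simp]: "pfst (pair a b) = a" and psnd_pair [simp]: "psnd (pair a b) = b"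
  by (simp_all add: pfst_def psnd_def)

lemma pair_pfst_psnd [simp]: "pair (pfst z) (psnd z) = z"
  by (simp add: pfst_def psnd_def)

lemma pfst_0 [simp]: "pfst 0 = 0" and psnd_0 [simp]: "psnd 0 = 0"
  using pfst_pair[of 0 0] psnd_pair[of 0 0] by (simp_all add: prod_encode_def del: pfst_pair psnd_pair)

lemma rec_n_pair: "rec_n n f \<Longrightarrow> rec_n n g \<Longrightarrow> rec_n n (\<lambda>xs. pair (f xs) (g xs))"
  unfolding prod_encode_def prod.case by (intro rec_n_add rec_n_triangle)

lemma triangle_mono: "m \<le> n \<Longrightarrow> triangle m \<le> triangle n"
  by (induction n) (auto simp: le_Suc_eq)

text \<open>The number \<open>a + b\<close> of the diagonal of Cantor's pairing on which
  \<open>pair a b\<close> lies. The summand \<open>1 - (triangle (Suc k) - z)\<close> is 1 exactly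
  if \<open>triangle (Suc k) \<le> z\<close>, so the recursion counts the diagonals that start later
  than 0 and not after \<open>z\<close>.\<close>

definition diagonal :: "nat \<Rightarrow> nat" where
  "diagonal z = rec_nat 0 (\<lambda>k r. r + (1 - (triangle (Suc k) - z))) z"

lemma diagonal_pair: "diagonal (pair a b) = a + b"
proof -
  define z where "z = pair a b"
  have z: "triangle (a + b) \<le> z" "z < triangle (Suc (a + b))"
    by (simp_all add: z_def prod_encode_def)
  have "rec_nat 0 (\<lambda>k r. r + (1 - (triangle (Suc k) - z))) m = min m (a + b)" for m
  proof (induction m)
    case (Suc m)
    show ?case
    proof (cases "Suc m \<le> a + b")
      case True
      then have "triangle (Suc m) \<le> z" using z triangle_mono le_trans by blast
      then show ?thesis using Suc True by simp
    next
      case False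
      then have "triangle (Suc m) > z" using z triangle_mono[of "Suc (a + b)" "Suc m"] by simp
      then show ?thesis using Suc False by simp
    qed
  qed simp
  \<comment> \<open>The recursion runs \<open>z\<close> times, which is long enough because
    \<open>a + b\<close> is at most \<open>z\<close>.\<close>
  moreover have "k \<le> triangle k" for k by (induction k) auto
  then have "a + b \<le> z" using z(1) le_trans by blast
  ultimately show ?thesis unfolding diagonal_def by (simp add: z_def)
qed

lemma rec_n_diagonal: "rec_n n f \<Longrightarrow> rec_n n (\<lambda>xs. diagonal (f xs))"
proof (rule rec_n_comp1[where F = diagonal])
  have drop: "rec_n 3 (\<lambda>ys. drop 2 ys ! 0)"
    using rec_n_proj[of 2 3] unfolding rec_n_def by simp
  show "rec_n 1 (\<lambda>ys. diagonal (ys ! 0))"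
    unfolding diagonal_def
    by (rule rec_n_prec)
      (use drop in \<open>auto intro!: rec_n_proj rec_n_Suc rec_n_add rec_n_zero rec_n_diff rec_n_triangle
        simp del: triangle_Suc simp: numeral_3_eq_3\<close>)
qed

lemma pfst_eq: "pfst z = z - triangle (diagonal z)"
proof -
  have "pair a b - triangle (diagonal (pair a b)) = a" for a b
    unfolding diagonal_pair by (simp add: prod_encode_def)
  from this[of "pfst z" "psnd z"] show ?thesis by simp
qed

lemma psnd_eq: "psnd z = diagonal z - pfst z"
  by (metis add_diff_cancel_left' diagonal_pair pair_pfst_psnd)

section \<open>Closure of recursive functions and predicates of one number\<close>

lemma rec_fun_comp: "rec_fun F \<Longrightarrow> rec_fun f \<Longrightarrow> rec_fun (\<lambda>z. F (f z))"
  unfolding rec_fun_def by (rule rec_n_comp1)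

lemma rec_fun_id: "rec_fun (\<lambda>z. z)"
  unfolding rec_fun_def by (rule rec_n_proj) simp

lemma rec_fun_Suc: "rec_fun f \<Longrightarrow> rec_fun (\<lambda>z. Suc (f z))"
  unfolding rec_fun_def by (rule rec_n_Suc)

lemma rec_fun_const: "rec_fun (\<lambda>_. c)"
  by (induction c) (auto simp: rec_fun_def intro: rec_n_zero rec_n_Suc)

lemma rec_fun_add: "rec_fun f \<Longrightarrow> rec_fun g \<Longrightarrow> rec_fun (\<lambda>z. f z + g z)"
  unfolding rec_fun_def by (rule rec_n_add)

lemma rec_fun_diff: "rec_fun f \<Longrightarrow> rec_fun g \<Longrightarrow> rec_fun (\<lambda>z. f z - g z)"
  unfolding rec_fun_def by (rule rec_n_diff)

lemma rec_fun_pair: "rec_fun f \<Longrightarrow> rec_fun g \<Longrightarrow> rec_fun (\<lambda>z. pair (f z) (g z))"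
  unfolding rec_fun_def by (rule rec_n_pair)

lemma rec_fun_pfst: "rec_fun f \<Longrightarrow> rec_fun (\<lambda>z. pfst (f z))"
  unfolding rec_fun_def pfst_eq by (intro rec_n_diff rec_n_triangle rec_n_diagonal)

lemma rec_fun_psnd: "rec_fun f \<Longrightarrow> rec_fun (\<lambda>z. psnd (f z))"
  using rec_fun_pfst[of f] unfolding rec_fun_def psnd_eq by (intro rec_n_diff rec_n_diagonal)

text \<open>The counter, the accumulator and the parameter of the recursion step reach it as one
  number \<open>w\<close>, in this order.\<close>

lemma rec_fun_rec:
  assumes "rec_fun b" "rec_fun (\<lambda>w. s (pfst w) (pfst (psnd w)) (psnd (psnd w)))" "rec_fun n"
  shows "rec_fun (\<lambda>z. rec_nat (b z) (\<lambda>y r. s y r z) (n z))"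
proof -
  have "rec_n 3 (\<lambda>ys. s (ys ! 0) (ys ! 1) (ys ! 2))"
    using rec_n_comp1[OF assms(2)[unfolded rec_fun_def],
        of 3 "\<lambda>ys. pair (ys ! 0) (pair (ys ! 1) (ys ! 2))"]
    by (simp add: rec_n_pair rec_n_proj)
  then have "rec_n 3 (\<lambda>ys. s (ys ! 0) (ys ! 1) (drop 2 ys ! 0))"
    unfolding rec_n_def by simp
  then show ?thesis
    using assms(1,3) unfolding rec_fun_def
    by (intro rec_n_prec[where G = "\<lambda>y r xs. s y r (xs ! 0)"])
      (simp_all add: numeral_3_eq_3)
qed

lemma rec_fun_if:
  assumes "rec_pred P" "rec_fun f" "rec_fun g"
  shows "rec_fun (\<lambda>z. if P z then f z else g z)"
proof -
  \<comment> \<open>Definition by cases as a recursion that runs once or not at all.\<close>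
  have "rec_fun (\<lambda>z. rec_nat (g z) (\<lambda>y r. f z) (if P z then 1 else 0))"
    by (rule rec_fun_rec) (use assms in \<open>auto simp: rec_pred_def
        intro!: rec_fun_comp[where F = f] rec_fun_psnd rec_fun_id\<close>)
  moreover have "rec_nat (g z) (\<lambda>y r. f z) (if P z then 1 else 0) = (if P z then f z else g z)" for z
    by simp
  ultimately show ?thesis by simp
qed

lemma rec_pred_comp: "rec_pred P \<Longrightarrow> rec_fun f \<Longrightarrow> rec_pred (\<lambda>z. P (f z))"
  unfolding rec_pred_def by (rule rec_fun_comp)

lemma rec_pred_not: "rec_pred P \<Longrightarrow> rec_pred (\<lambda>z. \<not> P z)"
proof -
  assume "rec_pred P"
  then have "rec_fun (\<lambda>z. if P z then 0 else 1)"
    by (intro rec_fun_if rec_fun_const)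
  then show ?thesis
    unfolding rec_pred_def by (rule back_subst[where P = rec_fun]) auto
qed

lemma rec_pred_conj: "rec_pred P \<Longrightarrow> rec_pred Q \<Longrightarrow> rec_pred (\<lambda>z. P z \<and> Q z)"
proof -
  assume P: "rec_pred P" and "rec_pred Q"
  then have "rec_fun (\<lambda>z. if P z then if Q z then 1 else 0 else 0)"
    by (intro rec_fun_if rec_fun_const)
  moreover have "(\<lambda>z. if P z then if Q z then 1 else 0 else 0) = (\<lambda>z. if P z \<and> Q z then 1 else 0 :: nat)"
    by auto
  ultimately show ?thesis
    unfolding rec_pred_def by (simp only:)
qed

lemma rec_pred_disj:
  assumes "rec_pred P" "rec_pred Q"
  shows "rec_pred (\<lambda>z. P z \<or> Q z)"
proof -
  have "rec_pred (\<lambda>z. \<not> (\<not> P z \<and> \<not> Q z))"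
    by (intro rec_pred_not rec_pred_conj assms)
  then show ?thesis by (simp only: de_Morgan_conj not_not)
qed

lemma rec_pred_imp: "rec_pred P \<Longrightarrow> rec_pred Q \<Longrightarrow> rec_pred (\<lambda>z. P z \<longrightarrow> Q z)"
  unfolding imp_conv_disj by (rule rec_pred_disj[OF rec_pred_not])

lemma rec_pred_iff: "rec_pred P \<Longrightarrow> rec_pred Q \<Longrightarrow> rec_pred (\<lambda>z. P z \<longleftrightarrow> Q z)"
  unfolding iff_conv_conj_imp by (rule rec_pred_conj[OF rec_pred_imp rec_pred_imp])

lemma rec_pred_const: "rec_pred (\<lambda>_. b)"
  unfolding rec_pred_def by (cases b) (auto intro: rec_fun_const)

lemma rec_pred_if: "rec_pred P \<Longrightarrow> rec_pred Q \<Longrightarrow> rec_pred R \<Longrightarrow> rec_pred (\<lambda>z. if P z then Q z else R z)"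
  unfolding if_bool_eq_conj by (intro rec_pred_conj rec_pred_imp rec_pred_not)

lemma rec_pred_le:
  assumes "rec_fun f" "rec_fun g"
  shows "rec_pred (\<lambda>z. f z \<le> g z)"
proof -
  have "(\<lambda>z. if f z \<le> g z then 1 else 0) = (\<lambda>z. 1 - (f z - g z))" by auto
  then show ?thesis
    unfolding rec_pred_def using assms by (auto intro: rec_fun_diff rec_fun_const)
qed

lemma rec_pred_less: "rec_fun f \<Longrightarrow> rec_fun g \<Longrightarrow> rec_pred (\<lambda>z. f z < g z)"
  using rec_pred_le[OF rec_fun_Suc] by (simp add: Suc_le_eq)

lemma rec_pred_eq: "rec_fun f \<Longrightarrow> rec_fun g \<Longrightarrow> rec_pred (\<lambda>z. f z = g z)"
  unfolding order.eq_iff by (intro rec_pred_conj rec_pred_le)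

lemma rec_pred_bex:
  assumes "rec_fun n" "rec_pred (\<lambda>w. P (pfst w) (psnd w))"
  shows "rec_pred (\<lambda>z. \<exists>y<n z. P y z)"
proof -
  \<comment> \<open>The accumulator becomes 1 at the first witness and stays 1.\<close>
  have "rec_fun (\<lambda>z. rec_nat 0 (\<lambda>y r. if r = 1 \<or> P y z then 1 else 0) (n z))"
    by (intro rec_fun_rec rec_fun_if rec_pred_disj rec_pred_eq rec_fun_const rec_fun_pfst
        rec_fun_psnd rec_fun_id assms(1)
        rec_pred_comp[OF assms(2), of "\<lambda>w. pair (pfst w) (psnd (psnd w))", simplified] rec_fun_pair)
  moreover have "rec_nat 0 (\<lambda>y r. if r = 1 \<or> P y z then 1 else 0) m =
    (if \<exists>y<m. P y z then 1 else 0 :: nat)" for z m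
    by (induction m) (auto simp: less_Suc_eq)
  ultimately show ?thesis unfolding rec_pred_def by simp
qed

lemma rec_pred_ball:
  assumes "rec_fun n" "rec_pred (\<lambda>w. P (pfst w) (psnd w))"
  shows "rec_pred (\<lambda>z. \<forall>y<n z. P y z)"
  using rec_pred_not[OF rec_pred_bex[OF assms(1) rec_pred_not[OF assms(2)]]] by simp

lemma rec_fun_sum:
  assumes "rec_fun n" "rec_fun (\<lambda>w. f (pfst w) (psnd w))"
  shows "rec_fun (\<lambda>z. \<Sum>y<n z. f y z)"
proof -
  have "rec_fun (\<lambda>z. rec_nat 0 (\<lambda>y r. r + f y z) (n z))"
    by (intro rec_fun_rec rec_fun_const rec_fun_add rec_fun_pfst
        rec_fun_psnd rec_fun_id assms(1)
        rec_fun_comp[OF assms(2), of "\<lambda>w. pair (pfst w) (psnd (psnd w))", simplified] rec_fun_pair)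
  moreover have "rec_nat 0 (\<lambda>y r. r + f y z) m = (\<Sum>y<m. f y z)" for z m
    by (induction m) auto
  ultimately show ?thesis by simp
qed

text \<open>With these rules recursiveness follows from the shape of a definition alone. This is why
  every predicate on codes below uses only bounded quantifiers, sums and iterations.\<close>

lemmas rec_intros =
  rec_fun_id rec_fun_const rec_fun_Suc rec_fun_add rec_fun_diff rec_fun_pair rec_fun_pfst
  rec_fun_psnd rec_fun_rec rec_fun_if rec_fun_sum
  rec_pred_not rec_pred_conj rec_pred_disj rec_pred_imp rec_pred_iff rec_pred_const rec_pred_if
  rec_pred_le rec_pred_less rec_pred_eq rec_pred_bex rec_pred_ball

section \<open>Lists of numbers as numbers\<close>

definition llen :: "nat \<Rightarrow> nat" where "llen u = length (list_decode u)"

text \<open>The default 0 matters: it is the code of the empty list and of no formula, so a walk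
  that leaves a code ends in 0 and is recognised as failed.\<close>

definition lnth :: "nat \<Rightarrow> nat \<Rightarrow> nat" where
  "lnth u i = (if i < length (list_decode u) then list_decode u ! i else 0)"

definition lapp :: "nat \<Rightarrow> nat \<Rightarrow> nat" where
  "lapp u v = list_encode (list_decode u @ list_decode v)"

definition lrep :: "nat \<Rightarrow> nat \<Rightarrow> nat" where "lrep n x = list_encode (replicate n x)"

lemma llen_list_encode [simp]: "llen (list_encode xs) = length xs"
  by (simp add: llen_def)

lemma lnth_list_encode [simp]: "lnth (list_encode xs) i = (if i < length xs then xs ! i else 0)"
  by (simp add: lnth_def)

lemma lapp_list_encode [simp]: "lapp (list_encode xs) (list_encode ys) = list_encode (xs @ ys)"
  by (simp add: lapp_def)

lemma pair_mono: "a \<le> a' \<Longrightarrow> b \<le> b' \<Longrightarrow> pair a b \<le> pair a' b'"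
  by (simp add: prod_encode_def add_mono triangle_mono)

lemma length_le_list_encode: "length xs \<le> list_encode xs"
proof (induction xs)
  case (Cons x xs)
  then show ?case using le_prod_encode_2[of "list_encode xs" x] by simp
qed simp

lemma mem_less_list_encode: "x \<in> set xs \<Longrightarrow> x < list_encode xs"
proof (induction xs)
  case (Cons y xs)
  then show ?case
    using le_prod_encode_1[of y "list_encode xs"] le_prod_encode_2[of "list_encode xs" y] by auto
qed simp

lemma list_encode_prefix_le: "list_encode xs \<le> list_encode (xs @ ys)"
  by (induction xs) (auto intro: pair_mono)

lemma list_encode_suffix_le: "list_encode ys \<le> list_encode (xs @ ys)"
proof (induction xs)
  case (Cons x xs)
  then show ?case using le_prod_encode_2[of "list_encode (xs @ ys)" x] by simp
qed simp

text \<open>As \<open>pair\<close> is monotone, the constant list of greatest length and greatest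
  entry has the greatest code. The bounds on nodes, positions, graphs and certificates all come from
  here.\<close>

lemma list_encode_le_lrep:
  "length xs \<le> n \<Longrightarrow> (\<And>x. x \<in> set xs \<Longrightarrow> x \<le> m) \<Longrightarrow> list_encode xs \<le> lrep n m"
proof (induction xs arbitrary: n)
  case (Cons x xs)
  then obtain n' where "n = Suc n'" by (cases n) auto
  then show ?case using Cons by (auto simp: lrep_def intro!: pair_mono)
qed simp

lemma rec_fun_tails: 
  assumes "rec_fun f" "rec_fun g"
  shows "rec_fun (\<lambda>z. list_encode (drop (g z) (list_decode (f z))))"
proof -
  \<comment> \<open>A nonempty list is coded as \<open>Suc (pair head tail)\<close>. For the empty
    list \<open>0 - 1 = 0\<close> and \<open>psnd 0 = 0\<close>, which agrees with
    \<open>tl [] = []\<close>.\<close>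
  have tl: "psnd (u - 1) = list_encode (tl (list_decode u))" for u
    by (cases u) (auto simp: psnd_0[unfolded psnd_def] psnd_def split: prod.split)
  have "rec_nat u (\<lambda>_ r. psnd (r - 1)) k = list_encode (drop k (list_decode u))" for u k
  proof (induction k)
    case (Suc k)
    then show ?case using tl[of "list_encode (drop k (list_decode u))"] by (simp add: tl_drop drop_Suc)
  qed simp
  moreover have "rec_fun (\<lambda>z. rec_nat (f z) (\<lambda>_ r. psnd (r - 1)) (g z))"
    by (intro rec_intros assms)
  ultimately show ?thesis by simp
qed

lemma rec_fun_lnth:
  assumes "rec_fun f" "rec_fun g"
  shows "rec_fun (\<lambda>z. lnth (f z) (g z))"
proof -
  have "pfst (list_encode (drop i (list_decode u)) - 1) = lnth u i" for u i
  proof (cases "i < length (list_decode u)")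
    case True
    then show ?thesis by (simp add: lnth_def Cons_nth_drop_Suc[symmetric])
  next
    case False
    then show ?thesis by (simp add: lnth_def)
  qed
  then show ?thesis
    using rec_fun_pfst[OF rec_fun_diff[OF rec_fun_tails[OF assms] rec_fun_const[of 1]]] by simp
qed

text \<open>The length is the number of nonempty tails. Counting them below the code itself is
  enough, since a list is never longer than its code.\<close>

lemma rec_fun_llen:
  assumes "rec_fun f"
  shows "rec_fun (\<lambda>z. llen (f z))"
proof -
  have "(\<Sum>k<u. if list_encode (drop k (list_decode u)) = 0 then 0 else 1) = llen u" for u
  proof -
    have zero: "list_encode (drop k (list_decode u)) = 0 \<longleftrightarrow> llen u \<le> k" for k
      by (cases "drop k (list_decode u)") (auto simp: llen_def)
    have "{k. k < u \<and> k < llen u} = {..<llen u}"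
      using length_le_list_encode[of "list_decode u"] by (auto simp: llen_def)
    then show ?thesis
      by (simp add: zero sum.If_cases Int_def not_le lessThan_def)
  qed
  moreover have "rec_fun (\<lambda>z. \<Sum>k<f z. if list_encode (drop k (list_decode (f z))) = 0 then 0 else 1)"
    by (intro rec_intros rec_fun_tails assms rec_fun_comp[OF assms])
  ultimately show ?thesis by simp
qed

lemma rec_fun_lapp:
  assumes "rec_fun f" "rec_fun g"
  shows "rec_fun (\<lambda>z. lapp (f z) (g z))"
proof -
  \<comment> \<open>The entries of the first list are put in front of the second one, the last entry
    first.\<close>
  have "rec_nat v (\<lambda>k r. Suc (pair (lnth (list_encode xs) (length xs - Suc k)) r)) k =
      list_encode (drop (length xs - k) xs @ list_decode v)" if "k \<le> length xs" for xs v k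
    using that
  proof (induction k)
    case (Suc k)
    have "drop (length xs - Suc k) xs = xs ! (length xs - Suc k) # drop (length xs - k) xs"
      using Suc.prems Cons_nth_drop_Suc[of "length xs - Suc k" xs] by (simp add: Suc_diff_Suc)
    moreover have "length xs - Suc k < length xs" using Suc.prems by simp
    ultimately show ?case using Suc by simp
  qed simp
  note * = this
  have "rec_nat v (\<lambda>k r. Suc (pair (lnth u (llen u - Suc k)) r)) (llen u) = lapp u v" for u v
    using *[of "llen u" "list_decode u" v] by (simp add: lapp_def llen_def)
  moreover have "rec_fun (\<lambda>z. rec_nat (g z)
      (\<lambda>k r. Suc (pair (lnth (f z) (llen (f z) - Suc k)) r)) (llen (f z)))"
    by (intro rec_intros rec_fun_lnth rec_fun_llen assms rec_fun_comp[OF assms(1)])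
  ultimately show ?thesis by simp
qed

lemma rec_fun_lrep:
  assumes "rec_fun f" "rec_fun g"
  shows "rec_fun (\<lambda>z. lrep (f z) (g z))"
proof -
  have "rec_nat 0 (\<lambda>k r. Suc (pair x r)) n = lrep n x" for x n
    by (induction n) (auto simp: lrep_def)
  moreover have "rec_fun (\<lambda>z. rec_nat 0 (\<lambda>k r. Suc (pair (g z) r)) (f z))"
    by (intro rec_intros assms rec_fun_comp[OF assms(2)])
  ultimately show ?thesis by simp
qed

lemmas rec_intros_list = rec_intros rec_fun_lnth rec_fun_llen rec_fun_lapp rec_fun_lrep

section \<open>The thread condition\<close>

text \<open>Infinitely many finite segments, \<open>f k\<close> on the interval from
  \<open>z k\<close> to \<open>z (Suc k)\<close>, are joined where they agree. \<open>P\<close> is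
  left open because this serves twice: for the loops found by Ramsey's theorem and for the line of
  descent of labels.\<close>

lemma glue_segments:
  fixes z :: "nat \<Rightarrow> nat" and f :: "nat \<Rightarrow> nat \<Rightarrow> 'a" and b :: "nat \<Rightarrow> nat \<Rightarrow> bool"
  assumes z: "\<And>k. z k < z (Suc k)"
    and ends: "\<And>k. f k (z (Suc k)) = f (Suc k) (z (Suc k))"
    and steps: "\<And>k l. z k \<le> l \<Longrightarrow> l < z (Suc k) \<Longrightarrow> P l (b k l) (f k l) (f k (Suc l))"
    and progress: "\<And>k. \<exists>l. z k \<le> l \<and> l < z (Suc k) \<and> b k l"
  shows "\<exists>\<sigma> \<beta>. (\<forall>l\<ge>z 0. P l (\<beta> l) (\<sigma> l) (\<sigma> (Suc l))) \<and> infinite {l. z 0 \<le> l \<and> \<beta> l}"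
proof -
  have zmono: "i < j \<Longrightarrow> z i < z j" for i j using z by (rule lift_Suc_mono_less)
  \<comment> \<open>The segment in which \<open>l\<close> lies; the least number exists because
    \<open>z\<close> increases strictly.\<close>
  define ix where "ix l = (LEAST k. l < z (Suc k))" for l
  have zk: "k \<le> z k" for k using zmono strict_mono_imp_increasing[of z] by (simp add: strict_mono_def)
  have ix1: "l < z (Suc (ix l))" for l
    unfolding ix_def by (rule LeastI[of _ l]) (use zk[of "Suc l"] in simp)
  have ix2: "z (ix l) \<le> l" if "z 0 \<le> l" for l
  proof (cases "ix l")
    case (Suc k)
    then have "\<not> l < z (Suc k)" unfolding ix_def using not_less_Least[of k "\<lambda>k. l < z (Suc k)"] by simp
    then show ?thesis using Suc by simp
  qed (use that in simp)
  have ix_eq: "ix l = k" if "z k \<le> l" "l < z (Suc k)" for l k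
  proof -
    have "z 0 \<le> l" using that zmono[of 0 k] by (cases k) auto
    have "\<not> ix l < k" using ix1[of l] that zmono[of "Suc (ix l)" k] by (cases "Suc (ix l) = k") auto
    moreover have "\<not> k < ix l" using ix2[OF \<open>z 0 \<le> l\<close>] that zmono[of "Suc k" "ix l"] by (cases "Suc k = ix l") auto
    ultimately show ?thesis by simp
  qed
  define \<sigma> where "\<sigma> l = f (ix l) l" for l
  define \<beta> where "\<beta> l = b (ix l) l" for l
  have "P l (\<beta> l) (\<sigma> l) (\<sigma> (Suc l))" if "z 0 \<le> l" for l
  proof -
    let ?k = "ix l"
    have "\<sigma> (Suc l) = f ?k (Suc l)"
    proof (cases "Suc l < z (Suc ?k)")
      case True
      then have "ix (Suc l) = ?k" using ix2[OF that] by (intro ix_eq) auto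
      then show ?thesis by (simp add: \<sigma>_def)
    next
      case False
      then have "Suc l = z (Suc ?k)" using ix1[of l] by simp
      then show ?thesis using ix_eq[of "Suc ?k" "Suc l"] z[of "Suc ?k"] ends[of ?k] by (simp add: \<sigma>_def)
    qed
    then show ?thesis using steps[OF ix2[OF that] ix1] by (simp add: \<sigma>_def \<beta>_def)
  qed
  moreover have "infinite {i. z 0 \<le> i \<and> \<beta> i}"
    unfolding infinite_nat_iff_unbounded_le
  proof
    fix m
    obtain l where l: "z m \<le> l" "l < z (Suc m)" "b m l" using progress by blast
    then have "\<beta> l" using ix_eq[of m l] by (simp add: \<beta>_def)
    moreover have "z 0 \<le> z m" using zmono[of 0 m] by (cases m) auto
    ultimately show "\<exists>i\<ge>m. i \<in> {i. z 0 \<le> i \<and> \<beta> i}" using l zk[of m] by (intro exI[of _ l]) auto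
  qed
  ultimately show ?thesis by blast
qed

section \<open>Size-change graphs along a path\<close>

type_synonym graph = "(nat \<times> bool \<times> nat) set"

text \<open>An arc is a source, a progress flag and a target. A composite arc makes progress if one
  of its parts does; arcs with and without progress may join the same two positions.\<close>

definition gcomp :: "graph \<Rightarrow> graph \<Rightarrow> graph" where
  "gcomp g h = {(s, b \<or> b', t) | s b u b' t. (s, b, u) \<in> g \<and> (u, b', t) \<in> h}"

abbreviation run ::
  "(nat \<Rightarrow> nat \<Rightarrow> graph) \<Rightarrow> (nat \<Rightarrow> nat) \<Rightarrow> nat \<Rightarrow> nat \<Rightarrow> (nat \<Rightarrow> nat) \<Rightarrow> (nat \<Rightarrow> bool) \<Rightarrow> bool"
where
  "run E n i j \<sigma> \<beta> \<equiv> \<forall>l. i \<le> l \<and> l < j \<longrightarrow> (\<sigma> l, \<beta> l, \<sigma> (Suc l)) \<in> E (n l) (n (Suc l))"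

definition threads :: "(nat \<Rightarrow> nat \<Rightarrow> graph) \<Rightarrow> (nat \<Rightarrow> nat) \<Rightarrow> nat \<Rightarrow> nat \<Rightarrow> graph" where
  "threads E n i j = {(s, b, t). \<exists>\<sigma> \<beta>. \<sigma> i = s \<and> \<sigma> j = t \<and>
     (run E n i j \<sigma> \<beta>) \<and>
     (b \<longleftrightarrow> (\<exists>l. i \<le> l \<and> l < j \<and> \<beta> l))}"

definition thread_condition :: "(nat \<Rightarrow> nat \<Rightarrow> bool) \<Rightarrow> (nat \<Rightarrow> nat \<Rightarrow> graph) \<Rightarrow> bool" where
  "thread_condition step E \<longleftrightarrow>
     (\<forall>n. (\<forall>i. step (n i) (n (Suc i))) \<longrightarrow>
       (\<exists>m \<sigma> \<beta>. (\<forall>i\<ge>m. (\<sigma> i, \<beta> i, \<sigma> (Suc i)) \<in> E (n i) (n (Suc i))) \<and> infinite {i. m \<le> i \<and> \<beta> i}))"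

text \<open>\<open>S\<close> may contain more than the graphs of actual paths, at the price that the
  condition on idempotents binds the surplus too. So nobody has to compute the exact
  closure.\<close>

definition certificate ::
  "(nat \<Rightarrow> nat \<Rightarrow> bool) \<Rightarrow> (nat \<Rightarrow> nat \<Rightarrow> graph) \<Rightarrow> (nat \<times> nat \<times> graph) set \<Rightarrow> bool" where
  "certificate step E S \<longleftrightarrow>
     (\<forall>p q. step p q \<longrightarrow> (p, q, E p q) \<in> S) \<and>
     (\<forall>p q r g h. (p, q, g) \<in> S \<and> (q, r, h) \<in> S \<longrightarrow> (p, r, gcomp g h) \<in> S) \<and>
     (\<forall>p g. (p, p, g) \<in> S \<and> gcomp g g = g \<longrightarrow> (\<exists>s. (s, True, s) \<in> g))"

text \<open>The path must have at least one step. Its nodes are given as a total function, of which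
  only the values between \<open>i\<close> and \<open>j\<close> count; this avoids lists of
  nodes.\<close>

definition realized :: "(nat \<Rightarrow> nat \<Rightarrow> bool) \<Rightarrow> (nat \<Rightarrow> nat \<Rightarrow> graph) \<Rightarrow> (nat \<times> nat \<times> graph) set" where
  "realized step E = {(n i, n j, threads E n i j) | n i j.
     i < j \<and> (\<forall>l. i \<le> l \<and> l < j \<longrightarrow> step (n l) (n (Suc l)))}"

lemma threadsI:
  assumes "\<And>l. i \<le> l \<Longrightarrow> l < j \<Longrightarrow> (\<sigma> l, \<beta> l, \<sigma> (Suc l)) \<in> E (n l) (n (Suc l))"
    and "\<sigma> i = s" "\<sigma> j = t" "b \<longleftrightarrow> (\<exists>l. i \<le> l \<and> l < j \<and> \<beta> l)"
  shows "(s, b, t) \<in> threads E n i j"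
  unfolding threads_def mem_Collect_eq prod.case
  by (intro exI[of _ \<sigma>] exI[of _ \<beta>] conjI allI impI) (use assms in auto)

lemma threadsE:
  assumes "x \<in> threads E n i j"
  obtains \<sigma> \<beta> where "x = (\<sigma> i, \<exists>l. i \<le> l \<and> l < j \<and> \<beta> l, \<sigma> j)"
    "run E n i j \<sigma> \<beta>"
proof (cases x)
  case (fields s b t)
  obtain \<sigma> \<beta> where "\<sigma> i = s" "\<sigma> j = t"
     "run E n i j \<sigma> \<beta>"
     "b \<longleftrightarrow> (\<exists>l. i \<le> l \<and> l < j \<and> \<beta> l)"
    using assms unfolding fields threads_def mem_Collect_eq prod.case by blast
  then show ?thesis using that[of \<sigma> \<beta>] fields by simp
qed

lemma gcompI: "(s, b, u) \<in> g \<Longrightarrow> (u, b', t) \<in> h \<Longrightarrow> c = (b \<or> b') \<Longrightarrow> (s, c, t) \<in> gcomp g h"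
  unfolding gcomp_def by blast

lemma threads_one: "threads E n i (Suc i) = E (n i) (n (Suc i))"
proof (intro set_eqI iffI)
  fix x assume "x \<in> threads E n i (Suc i)"
  then obtain \<sigma> \<beta> where *: "x = (\<sigma> i, \<exists>l. i \<le> l \<and> l < Suc i \<and> \<beta> l, \<sigma> (Suc i))"
     "run E n i (Suc i) \<sigma> \<beta>"
    by (rule threadsE)
  have "(\<exists>l. i \<le> l \<and> l < Suc i \<and> \<beta> l) = \<beta> i" by (auto simp: le_less_Suc_eq)
  then show "x \<in> E (n i) (n (Suc i))" using * by auto
next
  fix x assume x: "x \<in> E (n i) (n (Suc i))"
  obtain s b t where [simp]: "x = (s, b, t)" by (cases x)
  show "x \<in> threads E n i (Suc i)"
    using x
    by (auto simp: le_less_Suc_eq intro!: threadsI[where \<sigma> = "\<lambda>l. if l = i then s else t" and \<beta> = "\<lambda>_. b"])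
qed

lemma threads_comp:
  assumes "i \<le> j" "j \<le> k"
  shows "threads E n i k = gcomp (threads E n i j) (threads E n j k)"
proof (intro set_eqI iffI)
  fix x assume "x \<in> threads E n i k"
  then obtain \<sigma> \<beta> where *: "x = (\<sigma> i, \<exists>l. i \<le> l \<and> l < k \<and> \<beta> l, \<sigma> k)"
     "run E n i k \<sigma> \<beta>"
    by (rule threadsE)
  have "(\<sigma> i, \<exists>l. i \<le> l \<and> l < j \<and> \<beta> l, \<sigma> j) \<in> threads E n i j"
    using * assms by (intro threadsI[where \<sigma> = \<sigma> and \<beta> = \<beta>]) auto
  moreover have "(\<sigma> j, \<exists>l. j \<le> l \<and> l < k \<and> \<beta> l, \<sigma> k) \<in> threads E n j k"
    using * assms by (intro threadsI[where \<sigma> = \<sigma> and \<beta> = \<beta>]) auto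
  moreover have "(\<exists>l. i \<le> l \<and> l < k \<and> \<beta> l) =
      ((\<exists>l. i \<le> l \<and> l < j \<and> \<beta> l) \<or> (\<exists>l. j \<le> l \<and> l < k \<and> \<beta> l))"
  proof
    assume "\<exists>l. i \<le> l \<and> l < k \<and> \<beta> l"
    then obtain l where "i \<le> l" "l < k" "\<beta> l" by blast
    then show "(\<exists>l. i \<le> l \<and> l < j \<and> \<beta> l) \<or> (\<exists>l. j \<le> l \<and> l < k \<and> \<beta> l)"
      by (cases "l < j") auto
  next
    assume "(\<exists>l. i \<le> l \<and> l < j \<and> \<beta> l) \<or> (\<exists>l. j \<le> l \<and> l < k \<and> \<beta> l)"
    then show "\<exists>l. i \<le> l \<and> l < k \<and> \<beta> l"
    proof (elim disjE exE)
      fix l assume "i \<le> l \<and> l < j \<and> \<beta> l"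
      then show ?thesis using assms by (intro exI[of _ l]) auto
    next
      fix l assume "j \<le> l \<and> l < k \<and> \<beta> l"
      then show ?thesis using assms by (intro exI[of _ l]) auto
    qed
  qed
  ultimately show "x \<in> gcomp (threads E n i j) (threads E n j k)"
    unfolding * by (rule gcompI)
next
  fix x assume "x \<in> gcomp (threads E n i j) (threads E n j k)"
  then obtain s b u b' t where x: "x = (s, b \<or> b', t)"
    and g: "(s, b, u) \<in> threads E n i j" and h: "(u, b', t) \<in> threads E n j k"
    unfolding gcomp_def by blast
  obtain \<sigma> \<beta> where 1: "\<sigma> i = s" "\<sigma> j = u" "b = (\<exists>l. i \<le> l \<and> l < j \<and> \<beta> l)"
     "run E n i j \<sigma> \<beta>"
    using g by (rule threadsE) simp
  obtain \<sigma>' \<beta>' where 2: "\<sigma>' j = u" "\<sigma>' k = t" "b' = (\<exists>l. j \<le> l \<and> l < k \<and> \<beta>' l)"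
     "run E n j k \<sigma>' \<beta>'"
    using h by (rule threadsE) simp
  let ?\<sigma> = "\<lambda>l. if l \<le> j then \<sigma> l else \<sigma>' l"
  let ?\<beta> = "\<lambda>l. if l < j then \<beta> l else \<beta>' l"
  have "(?\<sigma> l, ?\<beta> l, ?\<sigma> (Suc l)) \<in> E (n l) (n (Suc l))" if "i \<le> l" "l < k" for l
  proof -
    consider "Suc l \<le> j" | "l = j" | "j < l" by linarith
    then show ?thesis using that 1 2 by cases auto
  qed
  moreover have "?\<sigma> k = t" using 1 2 assms by (cases "k = j") auto
  moreover have "(b \<or> b') = (\<exists>l. i \<le> l \<and> l < k \<and> ?\<beta> l)"
  proof
    assume "b \<or> b'"
    then show "\<exists>l. i \<le> l \<and> l < k \<and> ?\<beta> l"
    proof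
      assume b
      then obtain l where "i \<le> l" "l < j" "\<beta> l" unfolding 1(3) by blast
      then show ?thesis using assms by (intro exI[of _ l]) auto
    next
      assume b'
      then obtain l where "j \<le> l" "l < k" "\<beta>' l" unfolding 2(3) by blast
      then show ?thesis using assms by (intro exI[of _ l]) auto
    qed
  next
    assume "\<exists>l. i \<le> l \<and> l < k \<and> ?\<beta> l"
    then obtain l where "i \<le> l" "l < k" "?\<beta> l" by blast
    then show "b \<or> b'" unfolding 1(3) 2(3) by (cases "l < j") auto
  qed
  ultimately show "x \<in> threads E n i k"
    unfolding x using 1 assms by (intro threadsI[where \<sigma> = ?\<sigma> and \<beta> = ?\<beta>]) auto
qed

lemma threads_cong:
  assumes "\<And>l. i \<le> l \<Longrightarrow> l \<le> j \<Longrightarrow> n l = n' l"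
  shows "threads E n i j = threads E n' i j"
proof -
  have "threads E m i j \<subseteq> threads E m' i j" if "\<And>l. i \<le> l \<Longrightarrow> l \<le> j \<Longrightarrow> m l = m' l" for m m'
  proof
    fix x assume "x \<in> threads E m i j"
    then obtain \<sigma> \<beta> where *: "x = (\<sigma> i, \<exists>l. i \<le> l \<and> l < j \<and> \<beta> l, \<sigma> j)"
      "run E m i j \<sigma> \<beta>"
      by (rule threadsE)
    show "x \<in> threads E m' i j"
      unfolding *(1) by (rule threadsI[where \<sigma> = \<sigma> and \<beta> = \<beta>]) (use *(2) that in auto)
  qed
  from this[of n n'] this[of n' n] show ?thesis using assms by fastforce
qed

lemma threads_shift: "threads E (\<lambda>l. n (l + d)) i j = threads E n (i + d) (j + d)"
proof (intro set_eqI iffI)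
  fix x assume "x \<in> threads E (\<lambda>l. n (l + d)) i j"
  then obtain \<sigma> \<beta> where *: "x = (\<sigma> i, \<exists>l. i \<le> l \<and> l < j \<and> \<beta> l, \<sigma> j)"
     "\<forall>l. i \<le> l \<and> l < j \<longrightarrow> (\<sigma> l, \<beta> l, \<sigma> (Suc l)) \<in> E (n (l + d)) (n (Suc l + d))"
    by (rule threadsE)
  have "(\<sigma> (l - d), \<beta> (l - d), \<sigma> (Suc l - d)) \<in> E (n l) (n (Suc l))" if "i + d \<le> l" "l < j + d" for l
  proof -
    have "d \<le> l" "i \<le> l - d" "l - d < j" using that by auto
    then show ?thesis using *(2)[rule_format, of "l - d"] by (simp add: Suc_diff_le)
  qed
  moreover have "(\<exists>l. i \<le> l \<and> l < j \<and> \<beta> l) = (\<exists>l. i + d \<le> l \<and> l < j + d \<and> \<beta> (l - d))"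
  proof
    assume "\<exists>l. i \<le> l \<and> l < j \<and> \<beta> l"
    then obtain l where "i \<le> l" "l < j" "\<beta> l" by blast
    then show "\<exists>l. i + d \<le> l \<and> l < j + d \<and> \<beta> (l - d)" by (intro exI[of _ "l + d"]) auto
  next
    assume "\<exists>l. i + d \<le> l \<and> l < j + d \<and> \<beta> (l - d)"
    then obtain l where "i + d \<le> l" "l < j + d" "\<beta> (l - d)" by blast
    then show "\<exists>l. i \<le> l \<and> l < j \<and> \<beta> l" by (intro exI[of _ "l - d"]) auto
  qed
  ultimately show "x \<in> threads E n (i + d) (j + d)"
    unfolding *
    by (intro threadsI[where \<sigma> = "\<lambda>l. \<sigma> (l - d)" and \<beta> = "\<lambda>l. \<beta> (l - d)"]) auto
next
  fix x assume "x \<in> threads E n (i + d) (j + d)"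
  then obtain \<sigma> \<beta> where *: "x = (\<sigma> (i + d), \<exists>l. i + d \<le> l \<and> l < j + d \<and> \<beta> l, \<sigma> (j + d))"
     "run E n (i + d) (j + d) \<sigma> \<beta>"
    by (rule threadsE)
  have "(\<exists>l. i + d \<le> l \<and> l < j + d \<and> \<beta> l) = (\<exists>l. i \<le> l \<and> l < j \<and> \<beta> (l + d))"
  proof
    assume "\<exists>l. i + d \<le> l \<and> l < j + d \<and> \<beta> l"
    then obtain l where "i + d \<le> l" "l < j + d" "\<beta> l" by blast
    then show "\<exists>l. i \<le> l \<and> l < j \<and> \<beta> (l + d)" by (intro exI[of _ "l - d"]) auto
  next
    assume "\<exists>l. i \<le> l \<and> l < j \<and> \<beta> (l + d)"
    then obtain l where "i \<le> l" "l < j" "\<beta> (l + d)" by blast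
    then show "\<exists>l. i + d \<le> l \<and> l < j + d \<and> \<beta> l" by (intro exI[of _ "l + d"]) auto
  qed
  then show "x \<in> threads E (\<lambda>l. n (l + d)) i j"
    unfolding *(1) using *(2)
    by (intro threadsI[where \<sigma> = "\<lambda>l. \<sigma> (l + d)" and \<beta> = "\<lambda>l. \<beta> (l + d)"]) auto
qed

section \<open>Graphs realized by finite paths\<close>

lemma realizedI:
  assumes "i < j" "\<And>l. i \<le> l \<Longrightarrow> l < j \<Longrightarrow> step (n l) (n (Suc l))"
    and "p = n i" "q = n j" "g = threads E n i j"
  shows "(p, q, g) \<in> realized step E"
  using assms unfolding realized_def by blast

lemma realized_base: "step p q \<Longrightarrow> (p, q, E p q) \<in> realized step E"
  by (rule realizedI[of 0 "Suc 0" _ "\<lambda>i. if i = 0 then p else q"])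
    (auto simp: threads_one)

lemma realized_comp:
  assumes "(p, q, g) \<in> realized step E" "(q, r, h) \<in> realized step E"
  shows "(p, r, gcomp g h) \<in> realized step E"
proof -
  obtain n i j where 1: "p = n i" "q = n j" "g = threads E n i j" "i < j"
    "\<And>l. i \<le> l \<Longrightarrow> l < j \<Longrightarrow> step (n l) (n (Suc l))"
    using assms(1) unfolding realized_def by blast
  obtain n' i' j' where 2: "q = n' i'" "r = n' j'" "h = threads E n' i' j'" "i' < j'"
    "\<And>l. i' \<le> l \<Longrightarrow> l < j' \<Longrightarrow> step (n' l) (n' (Suc l))"
    using assms(2) unfolding realized_def by blast
  \<comment> \<open>The two paths come with unrelated index ranges. Here the first is moved to start
    at 0 and the second is attached at \<open>j - i\<close>.\<close>
  define m where "m l = (if l \<le> j - i then n (l + i) else n' (l - (j - i) + i'))" for l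
  have m1: "threads E m 0 (j - i) = g"
  proof -
    have "threads E m 0 (j - i) = threads E (\<lambda>l. n (l + i)) 0 (j - i)"
      by (rule threads_cong) (simp add: m_def)
    then show ?thesis using 1 by (simp add: threads_shift)
  qed
  have m2': "m (l + (j - i)) = n' (l + i')" for l
  proof (cases "l = 0")
    case False
    then show ?thesis using 1(4) by (auto simp: m_def)
  qed (use 1 2 in \<open>simp add: m_def\<close>)
  have m2: "threads E m (j - i) (j - i + (j' - i')) = h"
    using threads_shift[of E m "j - i" 0 "j' - i'", symmetric] threads_shift[of E n' i' 0 "j' - i'"] 2
    by (simp add: m2' add.commute)
  have st: "step (m l) (m (Suc l))" if "l < j - i + (j' - i')" for l
  proof (cases "l < j - i")
    case True then show ?thesis using 1(5)[of "l + i"] by (simp add: m_def)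
  next
    case False
    then show ?thesis
      using 2(5)[of "l - (j - i) + i'"] m2'[of "l - (j - i)"] m2'[of "Suc l - (j - i)"] that
      by (simp add: Suc_diff_le)
  qed
  have "gcomp g h = threads E m 0 (j - i + (j' - i'))"
    using threads_comp[of 0 "j - i" "j - i + (j' - i')" E m] by (simp add: m1 m2)
  moreover have "m 0 = p" "m (j - i + (j' - i')) = r"
    using 1 2 m2'[of "j' - i'"] by (auto simp: m_def add.commute)
  ultimately show ?thesis
    using st 1(4) by (intro realizedI[of 0 "j - i + (j' - i')" _ m]) auto
qed

text \<open>By induction on the length of the path: its last edge is in \<open>S\<close>, and
  \<open>S\<close> is closed under composition.\<close>

lemma realized_subset_certificate:
  assumes "certificate step E S"
  shows "realized step E \<subseteq> S"
proof -
  have "(n i, n (Suc (i + d)), threads E n i (Suc (i + d))) \<in> S"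
    if "\<forall>l. i \<le> l \<and> l < Suc (i + d) \<longrightarrow> step (n l) (n (Suc l))" for n i d
    using that
  proof (induction d)
    case 0
    then show ?case using assms unfolding certificate_def by (simp add: threads_one)
  next
    case (Suc d)
    then have "(n i, n (Suc (i + d)), threads E n i (Suc (i + d))) \<in> S" by simp
    moreover have "(n (Suc (i + d)), n (Suc (Suc (i + d))),
        threads E n (Suc (i + d)) (Suc (Suc (i + d)))) \<in> S"
      using assms Suc.prems unfolding certificate_def by (simp add: threads_one)
    ultimately have "(n i, n (Suc (Suc (i + d))), gcomp (threads E n i (Suc (i + d)))
        (threads E n (Suc (i + d)) (Suc (Suc (i + d))))) \<in> S"
      using assms unfolding certificate_def by blast
    then show ?case
      using threads_comp[of i "Suc (i + d)" "Suc (Suc (i + d))" E n] by simp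
  qed
  then show ?thesis
    unfolding realized_def by (auto simp: less_iff_Suc_add)
qed

text \<open>Colour \<open>i < j\<close> by the two nodes and the graph of the segment between them.
  On an infinite homogeneous set all segments share one graph, which is then idempotent and leads
  from a node to itself; its progressing loop can be followed through every segment.\<close>

lemma thread_condition_if_loops:
  assumes fin: "finite {p. \<exists>q. step p q}" "finite (\<Union>p q. E p q)"
    and loops: "\<And>p g. (p, p, g) \<in> realized step E \<Longrightarrow> gcomp g g = g \<Longrightarrow> \<exists>s. (s, True, s) \<in> g"
  shows "thread_condition step E"
  unfolding thread_condition_def
proof (intro allI impI)
  fix n :: "nat \<Rightarrow> nat"
  assume n: "\<forall>i. step (n i) (n (Suc i))"
  define A where "A = (\<Union>p q. E p q)"
  define V where "V = fst ` A \<union> (snd \<circ> snd) ` A"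
  have V: "finite V" "\<And>p q s b t. (s, b, t) \<in> E p q \<Longrightarrow> s \<in> V \<and> t \<in> V"
  proof -
    show "finite V" using fin(2) unfolding V_def A_def by simp
    fix p q s b t assume "(s, b, t) \<in> E p q"
    then have "(s, b, t) \<in> A" unfolding A_def by blast
    then show "s \<in> V \<and> t \<in> V" unfolding V_def by (auto intro: rev_image_eqI)
  qed
  \<comment> \<open>All colours lie in this finite set. The last node of a segment has a successor
    as well, because the path goes on.\<close>
  define W where "W = {p. \<exists>q. step p q} \<times> {p. \<exists>q. step p q} \<times> Pow (V \<times> (UNIV :: bool set) \<times> V)"
  have "finite W" unfolding W_def 
    using fin(1) V(1) finite_cartesian_product[OF V(1) finite_cartesian_product[OF finite_UNIV V(1)]]
    by (intro finite_cartesian_product) simp_all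
  have mem: "(n i, n j, threads E n i j) \<in> W" if "i < j" for i j
  proof -
    have "s \<in> V \<and> t \<in> V" if st: "(s, b, t) \<in> threads E n i j" for s b t
    proof -
      obtain \<sigma> \<beta> where *: "\<sigma> i = s" "\<sigma> j = t"
        "run E n i j \<sigma> \<beta>"
        using st by (rule threadsE) simp
      show ?thesis
        using *(3)[rule_format, of i] *(3)[rule_format, of "j - 1"] *(1,2) V(2) \<open>i < j\<close>
        by (cases j) auto
    qed
    then show ?thesis using n unfolding W_def by auto
  qed
  obtain c :: "nat \<times> nat \<times> graph \<Rightarrow> nat" and k where c: "bij_betw c W {..<k}"
    using ex_bij_betw_finite_nat[OF \<open>finite W\<close>] by (auto simp: lessThan_atLeast0)
  \<comment> \<open>\<open>Ramsey2\<close> colours two-element sets by numbers; \<open>Min\<close>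
    and \<open>Max\<close> recover the order of the two indices.\<close>
  define f where "f X = c (n (Min X), n (Max X), threads E n (Min X) (Max X))" for X
  have fk: "f {x, y} < k" if "x \<noteq> y" for x y
  proof -
    have "Min {x, y} < Max {x, y}" using that by auto
    from mem[OF this] show ?thesis using c unfolding f_def bij_betw_def by blast
  qed
  obtain Y t where Y: "infinite Y" "\<And>x y. x \<in> Y \<Longrightarrow> y \<in> Y \<Longrightarrow> x \<noteq> y \<Longrightarrow> f {x, y} = t"
    using Ramsey2[of "UNIV :: nat set" f k] fk by auto
  define z where "z = enumerate Y"
  have z: "z i \<in> Y" "z i < z (Suc i)" for i
    unfolding z_def using Y(1) by (auto simp: enumerate_in_set enumerate_step)
  have zmono: "i < j \<Longrightarrow> z i < z j" for i j using z(2) by (rule lift_Suc_mono_less)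
  have same: "(n (z i), n (z j), threads E n (z i) (z j)) =
      (n (z 0), n (z 1), threads E n (z 0) (z 1))" if "i < j" for i j
  proof -
    have "f {z i, z j} = f {z 0, z 1}"
      using Y(2)[OF z(1)[of i] z(1)[of j]] Y(2)[OF z(1)[of 0] z(1)[of 1]] zmono[OF that] zmono[of 0 1]
      by simp
    moreover have "Min {z i, z j} = z i" "Max {z i, z j} = z j" "Min {z 0, z 1} = z 0" "Max {z 0, z 1} = z 1"
      using zmono[OF that] zmono[of 0 1] by auto
    ultimately have "c (n (z i), n (z j), threads E n (z i) (z j)) =
      c (n (z 0), n (z 1), threads E n (z 0) (z 1))" unfolding f_def by simp
    then show ?thesis
      by (rule inj_onD[OF bij_betw_imp_inj_on[OF c]]) (use mem[OF zmono[OF that]] mem[OF zmono[of 0 1]] in simp_all)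
  qed
  define g where "g = threads E n (z 0) (z 1)"
  have "(n (z 0), n (z 0), g) \<in> realized step E"
  proof -
    \<comment> \<open>The segments starting at \<open>z 0\<close> and at \<open>z 1\<close> have the
      same colour, hence the same first node.\<close>
    have "n (z 1) = n (z 0)" using same[of 1 2] by simp
    then show ?thesis
      using n zmono[of 0 1] by (intro realizedI[of "z 0" "z 1" _ n]) (auto simp: g_def)
  qed
  \<comment> \<open>The segment from \<open>z 0\<close> to \<open>z 2\<close> has the colour of each
    of its two halves.\<close>
  moreover have "gcomp g g = g"
    using threads_comp[of "z 0" "z 1" "z 2" E n] zmono[of 0 1] zmono[of 1 2] same[of 0 2] same[of 1 2]
    unfolding g_def by simp
  ultimately obtain s where s: "(s, True, s) \<in> g" using loops by blast
  have "\<forall>k. \<exists>\<sigma> \<beta>. \<sigma> (z k) = s \<and> \<sigma> (z (Suc k)) = s \<and>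
     (run E n (z k) (z (Suc k)) \<sigma> \<beta>) \<and>
     (\<exists>l. z k \<le> l \<and> l < z (Suc k) \<and> \<beta> l)"
  proof
    fix k
    have "(s, True, s) \<in> threads E n (z k) (z (Suc k))"
      using s same[of k "Suc k"] unfolding g_def by simp
    then obtain \<sigma> \<beta> where "(s, True, s) = (\<sigma> (z k), \<exists>l. z k \<le> l \<and> l < z (Suc k) \<and> \<beta> l, \<sigma> (z (Suc k)))"
      "run E n (z k) (z (Suc k)) \<sigma> \<beta>"
      by (rule threadsE)
    then show "\<exists>\<sigma> \<beta>. \<sigma> (z k) = s \<and> \<sigma> (z (Suc k)) = s \<and>
     (run E n (z k) (z (Suc k)) \<sigma> \<beta>) \<and>
     (\<exists>l. z k \<le> l \<and> l < z (Suc k) \<and> \<beta> l)"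
      by (intro exI[of _ \<sigma>] exI[of _ \<beta>]) auto
  qed
  from choice[OF this] obtain \<sigma>s where "\<forall>k. \<exists>\<beta>. \<sigma>s k (z k) = s \<and> \<sigma>s k (z (Suc k)) = s \<and>
     (\<forall>l. z k \<le> l \<and> l < z (Suc k) \<longrightarrow> (\<sigma>s k l, \<beta> l, \<sigma>s k (Suc l)) \<in> E (n l) (n (Suc l))) \<and>
     (\<exists>l. z k \<le> l \<and> l < z (Suc k) \<and> \<beta> l)" ..
  from choice[OF this] obtain \<beta>s where "\<forall>k. \<sigma>s k (z k) = s \<and> \<sigma>s k (z (Suc k)) = s \<and>
     (\<forall>l. z k \<le> l \<and> l < z (Suc k) \<longrightarrow> (\<sigma>s k l, \<beta>s k l, \<sigma>s k (Suc l)) \<in> E (n l) (n (Suc l))) \<and>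
     (\<exists>l. z k \<le> l \<and> l < z (Suc k) \<and> \<beta>s k l)" ..
  then have sb: "\<And>k. \<sigma>s k (z k) = s" "\<And>k. \<sigma>s k (z (Suc k)) = s"
    "\<And>k l. z k \<le> l \<Longrightarrow> l < z (Suc k) \<Longrightarrow> (\<sigma>s k l, \<beta>s k l, \<sigma>s k (Suc l)) \<in> E (n l) (n (Suc l))"
    "\<And>k. \<exists>l. z k \<le> l \<and> l < z (Suc k) \<and> \<beta>s k l"
    by blast+
  have "\<exists>\<sigma> \<beta>. (\<forall>l\<ge>z 0. (\<sigma> l, \<beta> l, \<sigma> (Suc l)) \<in> E (n l) (n (Suc l))) \<and>
      infinite {l. z 0 \<le> l \<and> \<beta> l}"
    by (rule glue_segments[where P = "\<lambda>l b s t. (s, b, t) \<in> E (n l) (n (Suc l))"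
          and f = \<sigma>s and b = \<beta>s]) (simp_all add: z sb)
  then show "\<exists>m \<sigma> \<beta>. (\<forall>i\<ge>m. (\<sigma> i, \<beta> i, \<sigma> (Suc i)) \<in> E (n i) (n (Suc i))) \<and>
      infinite {i. m \<le> i \<and> \<beta> i}"
    by blast
qed

text \<open>Repeat the finite path behind \<open>g\<close> forever and take a thread along it. It
  meets some position at infinitely many multiples of the period; between two of them with progress
  in between it runs through a power of \<open>g\<close>, which is \<open>g\<close> by
  idempotence.\<close>

lemma loops_if_thread_condition:
  assumes fin: "finite (\<Union>p q. E p q)" and tc: "thread_condition step E"
    and g: "(p, p, g) \<in> realized step E" "gcomp g g = g"
  shows "\<exists>s. (s, True, s) \<in> g"
proof -
  obtain n0 i0 j0 where n0: "p = n0 i0" "p = n0 j0" "g = threads E n0 i0 j0" "i0 < j0"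
    "\<And>l. i0 \<le> l \<Longrightarrow> l < j0 \<Longrightarrow> step (n0 l) (n0 (Suc l))"
    using g(1) unfolding realized_def by blast
  define d where "d = j0 - i0"
  have d: "0 < d" using n0 d_def by simp
  define n where "n l = n0 (l mod d + i0)" for l
  \<comment> \<open>The end of a round, \<open>l = k * d + d\<close>, is included: both ends of the
    finite path are \<open>p\<close>.\<close>
  have n_eq: "n l = n0 (l - k * d + i0)" if "k * d \<le> l" "l \<le> k * d + d" for l k
  proof (cases "l = k * d + d")
    case True
    then have "l mod d = 0" by simp
    then show ?thesis using n0 True by (simp add: n_def d_def)
  next
    case False
    define x where "x = l - k * d"
    have x: "l = x + k * d" "x < d" using that False by (auto simp: x_def)
    then have "l mod d = l - k * d" by simp
    then show ?thesis by (simp add: n_def)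
  qed
  have le_kd: "x \<le> k * d" if "x \<le> k" for x k :: nat
    using that mult_le_mono[of x k 1 d] d by simp
  have T: "threads E n (k * d) (k * d + d) = g" for k
  proof -
    have "threads E n (k * d) (k * d + d) = threads E (\<lambda>l. n (l + k * d)) 0 d"
      by (simp add: threads_shift add.commute)
    also have "\<dots> = threads E (\<lambda>l. n0 (l + i0)) 0 d"
      by (rule threads_cong) (use n_eq[of k] in auto)
    also have "\<dots> = g" using n0 by (simp add: threads_shift d_def)
    finally show ?thesis .
  qed
  have Tm: "threads E n (k * d) ((k + Suc m) * d) = g" for k m
  proof (induction m)
    case 0 show ?case using T[of k] by (simp add: add.commute)
  next
    case (Suc m)
    have "threads E n (k * d) ((k + Suc (Suc m)) * d) =
       gcomp (threads E n (k * d) ((k + Suc m) * d)) (threads E n ((k + Suc m) * d) ((k + Suc m) * d + d))"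
      using threads_comp[of "k * d" "(k + Suc m) * d" "(k + Suc m) * d + d" E n]
      by (simp add: algebra_simps)
    then show ?case using Suc T[of "k + Suc m"] g(2) by simp
  qed
  have "step (n l) (n (Suc l))" for l
  proof -
    define k where "k = l div d"
    have k: "k * d \<le> l" "l < k * d + d"
      unfolding k_def using d dividend_less_div_times[of d l] by (simp_all add: add.commute)
    then have "step (n0 (l - k * d + i0)) (n0 (Suc (l - k * d + i0)))"
      using n0(5)[of "l - k * d + i0"] d_def by auto
    then show ?thesis using n_eq[of k l] n_eq[of k "Suc l"] k by (simp add: Suc_diff_le)
  qed
  then obtain m \<sigma> \<beta> where th: "\<And>i. i \<ge> m \<Longrightarrow> (\<sigma> i, \<beta> i, \<sigma> (Suc i)) \<in> E (n i) (n (Suc i))"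
    "infinite {i. m \<le> i \<and> \<beta> i}"
    using tc unfolding thread_condition_def by blast
  have "finite (fst ` (\<Union>p q. E p q))" using fin by simp
  moreover have "(\<lambda>k. \<sigma> (k * d)) ` {m..} \<subseteq> fst ` (\<Union>p q. E p q)"
  proof (rule image_subsetI)
    fix k assume "k \<in> {m..}"
    then have "m \<le> k * d" using le_kd by simp
    from th(1)[OF this] show "\<sigma> (k * d) \<in> fst ` (\<Union>p q. E p q)" by force
  qed
  ultimately have "finite ((\<lambda>k. \<sigma> (k * d)) ` {m..})" by (rule rev_finite_subset)
  then obtain k0 where k0: "k0 \<in> {m..}" "infinite {k \<in> {m..}. \<sigma> (k * d) = \<sigma> (k0 * d)}"
    using pigeonhole_infinite[of "{m..}" "\<lambda>k. \<sigma> (k * d)"] infinite_Ici by blast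
  have mk: "m \<le> k0 * d" using k0(1) le_kd by simp
  obtain i where i: "i \<ge> k0 * d" "\<beta> i"
    using th(2) unfolding infinite_nat_iff_unbounded_le by blast
  \<comment> \<open>A return to the same position that lies beyond the progress step
    \<open>i\<close>.\<close>
  obtain k where k: "k \<ge> Suc (i + k0)" "\<sigma> (k * d) = \<sigma> (k0 * d)"
    using k0(2) unfolding infinite_nat_iff_unbounded_le by blast
  have "i < k * d" using k(1) le_kd[of "Suc i" k] by simp
  then have "(\<sigma> (k0 * d), True, \<sigma> (k * d)) \<in> threads E n (k0 * d) (k * d)"
    using th(1) mk i by (intro threadsI[where \<sigma> = \<sigma> and \<beta> = \<beta>]) auto
  moreover have "threads E n (k0 * d) (k * d) = g"
    using Tm[of k0 "k - k0 - 1"] k(1) by simp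
  ultimately show ?thesis using k(2) by auto
qed

lemma certificate_realized:
  assumes "finite (\<Union>p q. E p q)" "thread_condition step E"
  shows "certificate step E (realized step E)"
  unfolding certificate_def
proof (intro conjI allI impI)
  show "(p, q, E p q) \<in> realized step E" if "step p q" for p q
    using that by (rule realized_base)
  show "(p, r, gcomp g h) \<in> realized step E"
    if "(p, q, g) \<in> realized step E \<and> (q, r, h) \<in> realized step E" for p q r g h
    using that realized_comp by (elim conjE)
  show "\<exists>s. (s, True, s) \<in> g" if "(p, p, g) \<in> realized step E \<and> gcomp g g = g" for p g
    using that loops_if_thread_condition[OF assms] by (elim conjE)
qed

lemma thread_condition_if_certificate:
  assumes "finite {p. \<exists>q. step p q}" "finite (\<Union>p q. E p q)" "certificate step E S"
  shows "thread_condition step E"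
proof (rule thread_condition_if_loops[OF assms(1,2)])
  fix p g assume "(p, p, g) \<in> realized step E" "gcomp g g = g"
  then have 1: "(p, p, g) \<in> S \<and> gcomp g g = g"
    using realized_subset_certificate[OF assms(3)] by auto
  have 2: "\<forall>p g. (p, p, g) \<in> S \<and> gcomp g g = g \<longrightarrow> (\<exists>s. (s, True, s) \<in> g)"
    using assms(3) unfolding certificate_def by (elim conjE)
  show "\<exists>s. (s, True, s) \<in> g" by (rule mp[OF spec[OF spec[OF 2]] 1])
qed

subsection \<open>Deciding the thread condition\<close>

definition lmem :: "nat \<Rightarrow> nat \<Rightarrow> bool" where "lmem v u \<longleftrightarrow> v \<in> set (list_decode u)"

lemma rec_pred_lmem:
  assumes "rec_fun f" "rec_fun g"
  shows "rec_pred (\<lambda>z. lmem (f z) (g z))"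
proof -
  have "lmem v u \<longleftrightarrow> (\<exists>k<llen u. lnth u k = v)" for v u
    unfolding lmem_def in_set_conv_nth by (auto simp: llen_def lnth_def)
  moreover have "rec_pred (\<lambda>z. \<exists>k<llen (g z). lnth (g z) k = f z)"
    by (intro rec_intros_list assms rec_fun_comp[OF assms(1)] rec_fun_comp[OF assms(2)])
  ultimately show ?thesis by simp
qed

lemma lmem_less: "lmem v u \<Longrightarrow> v < u"
  unfolding lmem_def using mem_less_list_encode[of v "list_decode u"] by simp

abbreviation triple :: "nat \<Rightarrow> nat \<Rightarrow> nat \<Rightarrow> nat" where
  "triple a b c \<equiv> pair a (pair b c)"

definition flag :: "bool \<Rightarrow> nat" where "flag b = (if b then 1 else 0)"

text \<open>Any number can be read as a graph: order, repetitions and entries that are no arcs below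
  \<open>M\<close> are ignored. A graph thus has many codes, and graphs are compared by quantifying
  over arcs, never by equality of codes.\<close>

definition graph_of :: "nat \<Rightarrow> nat \<Rightarrow> graph" where
  "graph_of M u = {(s, b, t). s < M \<and> t < M \<and> lmem (triple s (flag b) t) u}"

definition comp_code :: "nat \<Rightarrow> nat \<Rightarrow> nat \<Rightarrow> nat \<Rightarrow> nat \<Rightarrow> nat \<Rightarrow> bool" where
  "comp_code M g h s b t \<longleftrightarrow> (\<exists>u<M. \<exists>b1<2. \<exists>b2<2. lmem (triple s b1 u) g \<and> lmem (triple u b2 t) h \<and>
      (b = 0 \<longleftrightarrow> b1 = 0 \<and> b2 = 0))"

text \<open>The graphs may be bounded by \<open>S\<close>, since the code of a list exceeds every
  number from which its entries are built; see \<open>triple_less\<close>.\<close>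

definition certificate_code ::
  "nat \<Rightarrow> (nat \<Rightarrow> nat \<Rightarrow> bool) \<Rightarrow> (nat \<Rightarrow> nat \<Rightarrow> nat \<Rightarrow> nat \<Rightarrow> nat \<Rightarrow> bool) \<Rightarrow> nat \<Rightarrow> bool" where
  "certificate_code M step edge S \<longleftrightarrow>
     (\<forall>p<M. \<forall>q<M. step p q \<longrightarrow> (\<exists>g<S. lmem (triple p q g) S \<and>
        (\<forall>s<M. \<forall>b<2. \<forall>t<M. lmem (triple s b t) g \<longleftrightarrow> edge b p s q t))) \<and>
     (\<forall>p<M. \<forall>q<M. \<forall>r<M. \<forall>g<S. \<forall>h<S. lmem (triple p q g) S \<and> lmem (triple q r h) S \<longrightarrow>
        (\<exists>k<S. lmem (triple p r k) S \<and>
          (\<forall>s<M. \<forall>b<2. \<forall>t<M. lmem (triple s b t) k \<longleftrightarrow> comp_code M g h s b t))) \<and>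
     (\<forall>p<M. \<forall>g<S. lmem (triple p p g) S \<and>
        (\<forall>s<M. \<forall>b<2. \<forall>t<M. lmem (triple s b t) g \<longleftrightarrow> comp_code M g g s b t) \<longrightarrow>
        (\<exists>s<M. lmem (triple s 1 s) g))"

definition certificate_of :: "nat \<Rightarrow> nat \<Rightarrow> (nat \<times> nat \<times> graph) set" where
  "certificate_of M S = {(p, q, graph_of M g) | p q g. p < M \<and> q < M \<and> lmem (triple p q g) S}"

lemma less_2_flag: "(\<forall>b<2. P b) \<longleftrightarrow> (\<forall>b. P (flag b))"
proof
  assume "\<forall>b<2. P b"
  then show "\<forall>b. P (flag b)" by (simp add: flag_def)
next
  assume P: "\<forall>b. P (flag b)"
  have "P 0" "P 1" using P[rule_format, of False] P[rule_format, of True] by (simp_all add: flag_def)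
  then show "\<forall>b<2. P b" by (simp add: numeral_2_eq_2 less_Suc_eq)
qed

lemma ex_less_2_flag: "(\<exists>b<2. P b) \<longleftrightarrow> (\<exists>b. P (flag b))"
  using less_2_flag[of "\<lambda>b. \<not> P b"] by blast

lemma flag_or: "(flag b = 0 \<longleftrightarrow> flag b1 = 0 \<and> flag b2 = 0) \<longleftrightarrow> b = (b1 \<or> b2)"
  by (auto simp: flag_def)

lemma flag_le [simp]: "flag b \<le> Suc 0"
  by (simp add: flag_def)

lemma flag_inject [simp]: "flag b = flag b' \<longleftrightarrow> b = b'"
  by (simp add: flag_def)

lemma gcomp_iff:
  "(s, b, t) \<in> gcomp g h \<longleftrightarrow> (\<exists>u b1 b2. (s, b1, u) \<in> g \<and> (u, b2, t) \<in> h \<and> b = (b1 \<or> b2))"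
  unfolding gcomp_def mem_Collect_eq prod.inject by (simp del: ex_simps) metis

lemma graph_of_iff: "(s, b, t) \<in> graph_of M u \<longleftrightarrow> s < M \<and> t < M \<and> lmem (triple s (flag b) t) u"
  unfolding graph_of_def by simp

lemma comp_code_iff:
  assumes "s < M" "t < M"
  shows "comp_code M g h s (flag b) t \<longleftrightarrow> (s, b, t) \<in> gcomp (graph_of M g) (graph_of M h)"
  unfolding comp_code_def gcomp_iff graph_of_iff ex_less_2_flag flag_or
proof
  assume "\<exists>u<M. \<exists>b1 b2. lmem (triple s (flag b1) u) g \<and> lmem (triple u (flag b2) t) h \<and> b = (b1 \<or> b2)"
  then obtain u b1 b2 where
    "u < M" "lmem (triple s (flag b1) u) g" "lmem (triple u (flag b2) t) h" "b = (b1 \<or> b2)"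
    by (elim exE conjE) (rule that)
  then show "\<exists>u b1 b2. (s < M \<and> u < M \<and> lmem (triple s (flag b1) u) g) \<and>
      (u < M \<and> t < M \<and> lmem (triple u (flag b2) t) h) \<and> b = (b1 \<or> b2)"
    using assms by (intro exI[of _ u] exI[of _ b1] exI[of _ b2] conjI)
next
  assume "\<exists>u b1 b2. (s < M \<and> u < M \<and> lmem (triple s (flag b1) u) g) \<and>
      (u < M \<and> t < M \<and> lmem (triple u (flag b2) t) h) \<and> b = (b1 \<or> b2)"
  then obtain u b1 b2 where
    "u < M" "lmem (triple s (flag b1) u) g" "lmem (triple u (flag b2) t) h" "b = (b1 \<or> b2)"
    by (elim exE conjE) (rule that)
  then show "\<exists>u<M. \<exists>b1 b2. lmem (triple s (flag b1) u) g \<and> lmem (triple u (flag b2) t) h \<and> b = (b1 \<or> b2)"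
    by (intro exI[of _ u] exI[of _ b1] exI[of _ b2] conjI)
qed

lemma graph_of_eq_iff:
  "(\<forall>s<M. \<forall>b<2. \<forall>t<M. lmem (triple s b t) k \<longleftrightarrow> P s b t) \<longleftrightarrow>
     graph_of M k = {(s, b, t). s < M \<and> t < M \<and> P s (flag b) t}"
  unfolding set_eq_iff split_paired_All graph_of_iff less_2_flag mem_Collect_eq prod.case by blast

lemma gcomp_graph_of:
  "gcomp (graph_of M g) (graph_of M h) =
     {(s, b, t). s < M \<and> t < M \<and> comp_code M g h s (flag b) t}"
proof -
  have "(s, b, t) \<in> gcomp (graph_of M g) (graph_of M h) \<longleftrightarrow>
      s < M \<and> t < M \<and> comp_code M g h s (flag b) t" for s b t
  proof (cases "s < M \<and> t < M")
    case True then show ?thesis using comp_code_iff[of s M t g h b] by simp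
  next
    case False then show ?thesis unfolding gcomp_iff graph_of_iff by blast
  qed
  then show ?thesis by (simp add: set_eq_iff split_paired_All)
qed

text \<open>One bound \<open>M\<close> serves for nodes and for positions, so that all sets in
  question are finite and coded below a number computed from \<open>M\<close>.\<close>

definition bounded_graph ::
  "nat \<Rightarrow> (nat \<Rightarrow> nat \<Rightarrow> nat \<Rightarrow> nat \<Rightarrow> nat \<Rightarrow> bool) \<Rightarrow> nat \<Rightarrow> nat \<Rightarrow> graph" where
  "bounded_graph M edge p q = {(s, b, t). s < M \<and> t < M \<and> edge (flag b) p s q t}"

definition bounded_step :: "nat \<Rightarrow> (nat \<Rightarrow> nat \<Rightarrow> bool) \<Rightarrow> nat \<Rightarrow> nat \<Rightarrow> bool" where
  "bounded_step M step p q \<longleftrightarrow> p < M \<and> q < M \<and> step p q"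

lemma triple_less: "lmem (triple p q g) S \<Longrightarrow> g < S"
  using lmem_less[of "triple p q g" S] le_prod_encode_2[of "pair q g" p] le_prod_encode_2[of g q] by simp

lemma certificate_of_iff:
  "(p, q, g) \<in> certificate_of M S \<longleftrightarrow> p < M \<and> q < M \<and> (\<exists>u. lmem (triple p q u) S \<and> g = graph_of M u)"
  unfolding certificate_of_def by auto

lemma certificate_code_iff:
  "certificate_code M step edge S \<longleftrightarrow>
     certificate (bounded_step M step) (bounded_graph M edge) (certificate_of M S)"
proof -
  have "(\<forall>p<M. \<forall>q<M. step p q \<longrightarrow> (\<exists>g<S. lmem (triple p q g) S \<and>
        (\<forall>s<M. \<forall>b<2. \<forall>t<M. lmem (triple s b t) g \<longleftrightarrow> edge b p s q t))) \<longleftrightarrow>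
     (\<forall>p q. bounded_step M step p q \<longrightarrow> (p, q, bounded_graph M edge p q) \<in> certificate_of M S)"
    unfolding graph_of_eq_iff bounded_graph_def[symmetric]
  proof (intro iffI allI impI)
    fix p q assume L: "\<forall>p<M. \<forall>q<M. step p q \<longrightarrow>
        (\<exists>g<S. lmem (triple p q g) S \<and> graph_of M g = bounded_graph M edge p q)" 
      and pq: "bounded_step M step p q"
    then obtain g where "p < M" "q < M" "lmem (triple p q g) S" "graph_of M g = bounded_graph M edge p q"
      unfolding bounded_step_def by blast
    then show "(p, q, bounded_graph M edge p q) \<in> certificate_of M S"
      unfolding certificate_of_iff by (intro conjI exI[of _ g]) simp_all
  next
    fix p q assume R: "\<forall>p q. bounded_step M step p q \<longrightarrow> (p, q, bounded_graph M edge p q) \<in> certificate_of M S"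
      and pq: "p < M" "q < M" "step p q"
    then have "(p, q, bounded_graph M edge p q) \<in> certificate_of M S" unfolding bounded_step_def by simp
    then obtain g where "lmem (triple p q g) S" "bounded_graph M edge p q = graph_of M g"
      unfolding certificate_of_iff by (elim conjE exE) (rule that)
    then show "\<exists>g<S. lmem (triple p q g) S \<and> graph_of M g = bounded_graph M edge p q"
      using triple_less[of p q g S] by (intro exI[of _ g]) simp
  qed
  moreover have "(\<forall>p<M. \<forall>q<M. \<forall>r<M. \<forall>g<S. \<forall>h<S. lmem (triple p q g) S \<and> lmem (triple q r h) S \<longrightarrow>
        (\<exists>k<S. lmem (triple p r k) S \<and>
          (\<forall>s<M. \<forall>b<2. \<forall>t<M. lmem (triple s b t) k \<longleftrightarrow> comp_code M g h s b t))) \<longleftrightarrow>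
     (\<forall>p q r g h. (p, q, g) \<in> certificate_of M S \<and> (q, r, h) \<in> certificate_of M S \<longrightarrow>
        (p, r, gcomp g h) \<in> certificate_of M S)" (is "?L \<longleftrightarrow> ?R")
  proof
    assume L: ?L
    show ?R
    proof (intro allI impI)
      fix p q r g h
      assume "(p, q, g) \<in> certificate_of M S \<and> (q, r, h) \<in> certificate_of M S"
      then obtain g' h' where *: "p < M" "q < M" "r < M" "lmem (triple p q g') S" "lmem (triple q r h') S"
        "g = graph_of M g'" "h = graph_of M h'" unfolding certificate_of_iff by (elim conjE exE) (rule that)
      obtain k where "lmem (triple p r k) S" "graph_of M k = gcomp g h"
        using L[unfolded graph_of_eq_iff gcomp_graph_of[symmetric], rule_format, OF *(1-3)
            triple_less[OF *(4)] triple_less[OF *(5)] conjI[OF *(4,5)]] *(6,7)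
        by auto
      then show "(p, r, gcomp g h) \<in> certificate_of M S"
        using * unfolding certificate_of_iff by (intro conjI exI[of _ k]) simp_all
    qed
  next
    assume R: ?R
    show ?L
    proof (intro allI impI)
      fix p q r g h
      assume *: "p < M" "q < M" "r < M" "lmem (triple p q g) S \<and> lmem (triple q r h) S"
      then have "(p, q, graph_of M g) \<in> certificate_of M S" "(q, r, graph_of M h) \<in> certificate_of M S"
        unfolding certificate_of_iff by auto
      from R[rule_format, OF conjI[OF this]]
      obtain k where "lmem (triple p r k) S" "gcomp (graph_of M g) (graph_of M h) = graph_of M k"
        unfolding certificate_of_iff by (elim conjE exE) (rule that)
      then show "\<exists>k<S. lmem (triple p r k) S \<and>
          (\<forall>s<M. \<forall>b<2. \<forall>t<M. lmem (triple s b t) k \<longleftrightarrow> comp_code M g h s b t)"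
        unfolding graph_of_eq_iff gcomp_graph_of[symmetric]
        using triple_less[of p r k S] by (intro exI[of _ k]) simp
    qed
  qed
  moreover have "(\<forall>p<M. \<forall>g<S. lmem (triple p p g) S \<and>
        (\<forall>s<M. \<forall>b<2. \<forall>t<M. lmem (triple s b t) g \<longleftrightarrow> comp_code M g g s b t) \<longrightarrow>
        (\<exists>s<M. lmem (triple s 1 s) g)) \<longleftrightarrow>
     (\<forall>p g. (p, p, g) \<in> certificate_of M S \<and> gcomp g g = g \<longrightarrow> (\<exists>s. (s, True, s) \<in> g))" (is "?L \<longleftrightarrow> ?R")
  proof -
    have comm: "(\<forall>s<M. \<forall>b<2. \<forall>t<M. lmem (triple s b t) g \<longleftrightarrow> comp_code M g g s b t) \<longleftrightarrow>
        gcomp (graph_of M g) (graph_of M g) = graph_of M g" for g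
      unfolding graph_of_eq_iff gcomp_graph_of[symmetric] by (rule eq_commute)
    have arc: "(\<exists>s<M. lmem (triple s 1 s) g) \<longleftrightarrow> (\<exists>s. (s, True, s) \<in> graph_of M g)" for g
      unfolding graph_of_iff by (simp add: flag_def)
    show ?thesis
    proof
      assume L: ?L
      show ?R
      proof (intro allI impI)
        fix p g assume "(p, p, g) \<in> certificate_of M S \<and> gcomp g g = g"
        then obtain g' where "p < M" "lmem (triple p p g') S" "g = graph_of M g'" "gcomp g g = g"
          unfolding certificate_of_iff by (elim conjE exE) (rule that)
        then show "\<exists>s. (s, True, s) \<in> g"
          using L[unfolded comm arc, rule_format, of p g'] triple_less[of p p g' S] by simp
      qed
    next
      assume R: ?R
      show ?L
        unfolding comm arc
      proof (intro allI impI)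
        fix p g assume "p < M" "lmem (triple p p g) S \<and> gcomp (graph_of M g) (graph_of M g) = graph_of M g"
        then have "(p, p, graph_of M g) \<in> certificate_of M S \<and>
            gcomp (graph_of M g) (graph_of M g) = graph_of M g"
          unfolding certificate_of_iff by auto
        then show "\<exists>s. (s, True, s) \<in> graph_of M g" by (rule R[rule_format])
      qed
    qed
  qed
  ultimately show ?thesis unfolding certificate_code_def certificate_def by argo
qed

text \<open>\<open>A\<close> bounds the codes of arcs, so a graph is coded by at most
  \<open>Suc A\<close> distinct numbers up to \<open>A\<close>. \<open>B\<close> accordingly bounds
  the triples of two nodes and a graph, and the same estimate is applied to a set of such
  triples.\<close>

definition certificate_bound :: "nat \<Rightarrow> nat" where
  "certificate_bound M = (let A = triple M 1 M; B = triple M M (lrep (Suc A) A) in lrep (Suc B) B)"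

lemma list_encode_sorted_le:
  assumes "X \<subseteq> {..A}"
  shows "list_encode (sorted_list_of_set X) \<le> lrep (Suc A) A"
proof (rule list_encode_le_lrep)
  have "finite X" using assms finite_subset by blast
  then show "length (sorted_list_of_set X) \<le> Suc A"
    using card_mono[OF _ assms] by simp
  show "x \<in> set (sorted_list_of_set X) \<Longrightarrow> x \<le> A" for x
    using assms \<open>finite X\<close> by auto
qed

lemma realized_bounded:
  "realized (bounded_step M step) (bounded_graph M edge) \<subseteq>
     {..<M} \<times> {..<M} \<times> Pow ({..<M} \<times> UNIV \<times> {..<M})"
proof
  fix x assume "x \<in> realized (bounded_step M step) (bounded_graph M edge)"
  then obtain n i j where x: "x = (n i, n j, threads (bounded_graph M edge) n i j)" "i < j"
    "\<And>l. i \<le> l \<Longrightarrow> l < j \<Longrightarrow> bounded_step M step (n l) (n (Suc l))"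
    unfolding realized_def by blast
  have nodes: "n i < M" "n j < M"
    using x(3)[of i] x(3)[of "j - 1"] x(2) by (auto simp: bounded_step_def)
  have "y \<in> {..<M} \<times> UNIV \<times> {..<M}" if "y \<in> threads (bounded_graph M edge) n i j" for y
    using that
  proof (rule threadsE)
    fix \<sigma> \<beta> assume y: "y = (\<sigma> i, \<exists>l. i \<le> l \<and> l < j \<and> \<beta> l, \<sigma> j)"
      "run (bounded_graph M edge) n i j \<sigma> \<beta>"
    show ?thesis
      \<comment> \<open>The end points of the run lie on its first and on its last arc, which exist
        because \<open>i < j\<close>.\<close>
      using y(2)[rule_format, of i] y(2)[rule_format, of "j - 1"] x(2) y(1)
      by (auto simp: bounded_graph_def)
  qed
  then show "x \<in> {..<M} \<times> {..<M} \<times> Pow ({..<M} \<times> UNIV \<times> {..<M})"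
    using nodes x(1) by auto
qed

text \<open>Needed for \<open>T = realized ...\<close>: the search below the bound must not miss it.
  Sorted lists provide the small codes.\<close>

lemma certificate_of_ex:
  assumes T: "T \<subseteq> {..<M} \<times> {..<M} \<times> Pow ({..<M} \<times> UNIV \<times> {..<M})"
  shows "\<exists>S \<le> certificate_bound M. certificate_of M S = T"
proof -
  define A where "A = triple M 1 M"
  define B where "B = triple M M (lrep (Suc A) A)"
  define arcs where "arcs g = (\<lambda>(s, b, t). triple s (flag b) t) ` g" for g :: graph
  define code where "code g = list_encode (sorted_list_of_set (arcs g))" for g
  have arcs: "arcs g \<subseteq> {..A}" if "g \<subseteq> {..<M} \<times> UNIV \<times> {..<M}" for g
    using that unfolding arcs_def A_def by (auto intro!: pair_mono)
  have code_le: "code g \<le> lrep (Suc A) A" if "g \<subseteq> {..<M} \<times> UNIV \<times> {..<M}" for g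
    unfolding code_def by (rule list_encode_sorted_le[OF arcs[OF that]])
  have graph_of_code: "graph_of M (code g) = g" if g: "g \<subseteq> {..<M} \<times> UNIV \<times> {..<M}" for g
  proof -
    have "finite (arcs g)" using arcs[OF g] finite_subset by blast
    then have "lmem v (code g) \<longleftrightarrow> v \<in> arcs g" for v unfolding lmem_def code_def by simp
    moreover have "triple s (flag b) t \<in> arcs g \<longleftrightarrow> (s, b, t) \<in> g" for s b t
      unfolding arcs_def by (auto simp: image_iff Bex_def split_paired_Ex )
    ultimately show ?thesis using g unfolding graph_of_def by auto
  qed
  define X where "X = (\<lambda>(p, q, g). triple p q (code g)) ` T"
  have X: "X \<subseteq> {..B}"
    using T code_le unfolding X_def B_def by (force intro!: pair_mono)
  define S where "S = list_encode (sorted_list_of_set X)"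
  have "S \<le> certificate_bound M"
    using list_encode_sorted_le[OF X] unfolding S_def certificate_bound_def A_def B_def by (simp add: Let_def)
  moreover have "certificate_of M S = T"
  proof -
    have "finite X" using X finite_subset by blast
    then have mem: "lmem v S \<longleftrightarrow> v \<in> X" for v unfolding lmem_def S_def by simp
    show ?thesis
    proof (intro set_eqI iffI)
      fix x assume "x \<in> certificate_of M S"
      then obtain p q g where x: "x = (p, q, graph_of M g)" "triple p q g \<in> X"
        unfolding certificate_of_def mem by blast
      then obtain g' where "(p, q, g') \<in> T" "g = code g'" unfolding X_def by auto
      then show "x \<in> T" using x graph_of_code[of g'] T by auto
    next
      fix x assume "x \<in> T"
      moreover obtain p q g where x: "x = (p, q, g)" by (cases x)
      ultimately have "triple p q (code g) \<in> X" "p < M" "q < M" "graph_of M (code g) = g"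
        using T graph_of_code[of g] unfolding X_def by (force, auto)
      then show "x \<in> certificate_of M S" unfolding certificate_of_def mem x by (auto intro!: exI[of _ "code g"])
    qed
  qed
  ultimately show ?thesis by blast
qed

theorem thread_condition_code:
  "thread_condition (bounded_step M step) (bounded_graph M edge) \<longleftrightarrow>
     (\<exists>S < Suc (certificate_bound M). certificate_code M step edge S)"
proof -
  have fin: "finite {p. \<exists>q. bounded_step M step p q}" "finite (\<Union>p q. bounded_graph M edge p q)"
  proof -
    show "finite {p. \<exists>q. bounded_step M step p q}"
      by (rule finite_subset[of _ "{..<M}"]) (auto simp: bounded_step_def)
    show "finite (\<Union>p q. bounded_graph M edge p q)"
      by (rule finite_subset[of _ "{..<M} \<times> UNIV \<times> {..<M}"]) (auto simp: bounded_graph_def)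
  qed
  show ?thesis
  proof
    assume "thread_condition (bounded_step M step) (bounded_graph M edge)"
    from certificate_realized[OF fin(2) this]
    show "\<exists>S < Suc (certificate_bound M). certificate_code M step edge S"
      using certificate_of_ex[OF realized_bounded[of M step edge]]
      unfolding certificate_code_iff less_Suc_eq_le by metis
  next
    assume "\<exists>S < Suc (certificate_bound M). certificate_code M step edge S"
    then show "thread_condition (bounded_step M step) (bounded_graph M edge)"
      unfolding certificate_code_iff using thread_condition_if_certificate[OF fin] by blast
  qed
qed

theorem rec_pred_thread_condition:
  assumes "rec_fun M" and step: "rec_pred (\<lambda>z. step (pfst z) (pfst (psnd z)) (psnd (psnd z)))"
    and edge: "rec_pred (\<lambda>z. edge (pfst z) (pfst (psnd z)) (pfst (psnd (psnd z)))
      (pfst (psnd (psnd (psnd z)))) (pfst (psnd (psnd (psnd (psnd z))))) (psnd (psnd (psnd (psnd (psnd z))))))"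
  shows "rec_pred (\<lambda>c. thread_condition (bounded_step (M c) (step c)) (bounded_graph (M c) (edge c)))"
proof -
  have step': "rec_pred (\<lambda>z. step (f z) (g z) (h z))" if "rec_fun f" "rec_fun g" "rec_fun h" for f g h
    using rec_pred_comp[OF step, of "\<lambda>z. pair (f z) (pair (g z) (h z))"] that
    by (simp add: rec_fun_pair)
  have edge': "rec_pred (\<lambda>z. edge (f z) (g z) (h z) (f' z) (g' z) (h' z))"
    if "rec_fun f" "rec_fun g" "rec_fun h" "rec_fun f'" "rec_fun g'" "rec_fun h'" for f g h f' g' h'
    using rec_pred_comp[OF edge, of "\<lambda>z. pair (f z) (pair (g z) (pair (h z) (pair (f' z) (pair (g' z) (h' z)))))"] that
    by (simp add: rec_fun_pair)
  show ?thesis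
    unfolding thread_condition_code certificate_code_def comp_code_def certificate_bound_def Let_def
    by (intro rec_intros_list rec_pred_lmem step' edge' rec_fun_comp[OF assms(1)])
qed

section \<open>Positions of fixed-point operators\<close>

text \<open>Terms contain no fixed-point operators and are left out, so an equation is a leaf and
  substitution of terms changes no position.\<close>

fun kids :: "'a fm \<Rightarrow> 'a fm list" where
  "kids (Or \<phi> \<psi>) = [\<phi>, \<psi>]"
| "kids (And \<phi> \<psi>) = [\<phi>, \<psi>]"
| "kids (Lam A \<phi>) = [\<phi>]"
| "kids (AppF \<phi> \<psi>) = [\<phi>, \<psi>]"
| "kids (AppT \<phi> t) = [\<phi>]"
| "kids (Fix \<sigma> a T \<phi>) = [\<phi>]"
| "kids _ = []"

fun binds :: "'a fm \<Rightarrow> bool" where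
  "binds (Lam A \<phi>) = True"
| "binds (Fix \<sigma> a T \<phi>) = True"
| "binds _ = False"

fun sub :: "'a fm \<Rightarrow> nat list \<Rightarrow> 'a fm option" where
  "sub \<phi> [] = Some \<phi>"
| "sub \<phi> (j # \<pi>) = (if j < length (kids \<phi>) then sub (kids \<phi> ! j) \<pi> else None)"

fun fixat :: "sgn \<Rightarrow> 'a \<Rightarrow> 'a fm \<Rightarrow> nat list \<Rightarrow> bool" where
  "fixat \<sigma> p \<phi> [] \<longleftrightarrow> (\<exists>T \<chi>. \<phi> = Fix \<sigma> p T \<chi>)"
| "fixat \<sigma> p \<phi> (j # \<pi>) \<longleftrightarrow> j < length (kids \<phi>) \<and> fixat \<sigma> p (kids \<phi> ! j) \<pi>"

text \<open>
  \<open>holeat k \<phi> \<pi> \<rho>\<close>: the position \<open>\<pi>\<close> is the position \<open>\<rho>\<close> below an occurrence of the dangling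
  bound variable \<open>k\<close> of \<open>\<phi>\<close>, that is, it belongs to a copy of \<open>\<psi>\<close> in \<open>inst k (FArg \<psi>) \<phi>\<close>.
\<close>

fun holeat :: "nat \<Rightarrow> 'a fm \<Rightarrow> nat list \<Rightarrow> nat list \<Rightarrow> bool" where
  "holeat k \<phi> [] \<rho> \<longleftrightarrow> \<phi> = FBound k \<and> \<rho> = []"
| "holeat k \<phi> (j # \<pi>) \<rho> \<longleftrightarrow> (\<phi> = FBound k \<and> \<rho> = j # \<pi>) \<or>
     (j < length (kids \<phi>) \<and> holeat (if binds \<phi> then Suc k else k) (kids \<phi> ! j) \<pi> \<rho>)"

text \<open>At an occurrence of the variable, this is the index of the formula that \<open>plug\<close> puts there.\<close>

fun left_occs :: "nat \<Rightarrow> fty \<Rightarrow> 'a fm \<Rightarrow> nat list \<Rightarrow> nat" where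
  "left_occs x T \<phi> [] = 0"
| "left_occs x T \<phi> (j # \<pi>) = sum_list (map (occs x T) (take j (kids \<phi>))) +
     (if j < length (kids \<phi>) then left_occs x T (kids \<phi> ! j) \<pi> else 0)"

lemma less_length_2: "j < Suc (Suc 0) \<longleftrightarrow> j = 0 \<or> j = Suc 0" by auto

lemma ex_less_2: "(\<exists>j. (j = 0 \<or> j = Suc 0) \<and> Q j) \<longleftrightarrow> Q 0 \<or> Q (Suc 0)" by auto

lemma labels_fixat: "labels \<sigma> \<phi> = {p. \<exists>\<pi>. fixat \<sigma> p \<phi> \<pi>}"
proof (induction \<phi>)
  have ex_path: "(\<exists>\<pi>. P \<pi>) \<longleftrightarrow> P [] \<or> (\<exists>j \<pi>. P (j # \<pi>))" for P :: "nat list \<Rightarrow> bool"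
    by (metis neq_Nil_conv)
  {
    case (Eq s t) show ?case by (auto simp: ex_path)
  next
    case (Or \<phi> \<psi>) then show ?case by (subst ex_path) (auto simp: less_length_2 ex_less_2)
  next
    case (And \<phi> \<psi>) then show ?case by (subst ex_path) (auto simp: less_length_2 ex_less_2)
  next
    case (FFree x T) show ?case by (subst ex_path) auto
  next
    case (FBound i) show ?case by (subst ex_path) auto
  next
    case (Lam A \<phi>) then show ?case by (subst ex_path) auto
  next
    case (AppF \<phi> \<psi>) then show ?case by (subst ex_path) (auto simp: less_length_2 ex_less_2)
  next
    case (AppT \<phi> t) then show ?case by (subst ex_path) auto
  next
    case (Fix \<sigma> a T \<phi>) then show ?case by (subst ex_path) auto
  }
qed

lemma fixat_unique: "fixat \<sigma> p \<phi> \<pi> \<Longrightarrow> fixat \<sigma>' p' \<phi> \<pi> \<Longrightarrow> \<sigma> = \<sigma>' \<and> p = p'"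
  by (induction \<pi> arbitrary: \<phi>) auto

lemma fixat_tsubst [simp]: "fixat \<sigma> p (tsubst \<rho> \<phi>) \<pi> \<longleftrightarrow> fixat \<sigma> p \<phi> \<pi>"
  by (induction \<phi> arbitrary: \<pi>; rename_tac \<pi>; case_tac \<pi>) (auto simp: less_length_2)

text \<open>Replacing leaves keeps all positions of \<open>\<phi>\<close> and adds those inside the
  inserted copies. As \<open>inst\<close> shifts no indices, a copy is literally
  \<open>\<psi>\<close>.\<close>

lemma fixat_inst:
  "fixat \<sigma> p (inst k a \<phi>) \<pi> \<longleftrightarrow>
     fixat \<sigma> p \<phi> \<pi> \<or> (\<exists>\<psi> \<rho>. a = FArg \<psi> \<and> holeat k \<phi> \<pi> \<rho> \<and> fixat \<sigma> p \<psi> \<rho>)"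
  by (induction \<phi> arbitrary: k \<pi>; rename_tac \<pi>; case_tac \<pi>)
    (auto simp: less_length_2 split: arg.splits)

lemma fixat_plug: "fixat \<sigma> p \<phi> \<pi> \<Longrightarrow> fixat \<sigma> p (plug x T \<psi>s \<phi>) \<pi>"
  by (induction \<phi> arbitrary: \<pi> \<psi>s; rename_tac \<pi> \<psi>s; case_tac \<pi>) (auto simp: less_length_2)

lemma left_occs_less: "sub \<phi> \<pi> = Some (FFree x T) \<Longrightarrow> left_occs x T \<phi> \<pi> < occs x T \<phi>"
  by (induction \<phi> arbitrary: \<pi>; rename_tac \<pi>; case_tac \<pi>)
    (auto simp: less_length_2 trans_less_add1 split: if_splits)

text \<open>\<open>plug\<close> distributes its list over the children according to their numbers of
  occurrences, and \<open>left_occs\<close> adds up the same numbers along the path.\<close>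

lemma fixat_plug_occ:
  "sub \<phi> \<pi> = Some (FFree x T) \<Longrightarrow> length \<psi>s = occs x T \<phi> \<Longrightarrow>
     fixat \<sigma> p (plug x T \<psi>s \<phi>) (\<pi> @ \<rho>) \<longleftrightarrow> fixat \<sigma> p (\<psi>s ! left_occs x T \<phi> \<pi>) \<rho>"
proof (induction \<phi> arbitrary: \<pi> \<psi>s)
  case (Or \<phi> \<psi>) then show ?case
    using left_occs_less[of \<phi> _ x T] by (cases \<pi>) (auto simp: less_length_2)
next
  case (And \<phi> \<psi>) then show ?case
    using left_occs_less[of \<phi> _ x T] by (cases \<pi>) (auto simp: less_length_2)
next
  case (AppF \<phi> \<psi>) then show ?case
    using left_occs_less[of \<phi> _ x T] by (cases \<pi>) (auto simp: less_length_2)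
next
  case (FFree y U) then show ?case
    by (cases \<pi>; cases \<psi>s) (auto split: if_splits)
next
  case (Lam A \<phi>) then show ?case by (cases \<pi>) (auto split: if_splits)
next
  case (AppT \<phi> t) then show ?case by (cases \<pi>) (auto split: if_splits)
next
  case (Fix \<sigma> a T \<phi>) then show ?case by (cases \<pi>) (auto split: if_splits)
qed (auto elim: sub.elims split: if_splits)

text \<open>The numbering of occurrences is onto. So every premise of \<open>Mono\<close> belongs to
  an occurrence, and an operator in that premise has an ancestor.\<close>

lemma ex_left_occs: "j < occs x T \<phi> \<Longrightarrow> \<exists>\<pi>. sub \<phi> \<pi> = Some (FFree x T) \<and> left_occs x T \<phi> \<pi> = j"
proof (induction \<phi> arbitrary: j)
  have two: "\<exists>\<pi>. sub \<chi> \<pi> = Some (FFree x T) \<and> left_occs x T \<chi> \<pi> = j"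
    if \<chi>: "kids \<chi> = [\<phi>, \<psi>]" and j: "j < occs x T \<phi> + occs x T \<psi>"
      and \<phi>: "\<And>j. j < occs x T \<phi> \<Longrightarrow> \<exists>\<pi>. sub \<phi> \<pi> = Some (FFree x T) \<and> left_occs x T \<phi> \<pi> = j"
      and \<psi>: "\<And>j. j < occs x T \<psi> \<Longrightarrow> \<exists>\<pi>. sub \<psi> \<pi> = Some (FFree x T) \<and> left_occs x T \<psi> \<pi> = j"
    for \<chi> \<phi> \<psi> :: "'a fm" and j
  proof (cases "j < occs x T \<phi>")
    case True
    then obtain \<pi> where "sub \<phi> \<pi> = Some (FFree x T)" "left_occs x T \<phi> \<pi> = j" using \<phi> by blast
    then show ?thesis using \<chi> by (intro exI[of _ "0 # \<pi>"]) simp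
  next
    case False
    then have "j - occs x T \<phi> < occs x T \<psi>" using j by simp
    then obtain \<pi> where "sub \<psi> \<pi> = Some (FFree x T)" "left_occs x T \<psi> \<pi> = j - occs x T \<phi>"
      using \<psi> by blast
    then show ?thesis using \<chi> False by (intro exI[of _ "1 # \<pi>"]) simp
  qed
  have one: "\<exists>\<pi>. sub \<chi> \<pi> = Some (FFree x T) \<and> left_occs x T \<chi> \<pi> = j"
    if \<chi>: "kids \<chi> = [\<phi>]" and ex: "\<exists>\<pi>. sub \<phi> \<pi> = Some (FFree x T) \<and> left_occs x T \<phi> \<pi> = j"
    for \<chi> \<phi> :: "'a fm" and j
  proof -
    obtain \<pi> where "sub \<phi> \<pi> = Some (FFree x T)" "left_occs x T \<phi> \<pi> = j" using ex by blast
    then show ?thesis using \<chi> by (intro exI[of _ "0 # \<pi>"]) simp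
  qed
  {
    case (Or \<phi> \<psi>) show ?case by (rule two[OF _ _ Or.IH]) (use Or.prems in simp_all)
  next
    case (And \<phi> \<psi>) show ?case by (rule two[OF _ _ And.IH]) (use And.prems in simp_all)
  next
    case (AppF \<phi> \<psi>) show ?case by (rule two[OF _ _ AppF.IH]) (use AppF.prems in simp_all)
  next
    case (Lam A \<phi>) show ?case by (rule one[OF _ Lam.IH]) (use Lam.prems in simp_all)
  next
    case (AppT \<phi> t) show ?case by (rule one[OF _ AppT.IH]) (use AppT.prems in simp_all)
  next
    case (Fix \<sigma> a T \<phi>) show ?case by (rule one[OF _ Fix.IH]) (use Fix.prems in simp_all)
  next
    case (FFree y U) then show ?case by (intro exI[of _ "[]"]) (auto split: if_splits)
  }
qed auto

section \<open>Positions in iterated applications\<close>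

lemma apps_snoc: "apps h (as @ [a]) = app (apps h as) a"
  by (simp add: apps_def)

lemma apps_Cons: "apps h (a # as) = apps (app h a) as"
  by (simp add: apps_def)

lemma apps_Nil [simp]: "apps h [] = h"
  by (simp add: apps_def)

text \<open>Applications nest to the left: child 0 is the function and child 1 the argument. Such a
  position descends \<open>k\<close> times to the function and then enters an argument.\<close>

definition argpos :: "nat \<Rightarrow> nat list \<Rightarrow> bool" where
  "argpos n \<pi> \<longleftrightarrow> (\<exists>k \<rho>. k < n \<and> \<pi> = replicate k 0 @ 1 # \<rho>)"

lemma argpos_0 [simp]: "\<not> argpos 0 \<pi>"
  by (simp add: argpos_def)

lemma argpos_Suc_Nil [simp]: "\<not> argpos n []"
  by (simp add: argpos_def)

lemma argpos_Suc_Cons [simp]: "argpos (Suc n) (j # \<pi>) \<longleftrightarrow> j = 1 \<or> j = 0 \<and> argpos n \<pi>"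
proof
  assume "argpos (Suc n) (j # \<pi>)"
  then obtain k \<rho> where k: "k < Suc n" "j # \<pi> = replicate k 0 @ 1 # \<rho>" unfolding argpos_def by blast
  then show "j = 1 \<or> j = 0 \<and> argpos n \<pi>"
    by (cases k) (auto simp: argpos_def)
next
  assume "j = 1 \<or> j = 0 \<and> argpos n \<pi>"
  then show "argpos (Suc n) (j # \<pi>)"
  proof
    assume "j = 1" then show ?thesis unfolding argpos_def by (intro exI[of _ 0] exI[of _ \<pi>]) simp
  next
    assume "j = 0 \<and> argpos n \<pi>"
    then obtain k \<rho> where "j = 0" "k < n" "\<pi> = replicate k 0 @ 1 # \<rho>" unfolding argpos_def by blast
    then show ?thesis unfolding argpos_def by (intro exI[of _ "Suc k"] exI[of _ \<rho>]) simp
  qed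
qed

text \<open>The list starts with the outermost argument, which is nearest to the root; this is why
  \<open>fixat_apps\<close> passes \<open>rev as\<close>.\<close>

fun fixarg :: "sgn \<Rightarrow> 'a \<Rightarrow> 'a arg list \<Rightarrow> nat list \<Rightarrow> bool" where
  "fixarg \<sigma> p as [] \<longleftrightarrow> False"
| "fixarg \<sigma> p [] (j # \<pi>) \<longleftrightarrow> False"
| "fixarg \<sigma> p (a # as) (j # \<pi>) \<longleftrightarrow> (j = 1 \<and> (\<exists>\<psi>. a = FArg \<psi> \<and> fixat \<sigma> p \<psi> \<pi>)) \<or> (j = 0 \<and> fixarg \<sigma> p as \<pi>)"

lemma fixarg_argpos: "fixarg \<sigma> p as \<pi> \<Longrightarrow> argpos (length as) \<pi>"
  by (induction \<sigma> p as \<pi> rule: fixarg.induct) auto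

lemma kids_app: "kids (app f a) = f # (case a of FArg \<psi> \<Rightarrow> [\<psi>] | TArg _ \<Rightarrow> [])"
  by (cases a) auto

lemma app_neq_Fix [simp]: "app f a \<noteq> Fix \<sigma> p T \<phi>"
  by (cases a) auto

lemma fixat_apps:
  "fixat \<sigma> p (apps h as) \<pi> \<longleftrightarrow>
     (\<exists>\<rho>. \<pi> = replicate (length as) 0 @ \<rho> \<and> fixat \<sigma> p h \<rho>) \<or> fixarg \<sigma> p (rev as) \<pi>"
proof (induction as arbitrary: \<pi> rule: rev_induct)
  case (snoc a as)
  show ?case
  proof (cases \<pi>)
    case (Cons j \<pi>')
    then show ?thesis
      using snoc by (auto simp: apps_snoc kids_app nth_Cons' split: arg.splits if_splits)
  qed (auto simp: apps_snoc)
next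
  case Nil then show ?case by (cases \<pi>) auto
qed

lemma not_argpos_replicate [simp]: "\<not> argpos n (replicate n 0 @ \<rho>)"
  by (induction n) auto

lemma fixat_apps_head [simp]: "fixat \<sigma> p (apps h as) (replicate (length as) 0 @ \<rho>) \<longleftrightarrow> fixat \<sigma> p h \<rho>"
  using fixarg_argpos[of \<sigma> p "rev as" "replicate (length as) 0 @ \<rho>"] by (auto simp: fixat_apps)

lemma fixat_apps_arg: "argpos (length as) \<pi> \<Longrightarrow> fixat \<sigma> p (apps h as) \<pi> \<longleftrightarrow> fixarg \<sigma> p (rev as) \<pi>"
  by (auto simp: fixat_apps)

subsection \<open>Erasing annotations\<close>

lemma erase_simps [simp]:
  "erase (Eq s t) = Eq s t"
  "erase (Or \<phi> \<psi>) = Or (erase \<phi>) (erase \<psi>)"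
  "erase (And \<phi> \<psi>) = And (erase \<phi>) (erase \<psi>)"
  "erase (FFree x T) = FFree x T"
  "erase (FBound i) = FBound i"
  "erase (Lam A \<phi>) = Lam A (erase \<phi>)"
  "erase (AppF \<phi> \<psi>) = AppF (erase \<phi>) (erase \<psi>)"
  "erase (AppT \<phi> t) = AppT (erase \<phi>) t"
  "erase (Fix \<sigma> a T \<phi>) = Fix \<sigma> () T (erase \<phi>)"
  by (simp_all add: erase_def)

lemma erase_eq_simps:
  "erase \<alpha> = Eq s t \<longleftrightarrow> \<alpha> = Eq s t"
  "erase \<alpha> = Or \<phi> \<psi> \<longleftrightarrow> (\<exists>\<phi>' \<psi>'. \<alpha> = Or \<phi>' \<psi>' \<and> erase \<phi>' = \<phi> \<and> erase \<psi>' = \<psi>)"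
  "erase \<alpha> = And \<phi> \<psi> \<longleftrightarrow> (\<exists>\<phi>' \<psi>'. \<alpha> = And \<phi>' \<psi>' \<and> erase \<phi>' = \<phi> \<and> erase \<psi>' = \<psi>)"
  "erase \<alpha> = FFree x T \<longleftrightarrow> \<alpha> = FFree x T"
  "erase \<alpha> = FBound i \<longleftrightarrow> \<alpha> = FBound i"
  "erase \<alpha> = Lam A \<phi> \<longleftrightarrow> (\<exists>\<phi>'. \<alpha> = Lam A \<phi>' \<and> erase \<phi>' = \<phi>)"
  "erase \<alpha> = AppF \<phi> \<psi> \<longleftrightarrow> (\<exists>\<phi>' \<psi>'. \<alpha> = AppF \<phi>' \<psi>' \<and> erase \<phi>' = \<phi> \<and> erase \<psi>' = \<psi>)"
  "erase \<alpha> = AppT \<phi> t \<longleftrightarrow> (\<exists>\<phi>'. \<alpha> = AppT \<phi>' t \<and> erase \<phi>' = \<phi>)"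
  "erase \<alpha> = Fix \<sigma> u T \<phi> \<longleftrightarrow> (\<exists>\<phi>' a. \<alpha> = Fix \<sigma> a T \<phi>' \<and> erase \<phi>' = \<phi>)"
  by (cases \<alpha>; auto)+

definition erase_arg :: "'a arg \<Rightarrow> unit arg" where "erase_arg = map_arg (\<lambda>_. ())"

lemma erase_arg_simps [simp]: "erase_arg (FArg \<phi>) = FArg (erase \<phi>)" "erase_arg (TArg t) = TArg t"
  by (simp_all add: erase_arg_def erase_def)

lemma erase_app [simp]: "erase (app f a) = app (erase f) (erase_arg a)"
  by (cases a) auto

lemma erase_apps [simp]: "erase (apps h as) = apps (erase h) (map erase_arg as)"
  by (induction as rule: rev_induct) (auto simp: apps_snoc)

lemma kids_erase [simp]: "kids (erase \<phi>) = map erase (kids \<phi>)"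
  by (cases \<phi>) auto

lemma binds_erase [simp]: "binds (erase \<phi>) = binds \<phi>"
  by (cases \<phi>) auto

lemma occs_erase [simp]: "occs x T (erase \<phi>) = occs x T \<phi>"
  by (induction \<phi>) auto

lemma sub_erase [simp]: "sub (erase \<phi>) \<pi> = map_option erase (sub \<phi> \<pi>)"
  by (induction \<pi> arbitrary: \<phi>) auto

lemma fixat_erase: "fixat \<sigma> () (erase \<phi>) \<pi> \<longleftrightarrow> (\<exists>p. fixat \<sigma> p \<phi> \<pi>)"
  by (induction \<pi> arbitrary: \<phi>) (auto simp: erase_eq_simps)

lemma holeat_erase [simp]: "holeat k (erase \<phi>) \<pi> \<rho> \<longleftrightarrow> holeat k \<phi> \<pi> \<rho>"
  by (induction k \<phi> \<pi> \<rho> rule: holeat.induct) (auto simp: erase_eq_simps)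

lemma left_occs_erase [simp]: "left_occs x T (erase \<phi>) \<pi> = left_occs x T \<phi> \<pi>"
  by (induction \<pi> arbitrary: \<phi>) (auto simp: take_map comp_def)

lemma erase_tsubst [simp]: "erase (tsubst \<rho> \<phi>) = tsubst \<rho> (erase \<phi>)"
  by (induction \<phi>) auto

lemma inst_tm_erase [simp]: "inst_tm k (erase_arg a) t = inst_tm k a t"
  by (induction t) (auto split: arg.splits simp: erase_arg_def)

lemma erase_inst [simp]: "erase (inst k a \<phi>) = inst k (erase_arg a) (erase \<phi>)"
  by (induction \<phi> arbitrary: k) (auto split: arg.splits)

lemma erase_var_arg [simp]: "erase_arg (var_arg v) = var_arg v"
  by (cases v rule: var_arg.cases) auto

text \<open>Substitution can be undone on annotated formulas: labels not present in the unannotated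
  premise are found in the conclusion. This allows an annotation to be continued upwards.\<close>

lemma erase_tsubst_ex: "erase \<alpha> = tsubst \<rho> \<phi> \<Longrightarrow> \<exists>\<beta>. erase \<beta> = \<phi> \<and> \<alpha> = tsubst \<rho> \<beta>"
proof (induction \<phi> arbitrary: \<alpha>)
  case (Eq s t) then show ?case by (intro exI[of _ "Eq s t"]) (auto simp: erase_eq_simps)
next
  case (Or \<phi> \<psi>) 
  then obtain a b where "\<alpha> = Or a b" "erase a = tsubst \<rho> \<phi>" "erase b = tsubst \<rho> \<psi>" by (auto simp: erase_eq_simps)
  then show ?case using Or.IH(1)[of a] Or.IH(2)[of b] by (metis erase_simps(2) tsubst.simps(2))
next
  case (And \<phi> \<psi>) 
  then obtain a b where "\<alpha> = And a b" "erase a = tsubst \<rho> \<phi>" "erase b = tsubst \<rho> \<psi>" by (auto simp: erase_eq_simps)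
  then show ?case using And.IH(1)[of a] And.IH(2)[of b] by (metis erase_simps(3) tsubst.simps(3))
next
  case (AppF \<phi> \<psi>) 
  then obtain a b where "\<alpha> = AppF a b" "erase a = tsubst \<rho> \<phi>" "erase b = tsubst \<rho> \<psi>" by (auto simp: erase_eq_simps)
  then show ?case using AppF.IH(1)[of a] AppF.IH(2)[of b] by (metis erase_simps(7) tsubst.simps(7))
next
  case (FFree x T) then show ?case by (intro exI[of _ "FFree x T"]) (auto simp: erase_eq_simps)
next
  case (FBound x) then show ?case by (intro exI[of _ "FBound x"]) (auto simp: erase_eq_simps)
next
  case (Lam A \<phi>)
  then obtain a where "\<alpha> = Lam A a" "erase a = tsubst \<rho> \<phi>" by (auto simp: erase_eq_simps)
  then show ?case using Lam.IH[of a] by (metis erase_simps(6) tsubst.simps(6))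
next
  case (AppT \<phi> t)
  then obtain a where "\<alpha> = AppT a (subst_tm \<rho> t)" "erase a = tsubst \<rho> \<phi>" by (auto simp: erase_eq_simps)
  then show ?case using AppT.IH[of a] by (metis erase_simps(8) tsubst.simps(8))
next
  case (Fix \<sigma> u T \<phi>)
  then obtain a p where "\<alpha> = Fix \<sigma> p T a" "erase a = tsubst \<rho> \<phi>" by (auto simp: erase_eq_simps)
  moreover obtain b where "erase b = \<phi>" "a = tsubst \<rho> b" using Fix.IH calculation by blast
  ultimately show ?case by (intro exI[of _ "Fix \<sigma> p T b"]) auto
qed

text \<open>The copies of \<open>\<psi>\<close> may carry different labels, so an annotated instance
  need not be an \<open>fsubst\<close>; it is a \<open>plug\<close> with a list of differently
  annotated copies.\<close>

lemma erase_fsubst_ex: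
  "erase \<alpha> = fsubst x T \<psi> \<phi> \<Longrightarrow>
     \<exists>\<beta> \<psi>s. erase \<beta> = \<phi> \<and> length \<psi>s = occs x T \<phi> \<and> (\<forall>\<psi>' \<in> set \<psi>s. erase \<psi>' = \<psi>) \<and> \<alpha> = plug x T \<psi>s \<beta>"
proof (induction \<phi> arbitrary: \<alpha>)
  have two: "\<exists>\<beta> \<psi>s. erase \<beta> = C \<phi> \<chi> \<and> length \<psi>s = occs x T (C \<phi> \<chi>) \<and> (\<forall>\<psi>' \<in> set \<psi>s. erase \<psi>' = \<psi>) \<and> \<alpha> = plug x T \<psi>s \<beta>"
    if C: "\<And>\<psi>s a b. plug x T \<psi>s (C' a b) = C' (plug x T (take (occs x T a) \<psi>s) a) (plug x T (drop (occs x T a) \<psi>s) b)"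
      "\<And>a b. erase (C' a b) = C (erase a) (erase b)" "\<And>a b. occs x T (C a b) = occs x T a + occs x T b"
      and \<alpha>: "\<alpha> = C' a b"
      and a: "\<exists>\<beta> \<psi>s. erase \<beta> = \<phi> \<and> length \<psi>s = occs x T \<phi> \<and> (\<forall>\<psi>' \<in> set \<psi>s. erase \<psi>' = \<psi>) \<and> a = plug x T \<psi>s \<beta>"
      and b: "\<exists>\<beta> \<psi>s. erase \<beta> = \<chi> \<and> length \<psi>s = occs x T \<chi> \<and> (\<forall>\<psi>' \<in> set \<psi>s. erase \<psi>' = \<psi>) \<and> b = plug x T \<psi>s \<beta>"
    for C :: "form \<Rightarrow> form \<Rightarrow> form" and C' :: "'a fm \<Rightarrow> 'a fm \<Rightarrow> 'a fm" and a b \<alpha> :: "'a fm" and \<phi> \<chi>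
  proof -
    obtain \<beta>1 \<psi>s1 \<beta>2 \<psi>s2 where *: "erase \<beta>1 = \<phi>" "length \<psi>s1 = occs x T \<phi>" "\<forall>\<psi>' \<in> set \<psi>s1. erase \<psi>' = \<psi>"
      "a = plug x T \<psi>s1 \<beta>1" "erase \<beta>2 = \<chi>" "length \<psi>s2 = occs x T \<chi>" "\<forall>\<psi>' \<in> set \<psi>s2. erase \<psi>' = \<psi>"
      "b = plug x T \<psi>s2 \<beta>2" using a b by blast
    \<comment> \<open>The split point of \<open>plug\<close> is computed from the annotated formula
      and must fall between the two lists.\<close>
    have "occs x T \<beta>1 = length \<psi>s1" using * occs_erase[of x T \<beta>1] by simp
    then show ?thesis
      using * C \<alpha> by (intro exI[of _ "C' \<beta>1 \<beta>2"] exI[of _ "\<psi>s1 @ \<psi>s2"]) auto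
  qed
  {
    case (Or \<phi> \<chi>) 
    then obtain a b where *: "\<alpha> = Or a b" "erase a = fsubst x T \<psi> \<phi>" "erase b = fsubst x T \<psi> \<chi>"
      by (auto simp: erase_eq_simps)
    show ?case by (rule two[of Or, OF _ _ _ *(1) Or.IH(1)[OF *(2)] Or.IH(2)[OF *(3)]]) simp_all
  next
    case (And \<phi> \<chi>) 
    then obtain a b where *: "\<alpha> = And a b" "erase a = fsubst x T \<psi> \<phi>" "erase b = fsubst x T \<psi> \<chi>"
      by (auto simp: erase_eq_simps)
    show ?case by (rule two[of And, OF _ _ _ *(1) And.IH(1)[OF *(2)] And.IH(2)[OF *(3)]]) simp_all
  next
    case (AppF \<phi> \<chi>) 
    then obtain a b where *: "\<alpha> = AppF a b" "erase a = fsubst x T \<psi> \<phi>" "erase b = fsubst x T \<psi> \<chi>"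
      by (auto simp: erase_eq_simps)
    show ?case by (rule two[of AppF, OF _ _ _ *(1) AppF.IH(1)[OF *(2)] AppF.IH(2)[OF *(3)]]) simp_all
  next
    case (Eq s t) then show ?case by (intro exI[of _ "Eq s t"] exI[of _ "[]"]) (auto simp: erase_eq_simps)
  next
    case (FBound s) then show ?case by (intro exI[of _ "FBound s"] exI[of _ "[]"]) (auto simp: erase_eq_simps)
  next
    case (FFree y U) then show ?case
      by (intro exI[of _ "FFree y U"] exI[of _ "if y = x \<and> U = T then [\<alpha>] else []"])
        (auto simp: erase_eq_simps split: if_splits)
  next
    case (Lam A \<phi>)
    then obtain a where *: "\<alpha> = Lam A a" "erase a = fsubst x T \<psi> \<phi>" by (auto simp: erase_eq_simps)
    obtain \<beta> \<psi>s where "erase \<beta> = \<phi>" "length \<psi>s = occs x T \<phi>" "\<forall>\<psi>' \<in> set \<psi>s. erase \<psi>' = \<psi>" "a = plug x T \<psi>s \<beta>"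
      using Lam.IH[OF *(2)] by blast
    then show ?case using * by (intro exI[of _ "Lam A \<beta>"] exI[of _ \<psi>s]) auto
  next
    case (AppT \<phi> t)
    then obtain a where *: "\<alpha> = AppT a t" "erase a = fsubst x T \<psi> \<phi>" by (auto simp: erase_eq_simps)
    obtain \<beta> \<psi>s where "erase \<beta> = \<phi>" "length \<psi>s = occs x T \<phi>" "\<forall>\<psi>' \<in> set \<psi>s. erase \<psi>' = \<psi>" "a = plug x T \<psi>s \<beta>"
      using AppT.IH[OF *(2)] by blast
    then show ?case using * by (intro exI[of _ "AppT \<beta> t"] exI[of _ \<psi>s]) auto
  next
    case (Fix \<sigma> u U \<phi>)
    then obtain a p where *: "\<alpha> = Fix \<sigma> p U a" "erase a = fsubst x T \<psi> \<phi>" by (auto simp: erase_eq_simps)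
    obtain \<beta> \<psi>s where "erase \<beta> = \<phi>" "length \<psi>s = occs x T \<phi>" "\<forall>\<psi>' \<in> set \<psi>s. erase \<psi>' = \<psi>" "a = plug x T \<psi>s \<beta>"
      using Fix.IH[OF *(2)] by blast
    then show ?case using * by (intro exI[of _ "Fix \<sigma> p U \<beta>"] exI[of _ \<psi>s]) auto
  }
qed

lemma erase_apps_ex: "erase \<alpha> = apps h as \<Longrightarrow>
   \<exists>h' as'. \<alpha> = apps h' as' \<and> erase h' = h \<and> map erase_arg as' = as"
proof (induction as arbitrary: \<alpha> rule: rev_induct)
  case (snoc a as)
  have "\<exists>f b. \<alpha> = app f b \<and> erase f = apps h as \<and> erase_arg b = a"
    using snoc.prems
  proof (cases a)
    case (FArg \<psi>)
    then obtain f \<psi>' where "\<alpha> = AppF f \<psi>'" "erase f = apps h as" "erase \<psi>' = \<psi>"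
      using snoc.prems by (auto simp: apps_snoc erase_eq_simps)
    then show ?thesis using FArg by (intro exI[of _ f] exI[of _ "FArg \<psi>'"]) auto
  next
    case (TArg t)
    then obtain f where "\<alpha> = AppT f t" "erase f = apps h as"
      using snoc.prems by (auto simp: apps_snoc erase_eq_simps)
    then show ?thesis using TArg by (intro exI[of _ f] exI[of _ "TArg t"]) auto
  qed
  then obtain f b where *: "\<alpha> = app f b" "erase f = apps h as" "erase_arg b = a" by blast
  then obtain h' as' where "f = apps h' as'" "erase h' = h" "map erase_arg as' = as"
    using snoc.IH by blast
  then show ?case using * by (intro exI[of _ h'] exI[of _ "as' @ [b]"]) (auto simp: apps_snoc)
next
  case Nil then show ?case by (intro exI[of _ \<alpha>] exI[of _ "[]"]) simp
qed

fun is_app :: "'a fm \<Rightarrow> bool" where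
  "is_app (AppF \<phi> \<psi>) = True" | "is_app (AppT \<phi> t) = True" | "is_app _ = False"

lemma is_app_app [simp]: "is_app (app f a)"
  by (cases a) auto

lemma app_inject [simp]: "app f a = app g b \<longleftrightarrow> f = g \<and> a = b"
  by (cases a; cases b) auto

text \<open>An application could be cut into head and arguments in several ways; a head that is no
  application makes the cut unique.\<close>

lemma apps_inject:
  "apps h as = apps h' as' \<Longrightarrow> \<not> is_app h \<Longrightarrow> \<not> is_app h' \<Longrightarrow> h = h' \<and> as = as'"
proof (induction as arbitrary: as' rule: rev_induct)
  case Nil
  then show ?case by (cases as' rule: rev_cases) (auto simp: apps_snoc)
next
  case (snoc a as)
  then show ?case by (cases as' rule: rev_cases) (auto simp: apps_snoc)
qed

section \<open>Descent of operators along a rule\<close>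

text \<open>
  In \<open>apps h as\<close> the position of \<open>h\<close> is \<open>replicate (length as) 0\<close>, and \<open>argpos (length as)\<close> holds
  of the positions inside \<open>as\<close>. The flag \<open>b\<close> tells whether the step unfolds the operator at \<open>\<pi>\<close>,
  so that the label of its copy at \<open>\<pi>'\<close> is longer by one number.
\<close>

definition head_step ::
  "nat \<Rightarrow> (bool \<Rightarrow> nat list \<Rightarrow> nat list \<Rightarrow> bool) \<Rightarrow> bool \<Rightarrow> nat list \<Rightarrow> nat list \<Rightarrow> bool" where
  "head_step n H b \<pi> \<pi>' \<longleftrightarrow> (\<not> b \<and> \<pi> = \<pi>' \<and> argpos n \<pi>) \<or>
     (\<exists>\<rho> \<rho>'. \<pi> = replicate n 0 @ \<rho> \<and> \<pi>' = replicate n 0 @ \<rho>' \<and> H b \<rho> \<rho>')"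

text \<open>\<open>\<pi>\<close> lives in the conclusion and \<open>\<pi>'\<close> in the premise.
  In a redex the body is at \<open>[0, 0]\<close> and the argument at \<open>[1]\<close>. In an
  unfolding the body is at \<open>[0]\<close>, and every hole receives a copy of the whole operator
  formula: its position \<open>[]\<close> is the operator itself, whose label grows, and its other
  positions keep their labels.\<close>

fun pos_principal :: "rule \<Rightarrow> nat \<Rightarrow> nat \<Rightarrow> bool \<Rightarrow> nat list \<Rightarrow> nat list \<Rightarrow> bool" where
  "pos_principal (OrL \<Gamma> \<Delta> \<phi> \<psi>) j i b \<pi> \<pi>' \<longleftrightarrow> \<not> b \<and> \<pi> = (if j = 0 then 0 else 1) # \<pi>'"
| "pos_principal (OrR \<Gamma> \<Delta> \<phi> \<psi>) j i b \<pi> \<pi>' \<longleftrightarrow> \<not> b \<and> \<pi> = (if i = 0 then 0 else 1) # \<pi>'"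
| "pos_principal (AndL \<Gamma> \<Delta> \<phi> \<psi>) j i b \<pi> \<pi>' \<longleftrightarrow> \<not> b \<and> \<pi> = (if i = length \<Gamma> then 0 else 1) # \<pi>'"
| "pos_principal (AndR \<Gamma> \<Delta> \<phi> \<psi>) j i b \<pi> \<pi>' \<longleftrightarrow> \<not> b \<and> \<pi> = (if j = 0 then 0 else 1) # \<pi>'"
| "pos_principal (LamL \<Gamma> \<Delta> A \<phi> a as) j i b \<pi> \<pi>' \<longleftrightarrow> head_step (length as)
     (\<lambda>b \<rho> \<rho>'. \<not> b \<and> (\<rho> = 0 # 0 # \<rho>' \<or> (\<exists>\<rho>2. \<rho> = 1 # \<rho>2 \<and> holeat 0 \<phi> \<rho>' \<rho>2))) b \<pi> \<pi>'"
| "pos_principal (LamR \<Gamma> \<Delta> A \<phi> a as) j i b \<pi> \<pi>' \<longleftrightarrow> head_step (length as)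
     (\<lambda>b \<rho> \<rho>'. \<not> b \<and> (\<rho> = 0 # 0 # \<rho>' \<or> (\<exists>\<rho>2. \<rho> = 1 # \<rho>2 \<and> holeat 0 \<phi> \<rho>' \<rho>2))) b \<pi> \<pi>'"
| "pos_principal (FixL \<Gamma> \<Delta> \<sigma> T \<phi> as) j i b \<pi> \<pi>' \<longleftrightarrow> head_step (length as)
     (\<lambda>b \<rho> \<rho>'. (\<not> b \<and> \<rho> = 0 # \<rho>') \<or> ((b \<longleftrightarrow> \<rho> = []) \<and> holeat 0 \<phi> \<rho>' \<rho>)) b \<pi> \<pi>'"
| "pos_principal (FixR \<Gamma> \<Delta> \<sigma> T \<phi> as) j i b \<pi> \<pi>' \<longleftrightarrow> head_step (length as)
     (\<lambda>b \<rho> \<rho>'. (\<not> b \<and> \<rho> = 0 # \<rho>') \<or> ((b \<longleftrightarrow> \<rho> = []) \<and> holeat 0 \<phi> \<rho>' \<rho>)) b \<pi> \<pi>'"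
| "pos_principal (Mono \<Gamma> \<Delta> x T \<phi> \<psi> \<chi> ys) j i b \<pi> \<pi>' \<longleftrightarrow> \<not> b \<and>
     (\<exists>\<rho> \<rho>'. \<pi>' = replicate (length ys) 0 @ \<rho>' \<and> \<pi> = \<rho> @ \<rho>' \<and> sub \<phi> \<rho> = Some (FFree x T) \<and>
        left_occs x T \<phi> \<rho> = j)"
| "pos_principal (P2 \<Gamma> \<Delta> s t) j i b \<pi> \<pi>' \<longleftrightarrow> False"
| "pos_principal _ j i b \<pi> \<pi>' \<longleftrightarrow> \<not> b \<and> \<pi> = \<pi>'"

text \<open>
  An operator of the conclusion of \<open>SubstF\<close> that comes from the substituted formula has no descendant.
\<close>

fun pos_side :: "rule \<Rightarrow> occurrence \<Rightarrow> nat list \<Rightarrow> bool" where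
  "pos_side (SubstF \<Gamma> \<Delta> x T \<phi>) (d, i) \<pi> \<longleftrightarrow> (\<exists>\<sigma>. fixat \<sigma> () (formulas d (\<Gamma>, \<Delta>) ! i) \<pi>)"
| "pos_side _ _ \<pi> \<longleftrightarrow> True"

definition pos_step ::
  "rule \<Rightarrow> nat \<Rightarrow> occurrence \<Rightarrow> occurrence \<Rightarrow> bool \<Rightarrow> nat list \<Rightarrow> nat list \<Rightarrow> bool" where
  "pos_step r j oc oc' b \<pi> \<pi>' \<longleftrightarrow>
     (if principal r oc then pos_principal r j (snd oc') b \<pi> \<pi>' else \<not> b \<and> \<pi> = \<pi>' \<and> pos_side r oc' \<pi>)"

text \<open>Lifts an account of what happens at the head to an application to common arguments.
  \<open>H\<close> relates positions within the head and \<open>L\<close> is the effect on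
  labels.\<close>

lemma apps_step:
  assumes len: "length as = n"
    and H: "\<And>\<rho>' p'. fixat \<sigma> p' h' \<rho>' \<longleftrightarrow> (\<exists>\<rho> p b. fixat \<sigma> p h \<rho> \<and> H b \<rho> \<rho>' \<and> p' = L b p)"
    and L: "\<And>p. L False p = p"
  shows "fixat \<sigma> p' (apps h' as) \<pi>' \<longleftrightarrow>
     (\<exists>\<pi> p b. fixat \<sigma> p (apps h as) \<pi> \<and> head_step n H b \<pi> \<pi>' \<and> p' = L b p)"
proof
  assume "fixat \<sigma> p' (apps h' as) \<pi>'"
  then consider \<rho>' where "\<pi>' = replicate n 0 @ \<rho>'" "fixat \<sigma> p' h' \<rho>'" | "fixarg \<sigma> p' (rev as) \<pi>'"
    unfolding fixat_apps len by blast
  then show "\<exists>\<pi> p b. fixat \<sigma> p (apps h as) \<pi> \<and> head_step n H b \<pi> \<pi>' \<and> p' = L b p"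
  proof cases
    case (1 \<rho>')
    then obtain \<rho> p b where "fixat \<sigma> p h \<rho>" "H b \<rho> \<rho>'" "p' = L b p" using H by blast
    then show ?thesis using 1 len
      by (intro exI[of _ "replicate n 0 @ \<rho>"] exI[of _ p] exI[of _ b])
        (auto simp: head_step_def fixat_apps)
  next
    case 2
    then show ?thesis using len fixarg_argpos[OF 2] L
      by (intro exI[of _ \<pi>'] exI[of _ p'] exI[of _ False]) (auto simp: head_step_def fixat_apps)
  qed
next
  assume "\<exists>\<pi> p b. fixat \<sigma> p (apps h as) \<pi> \<and> head_step n H b \<pi> \<pi>' \<and> p' = L b p"
  then obtain \<pi> p b where *: "fixat \<sigma> p (apps h as) \<pi>" "head_step n H b \<pi> \<pi>'" "p' = L b p" by blast
  from *(2) show "fixat \<sigma> p' (apps h' as) \<pi>'"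
    unfolding head_step_def
  proof (elim disjE exE conjE)
    assume "\<not> b" "\<pi> = \<pi>'" "argpos n \<pi>"
    then show ?thesis using * L len by (simp add: fixat_apps_arg)
  next
    fix \<rho> \<rho>' assume \<rho>: "\<pi> = replicate n 0 @ \<rho>" "\<pi>' = replicate n 0 @ \<rho>'" "H b \<rho> \<rho>'"
    then have "fixat \<sigma> p h \<rho>" using * len by auto
    then have "fixat \<sigma> p' h' \<rho>'" using H \<rho> * by blast
    then show ?thesis using \<rho> len by auto
  qed
qed

text \<open>No label grows here: \<open>b\<close> is never true, and the \<open>if\<close> with an
  arbitrary \<open>L\<close> only gives the conclusion the form shared by all rules.\<close>

lemma beta_step:
  assumes "ann_beta \<alpha> \<beta>" "erase \<alpha> = apps (Lam A \<phi>) (a # as)"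
  shows "fixat \<sigma> p' \<beta> \<pi>' \<longleftrightarrow> (\<exists>\<pi> p b. fixat \<sigma> p \<alpha> \<pi> \<and>
     head_step (length as)
       (\<lambda>b \<rho> \<rho>'. \<not> b \<and> (\<rho> = 0 # 0 # \<rho>' \<or> (\<exists>\<rho>2. \<rho> = 1 # \<rho>2 \<and> holeat 0 \<phi> \<rho>' \<rho>2))) b \<pi> \<pi>' \<and>
     p' = (if b then L p else p))"
proof -
  obtain A' \<phi>' a' as' where *: "\<alpha> = apps (Lam A' \<phi>') (a' # as')" "\<beta> = apps (inst 0 a' \<phi>') as'"
    using assms(1) unfolding ann_beta_def by blast
  have "apps (Lam A' (erase \<phi>')) (map erase_arg (a' # as')) = apps (Lam A \<phi>) (a # as)"
    using assms(2) * by simp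
  from apps_inject[OF this] have eq: "erase \<phi>' = \<phi>" "length as' = length as"
    using map_eq_imp_length_eq by auto
  show ?thesis
    unfolding * apps_Cons
  proof (rule apps_step[where L = "\<lambda>b p. if b then L p else p"])
    fix \<rho>' p'
    show "fixat \<sigma> p' (inst 0 a' \<phi>') \<rho>' \<longleftrightarrow> (\<exists>\<rho> p b. fixat \<sigma> p (app (Lam A' \<phi>') a') \<rho> \<and>
       (\<not> b \<and> (\<rho> = 0 # 0 # \<rho>' \<or> (\<exists>\<rho>2. \<rho> = 1 # \<rho>2 \<and> holeat 0 \<phi> \<rho>' \<rho>2))) \<and> p' = (if b then L p else p))"
      unfolding fixat_inst eq(1)[symmetric] holeat_erase
      by (cases a') (auto simp: ex_bool_eq intro: exI[of _ "0 # 0 # \<rho>'"] exI[of _ "Suc 0 # _"])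
  qed (use eq in auto)
qed

text \<open>A premise operator at a hole comes from the unfolded operator if it is the root of the
  copy, and from the operator at the same place of the conclusion otherwise. An operator of the body
  thus descends both to the new body and into the copies.\<close>

lemma unfold_step:
  assumes "ann_unfold k \<alpha> \<beta>" "erase \<alpha> = apps (Fix \<tau> u T \<phi>) as"
  shows "fixat \<sigma> p' \<beta> \<pi>' \<longleftrightarrow> (\<exists>\<pi> p b. fixat \<sigma> p \<alpha> \<pi> \<and>
     head_step (length as)
       (\<lambda>b \<rho> \<rho>'. (\<not> b \<and> \<rho> = 0 # \<rho>') \<or> ((b \<longleftrightarrow> \<rho> = []) \<and> holeat 0 \<phi> \<rho>' \<rho>)) b \<pi> \<pi>' \<and>
     p' = (if b then p @ [k] else p))"
proof -
  obtain \<tau>' q T' \<phi>' as' where *: "\<alpha> = apps (Fix \<tau>' q T' \<phi>') as'"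
      "\<beta> = apps (inst 0 (FArg (Fix \<tau>' (q @ [k]) T' \<phi>')) \<phi>') as'"
    using assms(1) unfolding ann_unfold_def by blast
  have "apps (Fix \<tau>' () T' (erase \<phi>')) (map erase_arg as') = apps (Fix \<tau> u T \<phi>) as"
    using assms(2) * by simp
  from apps_inject[OF this] have eq: "erase \<phi>' = \<phi>" "length as' = length as"
    using map_eq_imp_length_eq by auto
  have fixat_Fix: "fixat \<sigma> p (Fix \<tau>' q T' \<phi>') \<rho> \<longleftrightarrow>
      (\<rho> = [] \<and> \<sigma> = \<tau>' \<and> p = q) \<or> (\<exists>\<rho>'. \<rho> = 0 # \<rho>' \<and> fixat \<sigma> p \<phi>' \<rho>')" for q p \<rho>
    by (cases \<rho>) auto
  show ?thesis
    unfolding * 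
  proof (rule apps_step[where L = "\<lambda>b p. if b then p @ [k] else p"])
    fix \<rho>' p'
    show "fixat \<sigma> p' (inst 0 (FArg (Fix \<tau>' (q @ [k]) T' \<phi>')) \<phi>') \<rho>' \<longleftrightarrow>
       (\<exists>\<rho> p b. fixat \<sigma> p (Fix \<tau>' q T' \<phi>') \<rho> \<and>
       ((\<not> b \<and> \<rho> = 0 # \<rho>') \<or> ((b \<longleftrightarrow> \<rho> = []) \<and> holeat 0 \<phi> \<rho>' \<rho>)) \<and> p' = (if b then p @ [k] else p))"
      unfolding fixat_inst eq(1)[symmetric] holeat_erase
      by (auto simp: fixat_Fix)
  qed (use eq in auto)
qed

lemma mono_step:
  assumes "erase \<phi>' = \<phi>" "length \<psi>s = occs x T \<phi>" "\<alpha> = plug x T \<psi>s \<phi>'"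
    "\<beta> = apps (\<psi>s ! j) (map var_arg ys)" "j < occs x T \<phi>"
  shows "fixat \<sigma> p' \<beta> \<pi>' \<longleftrightarrow> (\<exists>\<pi>. fixat \<sigma> p' \<alpha> \<pi> \<and>
     (\<exists>\<rho> \<rho>'. \<pi>' = replicate (length ys) 0 @ \<rho>' \<and> \<pi> = \<rho> @ \<rho>' \<and> sub \<phi> \<rho> = Some (FFree x T) \<and>
        left_occs x T \<phi> \<rho> = j))"
proof -
  \<comment> \<open>The arguments in a premise of \<open>Mono\<close> are variables, hence free of
    operators.\<close>
  have var: "\<not> fixarg \<sigma> p' (rev (map var_arg ys)) \<pi>" for \<pi>
  proof -
    have "\<not> fixarg \<sigma> p' as \<pi>" if "\<forall>a \<in> set as. \<exists>v. a = var_arg v" for as \<pi>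
      using that
    proof (induction as arbitrary: \<pi>)
      case (Cons a as)
      then obtain v where v: "a = var_arg v" by auto
      show ?case
      proof (cases \<pi>)
        case (Cons j \<rho>)
        then show ?thesis
          using Cons.IH Cons.prems v by (cases v rule: var_arg.cases; cases \<rho>) auto
      qed simp
    qed (case_tac \<pi>; simp)
    note this[of "rev (map var_arg ys)" \<pi>]
    moreover have "\<forall>a \<in> set (rev (map var_arg ys)). \<exists>v. a = var_arg v"
      by (auto simp del: split_paired_Ex)
    ultimately show ?thesis by simp
  qed
  have sub': "sub \<phi>' \<rho> = Some (FFree x T)" if "sub \<phi> \<rho> = Some (FFree x T)" for \<rho>
    using that assms(1) by (auto simp: erase_eq_simps)
  have plug: "fixat \<sigma> p' \<alpha> (\<rho> @ \<rho>') \<longleftrightarrow> fixat \<sigma> p' (\<psi>s ! j) \<rho>'"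
    if "sub \<phi> \<rho> = Some (FFree x T)" "left_occs x T \<phi> \<rho> = j" for \<rho> \<rho>'
    using fixat_plug_occ[OF sub'[OF that(1)], of \<psi>s] assms that(2)
      left_occs_erase[of x T \<phi>' \<rho>] occs_erase[of x T \<phi>'] by simp
  obtain \<rho>0 where "sub \<phi> \<rho>0 = Some (FFree x T)" "left_occs x T \<phi> \<rho>0 = j"
    using ex_left_occs[OF assms(5)] by blast
  then show ?thesis
    unfolding assms(4) fixat_apps using var plug by (auto simp del: fixat_apps_head)
qed

text \<open>Only \<open>SubstF\<close> is not immediate: positions of the premise survive in the
  plugged formula, and \<open>pos_side\<close> excludes exactly the operators that the substituted
  formula brought in.\<close>

lemma ann_side_fixat:
  assumes "ann_side r \<alpha> \<beta>" "erase \<beta> = formulas d (prems r ! j) ! i'" "j < length (prems r)"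
  shows "fixat \<sigma> p \<beta> \<pi> \<longleftrightarrow> fixat \<sigma> p \<alpha> \<pi> \<and> pos_side r (d, i') \<pi>"
proof (cases r)
  case (SubstF \<Gamma> \<Delta> x T \<phi>)
  then have "erase \<beta> = formulas d (\<Gamma>, \<Delta>) ! i'" using assms by simp
  then have side: "pos_side r (d, i') \<pi> \<longleftrightarrow> (\<exists>\<sigma> p. fixat \<sigma> p \<beta> \<pi>)"
    using SubstF fixat_erase[of _ \<beta> \<pi>] by auto
  obtain \<psi>s where "\<alpha> = plug x T \<psi>s \<beta>" using SubstF assms by auto
  then have "fixat \<sigma> p \<beta> \<pi> \<Longrightarrow> fixat \<sigma> p \<alpha> \<pi>" for \<sigma> p by (simp add: fixat_plug)
  then show ?thesis unfolding side using fixat_unique[of _ _ \<alpha> \<pi>] by blast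
qed (use assms in auto)

lemma principal_fixat:
  assumes "ann_principal r j (d, i') k \<alpha> \<beta>" "j < length (prems r)"
    "erase \<alpha> = formulas d (concl r) ! i" "i < length (formulas d (concl r))" "principal r (d, i)"
  shows "fixat \<sigma> p' \<beta> \<pi>' \<longleftrightarrow>
    (\<exists>\<pi> p b. fixat \<sigma> p \<alpha> \<pi> \<and> pos_principal r j i' b \<pi> \<pi>' \<and> p' = (if b then p @ [k] else p))"
proof (cases r)
  case (LamL \<Gamma> \<Delta> A \<phi> a as)
  then have "erase \<alpha> = apps (Lam A \<phi>) (a # as)"
    using assms by (cases d; cases i) (auto simp: nth_append split: if_splits)
  from beta_step[OF _ this, of \<beta>] show ?thesis using LamL assms by simp
next
  case (LamR \<Gamma> \<Delta> A \<phi> a as)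
  then have "erase \<alpha> = apps (Lam A \<phi>) (a # as)"
    using assms by (cases d; cases i) (auto simp: nth_append split: if_splits)
  from beta_step[OF _ this, of \<beta>] show ?thesis using LamR assms by simp
next
  case (FixL \<Gamma> \<Delta> \<tau> T \<phi> as)
  then have "erase \<alpha> = apps (Fix \<tau> () T \<phi>) as"
    using assms by (cases d; cases i) (auto simp: nth_append split: if_splits)
  from unfold_step[OF _ this, of k \<beta>] show ?thesis using FixL assms by simp
next
  case (FixR \<Gamma> \<Delta> \<tau> T \<phi> as)
  then have "erase \<alpha> = apps (Fix \<tau> () T \<phi>) as"
    using assms by (cases d; cases i) (auto simp: nth_append split: if_splits)
  from unfold_step[OF _ this, of k \<beta>] show ?thesis using FixR assms by simp
next
  case (Mono \<Gamma> \<Delta> x T \<phi> \<psi> \<chi> ys)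
  then obtain \<phi>' \<psi>s where "erase \<phi>' = \<phi>" "length \<psi>s = occs x T \<phi>" "\<alpha> = plug x T \<psi>s \<phi>'"
    "\<beta> = apps (\<psi>s ! j) (map var_arg ys)" using assms(1) by auto
  from mono_step[OF this] assms(2) Mono show ?thesis by (simp add: ex_bool_eq)
next
  case (P2 \<Gamma> \<Delta> s t)
  then have "\<beta> = Eq s t" using assms by simp
  then show ?thesis using P2 by (cases \<pi>') simp_all
qed (use assms in \<open>auto simp: less_length_2 ex_bool_eq\<close>)

text \<open>The passage from annotations to positions: the relation between positions does not
  mention labels. Read from left to right it traces a label back; read from right to left it carries
  one along a thread.\<close>

theorem ann_rule_fixat:
  assumes "ann_rule r j (d, i) (d, i') k \<alpha> \<beta>" "j < length (prems r)"
    "erase \<alpha> = formulas d (concl r) ! i" "i < length (formulas d (concl r))"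
    "erase \<beta> = formulas d (prems r ! j) ! i'"
  shows "fixat \<sigma> p' \<beta> \<pi>' \<longleftrightarrow>
    (\<exists>\<pi> p b. fixat \<sigma> p \<alpha> \<pi> \<and> pos_step r j (d, i) (d, i') b \<pi> \<pi>' \<and> p' = (if b then p @ [k] else p))"
proof (cases "principal r (d, i)")
  case True
  then show ?thesis
    using principal_fixat[of r j d i' k \<alpha> \<beta> i] assms unfolding ann_rule_def pos_step_def by simp
next
  case False
  then have "ann_side r \<alpha> \<beta>" using assms(1) unfolding ann_rule_def by simp
  from ann_side_fixat[OF this assms(5,2)] show ?thesis
    unfolding pos_step_def if_not_P[OF False] by (simp add: ex_bool_eq)
qed

section \<open>Continuing annotations to a premise\<close>

fun is_subst :: "rule \<Rightarrow> bool" where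
  "is_subst (SubstF \<Gamma> \<Delta> x T \<phi>) = True"
| "is_subst (SubstT \<Gamma> \<Delta> x t) = True"
| "is_subst (EqL \<Gamma> \<Delta> x y s t) = True"
| "is_subst _ = False"

lemma plain_formula:
  assumes "relevant r j (d, i) (d, i')" "j < length (prems r)"
    "i < length (formulas d (concl r))" "i' < length (formulas d (prems r ! j))"
    "\<not> is_subst r" "\<not> principal r (d, i)"
  shows "formulas d (prems r ! j) ! i' = formulas d (concl r) ! i"
  using assms
  by (cases r; cases d)
    (auto simp: nth_append nth_Cons' less_length_2 numeral_2_eq_2 split: if_splits)

lemma ann_side_ex:
  assumes "relevant r j (d, i) (d, i')" "j < length (prems r)"
    "i < length (formulas d (concl r))" "i' < length (formulas d (prems r ! j))"
    "erase \<alpha> = formulas d (concl r) ! i" "\<not> principal r (d, i)"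
  shows "\<exists>\<beta>. erase \<beta> = formulas d (prems r ! j) ! i' \<and> ann_side r \<alpha> \<beta>"
proof (cases r)
  case (SubstF \<Gamma> \<Delta> x T \<phi>)
  then have "erase \<alpha> = fsubst x T \<phi> (formulas d (prems r ! j) ! i')"
    using assms by (cases d) auto
  from erase_fsubst_ex[OF this] obtain \<beta> \<psi>s where
    "erase \<beta> = formulas d (prems r ! j) ! i'" "length \<psi>s = occs x T (formulas d (prems r ! j) ! i')"
    "\<forall>\<psi>' \<in> set \<psi>s. erase \<psi>' = \<phi>" "\<alpha> = plug x T \<psi>s \<beta>" by blast
  moreover from this have "length \<psi>s = occs x T \<beta>" using occs_erase[of x T \<beta>] by simp
  ultimately show ?thesis using SubstF by (intro exI[of _ \<beta>]) auto
next
  case (SubstT \<Gamma> \<Delta> x t)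
  then have "erase \<alpha> = tsubst (TFree(x := t)) (formulas d (prems r ! j) ! i')"
    using assms by (cases d) auto
  from erase_tsubst_ex[OF this] show ?thesis using SubstT by auto
next
  case (EqL \<Gamma> \<Delta> x y s t)
  then have "\<exists>\<phi>. erase \<alpha> = tsubst (TFree(x := s, y := t)) \<phi> \<and>
      formulas d (prems r ! j) ! i' = tsubst (TFree(x := t, y := s)) \<phi>"
    using assms by (cases d) (auto simp: nth_append split: if_splits)
  then obtain \<phi> where \<phi>: "erase \<alpha> = tsubst (TFree(x := s, y := t)) \<phi>"
      "formulas d (prems r ! j) ! i' = tsubst (TFree(x := t, y := s)) \<phi>" by blast
  from erase_tsubst_ex[OF \<phi>(1)] obtain \<gamma> where "erase \<gamma> = \<phi>" "\<alpha> = tsubst (TFree(x := s, y := t)) \<gamma>"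
    by blast
  then show ?thesis using EqL \<phi> by (intro exI[of _ "tsubst (TFree(x := t, y := s)) \<gamma>"]) auto
qed (use plain_formula[OF assms(1-4) _ assms(6)] assms(5) in simp_all)

lemma ann_unfoldI:
  "ann_unfold k (apps (Fix \<sigma> p T \<phi>) as) (apps (inst 0 (FArg (Fix \<sigma> (p @ [k]) T \<phi>)) \<phi>) as)"
  unfolding ann_unfold_def
  by (intro exI[of _ \<sigma>] exI[of _ p] exI[of _ T] exI[of _ \<phi>] exI[of _ as] conjI refl)

lemma ann_principal_ex:
  assumes "relevant r j (d, i) (d, i')" "j < length (prems r)"
    "i < length (formulas d (concl r))" "i' < length (formulas d (prems r ! j))"
    "erase \<alpha> = formulas d (concl r) ! i" "principal r (d, i)"
  shows "\<exists>\<beta>. erase \<beta> = formulas d (prems r ! j) ! i' \<and> ann_principal r j (d, i') k \<alpha> \<beta>"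
proof -
  have beta: "\<exists>\<beta>. erase \<beta> = apps (inst 0 a \<phi>) as \<and> ann_beta \<alpha> \<beta>"
    if \<alpha>: "erase \<alpha> = apps (Lam A \<phi>) (a # as)" for A \<phi> a as
  proof -
    obtain h' as' where *: "\<alpha> = apps h' as' \<and> erase h' = Lam A \<phi> \<and> map erase_arg as' = a # as"
      using erase_apps_ex[OF \<alpha>] by (elim exE) (rule that)
    then obtain \<phi>' a' as'' where "h' = Lam A \<phi>'" "erase \<phi>' = \<phi>" "as' = a' # as''"
      "erase_arg a' = a" "map erase_arg as'' = as" by (auto simp: erase_eq_simps)
    then show ?thesis unfolding ann_beta_def using *
      by (intro exI[of _ "apps (inst 0 a' \<phi>') as''"]) auto
  qed
  have unfold: "\<exists>\<beta>. erase \<beta> = apps (inst 0 (FArg (Fix \<sigma> () T \<phi>)) \<phi>) as \<and> ann_unfold k \<alpha> \<beta>"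
    if \<alpha>: "erase \<alpha> = apps (Fix \<sigma> () T \<phi>) as" for \<sigma> T \<phi> as
  proof -
    obtain h' as' where *: "\<alpha> = apps h' as' \<and> erase h' = Fix \<sigma> () T \<phi> \<and> map erase_arg as' = as"
      using erase_apps_ex[OF \<alpha>] by (elim exE) (rule that)
    then obtain \<phi>' p where "h' = Fix \<sigma> p T \<phi>'" "erase \<phi>' = \<phi>" by (auto simp: erase_eq_simps)
    then show ?thesis using *
      by (intro exI[of _ "apps (inst 0 (FArg (Fix \<sigma> (p @ [k]) T \<phi>')) \<phi>') as'"])
        (auto simp: ann_unfoldI)
  qed
  show ?thesis
  proof (cases r)
    case (Mono \<Gamma> \<Delta> x T \<phi> \<psi> \<chi> ys)
    let ?\<psi> = "if d = Lft then \<psi> else \<chi>"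
    have \<alpha>: "erase \<alpha> = fsubst x T ?\<psi> \<phi>"
      using Mono assms by (cases d; cases i) (auto simp: nth_append split: if_splits)
    from erase_fsubst_ex[OF this] obtain \<phi>' \<psi>s where *: "erase \<phi>' = \<phi>" "length \<psi>s = occs x T \<phi>"
      "\<forall>\<psi>' \<in> set \<psi>s. erase \<psi>' = ?\<psi>" "\<alpha> = plug x T \<psi>s \<phi>'" by blast
    have "erase (\<psi>s ! j) = ?\<psi>" using * assms(2) Mono by simp
    moreover have "formulas d (prems r ! j) ! i' = apps ?\<psi> (map var_arg ys)"
      using Mono assms by (cases d; cases i') (auto simp: nth_append split: if_splits)
    moreover have "ann_principal r j (d, i') k \<alpha> (apps (\<psi>s ! j) (map var_arg ys))"
      unfolding Mono ann_principal.simps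
      by (intro exI[of _ \<phi>'] exI[of _ \<psi>s] conjI) (use * in auto)
    ultimately show ?thesis
      by (intro exI[of _ "apps (\<psi>s ! j) (map var_arg ys)"]) (simp add: comp_def)
  next
    case (LamL \<Gamma> \<Delta> A \<phi> a as)
    then show ?thesis using beta[of A \<phi> a as] assms by (cases d) (auto simp: nth_append split: if_splits)
  next
    case (LamR \<Gamma> \<Delta> A \<phi> a as)
    then show ?thesis using beta[of A \<phi> a as] assms by (cases d; cases i; cases i') (auto split: if_splits)
  next
    case (FixL \<Gamma> \<Delta> \<sigma> T \<phi> as)
    then show ?thesis using unfold[of \<sigma> T \<phi> as] assms by (cases d) (auto simp: nth_append split: if_splits)
  next
    case (FixR \<Gamma> \<Delta> \<sigma> T \<phi> as)
    then show ?thesis using unfold[of \<sigma> T \<phi> as] assms by (cases d; cases i; cases i') (auto split: if_splits)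
  next
    case (P2 \<Gamma> \<Delta> s t)
    then show ?thesis using assms
      by (cases d) (auto simp: nth_append erase_eq_simps split: if_splits intro!: exI[of _ "Eq s t"])
  qed (use assms in \<open>cases d; auto simp: nth_append nth_Cons' less_length_2 erase_eq_simps split: if_splits\<close>)+
qed

text \<open>An annotation never gets stuck, whatever number \<open>k\<close> is to be appended;
  dependent choice then annotates a whole trace.\<close>

lemma ann_rule_ex:
  assumes "relevant r j (d, i) (d, i')" "j < length (prems r)"
    "i < length (formulas d (concl r))" "i' < length (formulas d (prems r ! j))"
    "erase \<alpha> = formulas d (concl r) ! i"
  shows "\<exists>\<beta>. erase \<beta> = formulas d (prems r ! j) ! i' \<and> ann_rule r j (d, i) (d, i') k \<alpha> \<beta>"
  using ann_side_ex[OF assms] ann_principal_ex[OF assms, of k]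
  unfolding ann_rule_def by (cases "principal r (d, i)") (simp_all del: principal.simps)

lemma relevant_side: "relevant r j (d, i) (d', i') \<Longrightarrow> d' = d"
  by (cases r) (auto split: if_splits)

text \<open>The principal formula of \<open>FixL\<close> stands on the left and that of
  \<open>FixR\<close> on the right, so the rule alone decides whether the unfolding counts for the
  global trace condition.\<close>

fun good_unfold :: "rule \<Rightarrow> bool" where
  "good_unfold (FixL \<Gamma> \<Delta> \<sigma> T \<phi> as) \<longleftrightarrow> \<sigma> = Mu"
| "good_unfold (FixR \<Gamma> \<Delta> \<sigma> T \<phi> as) \<longleftrightarrow> \<sigma> = Nu"
| "good_unfold _ \<longleftrightarrow> False"

definition good_sign :: "side \<Rightarrow> sgn \<Rightarrow> bool" where
  "good_sign d \<sigma> \<longleftrightarrow> (d = Lft \<and> \<sigma> = Mu) \<or> (d = Rgt \<and> \<sigma> = Nu)"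

text \<open>At an unfolding this is the one position whose label grows. That the rule instance
  determines it is the uniqueness used for lines of descent.\<close>

fun unfold_pos :: "rule \<Rightarrow> nat list" where
  "unfold_pos (FixL \<Gamma> \<Delta> \<sigma> T \<phi> as) = replicate (length as) 0"
| "unfold_pos (FixR \<Gamma> \<Delta> \<sigma> T \<phi> as) = replicate (length as) 0"
| "unfold_pos _ = []"

lemma pos_step_progress:
  assumes "pos_step r j (d, i) oc' True \<pi> \<pi>'" "i < length (formulas d (concl r))"
  shows "principal r (d, i) \<and> unfolding_rule r \<and> logical r \<and> \<pi> = unfold_pos r"
    and "\<exists>\<sigma>. fixat \<sigma> () (formulas d (concl r) ! i) \<pi> \<and> (good_unfold r \<longleftrightarrow> good_sign d \<sigma>)"
proof -
  have 1: "principal r (d, i)" using assms(1) unfolding pos_step_def by (auto split: if_splits)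
  have 2: "pos_principal r j (snd oc') True \<pi> \<pi>'"
    using assms(1) unfolding pos_step_def if_P[OF 1] .
  show "principal r (d, i) \<and> unfolding_rule r \<and> logical r \<and> \<pi> = unfold_pos r"
    using 1 2 by (cases r) (auto simp: head_step_def)
  show "\<exists>\<sigma>. fixat \<sigma> () (formulas d (concl r) ! i) \<pi> \<and> (good_unfold r \<longleftrightarrow> good_sign d \<sigma>)"
  proof (cases r)
    case (FixL \<Gamma> \<Delta> \<sigma> T \<phi> as)
    then have "formulas d (concl r) ! i = apps (Fix \<sigma> () T \<phi>) as" "\<pi> = replicate (length as) 0 @ []" "d = Lft"
      using 1 2 assms(2) by (cases d; auto simp: nth_append head_step_def split: if_splits)+
    then show ?thesis using FixL by (intro exI[of _ \<sigma>]) (auto simp: good_sign_def simp del: append_Nil2)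
  next
    case (FixR \<Gamma> \<Delta> \<sigma> T \<phi> as)
    then have "formulas d (concl r) ! i = apps (Fix \<sigma> () T \<phi>) as" "\<pi> = replicate (length as) 0 @ []" "d = Rgt"
      using 1 2 assms(2) by (cases d; cases i; auto simp: head_step_def split: if_splits)+
    then show ?thesis using FixR by (intro exI[of _ \<sigma>]) (auto simp: good_sign_def simp del: append_Nil2)
  qed (use 2 in \<open>auto simp: head_step_def\<close>)
qed

section \<open>Traces and threads\<close>

abbreviation line ::
  "(nat \<Rightarrow> bool \<Rightarrow> 'p \<Rightarrow> 'p \<Rightarrow> bool) \<Rightarrow> nat \<Rightarrow> nat \<Rightarrow> (nat \<Rightarrow> bool) \<Rightarrow> (nat \<Rightarrow> 'p) \<Rightarrow> bool"
where
  "line St i j b f \<equiv> \<forall>l. i \<le> l \<and> l < j \<longrightarrow> St l (b l) (f l) (f (Suc l))"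

text \<open>\<open>F i q \<pi>\<close> reads: at time \<open>i\<close> the operator at
  \<open>\<pi>\<close> has label \<open>q\<close>. Going back from an operator labelled
  \<open>q @ [x]\<close>, the label stays the same until the step \<open>t\<close> that appended
  \<open>x\<close>; there is one, because all labels at time 0 are empty.\<close>

lemma descent_segment:
  fixes F :: "nat \<Rightarrow> 'l list \<Rightarrow> 'p \<Rightarrow> bool"
  assumes parent: "\<And>i q \<pi>'. F (Suc i) q \<pi>' \<Longrightarrow>
      \<exists>\<pi> q0 b. F i q0 \<pi> \<and> St i b \<pi> \<pi>' \<and> q = (if b then q0 @ [\<kappa> i] else q0)"
    and init: "\<And>q \<pi>. F 0 q \<pi> \<Longrightarrow> q = []"
  shows "F i (q @ [x]) \<pi> \<Longrightarrow> \<exists>t f b. t < i \<and> \<kappa> t = x \<and> F t q (f t) \<and> b t \<and> f i = \<pi> \<and>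
    (line St t i b f)"
proof (induction i arbitrary: \<pi>)
  case 0
  then show ?case using init[OF 0] by simp
next
  case (Suc i)
  obtain \<pi>0 q0 b0 where *: "F i q0 \<pi>0" "St i b0 \<pi>0 \<pi>" "q @ [x] = (if b0 then q0 @ [\<kappa> i] else q0)"
    using parent[OF Suc.prems] by (elim exE conjE) (rule that)
  show ?case
  proof (cases b0)
    case True
    let ?f = "\<lambda>l. if l = i then \<pi>0 else \<pi>"
    have "q = q0" "x = \<kappa> i" using *(3) True by auto
    moreover have "St l True (?f l) (?f (Suc l))" if "i \<le> l \<and> l < Suc i" for l
    proof -
      have "l = i" using that by simp
      then show ?thesis using *(2) True by simp
    qed
    ultimately show ?thesis using *(1)
      by (intro exI[of _ i] exI[of _ ?f] exI[of _ "\<lambda>_. True"] conjI allI impI) simp_all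
  next
    case False
    then have "F i (q @ [x]) \<pi>0" using * by simp
    from Suc.IH[OF this] obtain t f b where **: "t < i" "\<kappa> t = x" "F t q (f t)" "b t" "f i = \<pi>0"
      "line St t i b f" by (elim exE conjE) (rule that)
    let ?f = "f(Suc i := \<pi>)" and ?b = "b(i := False)"
    have "St l (?b l) (?f l) (?f (Suc l))" if "t \<le> l \<and> l < Suc i" for l
    proof (cases "l = i")
      case True
      then show ?thesis using **(5) *(2) \<open>\<not> b0\<close> by simp
    next
      case False
      then have "l < i" using that by simp
      then show ?thesis using **(6) that by simp
    qed
    then show ?thesis using **(1-4)
      by (intro exI[of _ t] exI[of _ ?f] exI[of _ ?b] conjI allI impI) simp_all
  qed
qed

text \<open>Injectivity of \<open>\<kappa>\<close> leaves a single step \<open>z m\<close> at which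
  \<open>p m\<close> is appended, and the rule leaves a single position \<open>h (z m)\<close> for
  it. Every operator labelled by the first \<open>Suc m\<close> members of \<open>p\<close> descends
  from there, so the segments from \<open>z m\<close> to \<open>z (Suc m)\<close> meet at their
  ends.\<close>

lemma infinite_descent_line:
  fixes F :: "nat \<Rightarrow> 'l list \<Rightarrow> 'p \<Rightarrow> bool"
  assumes parent: "\<And>i q \<pi>'. F (Suc i) q \<pi>' \<Longrightarrow>
      \<exists>\<pi> q0 b. F i q0 \<pi> \<and> St i b \<pi> \<pi>' \<and> q = (if b then q0 @ [\<kappa> i] else q0)"
    and init: "\<And>q \<pi>. F 0 q \<pi> \<Longrightarrow> q = []"
    and unique: "\<And>i \<pi> \<pi>'. St i True \<pi> \<pi>' \<Longrightarrow> i \<in> U \<and> \<pi> = h i" "inj_on \<kappa> U"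
    and all: "\<And>m. \<exists>i \<pi>. F i (map p [0..<m]) \<pi>"
  shows "\<exists>m \<sigma> \<beta>. (\<forall>i\<ge>m. St i (\<beta> i) (\<sigma> i) (\<sigma> (Suc i))) \<and> infinite {i. m \<le> i \<and> \<beta> i}"
proof -
  have segment: "\<exists>t f b. t < i \<and> \<kappa> t = x \<and> F t q (f t) \<and> b t \<and> f i = \<pi> \<and>
    (line St t i b f)" if "F i (q @ [x]) \<pi>" for i q x \<pi>
    by (rule descent_segment[of F St \<kappa>]) (erule parent, erule init, rule that)
  \<comment> \<open>The label with \<open>m + 1\<close> entries occurs somewhere; its last entry was
    appended at such a \<open>t\<close>, when the label had \<open>m\<close> entries.\<close>
  have "\<forall>m. \<exists>t. t \<in> U \<and> \<kappa> t = p m \<and> F t (map p [0..<m]) (h t)"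
  proof
    fix m
    obtain i \<pi> where "F i (map p [0..<m] @ [p m]) \<pi>" using all[of "Suc m"] by auto
    from segment[OF this] obtain t f b where *: "t < i" "\<kappa> t = p m" "F t (map p [0..<m]) (f t)" "b t"
       "line St t i b f" by (elim exE conjE) (rule that)
    then have "St t True (f t) (f (Suc t))" using *(5)[rule_format, of t] by simp
    from unique(1)[OF this] show "\<exists>t. t \<in> U \<and> \<kappa> t = p m \<and> F t (map p [0..<m]) (h t)"
      using * by (intro exI[of _ t]) simp
  qed
  from choice[OF this] obtain z where "\<forall>m. z m \<in> U \<and> \<kappa> (z m) = p m \<and> F (z m) (map p [0..<m]) (h (z m))" ..
  then have z: "\<And>m. z m \<in> U" "\<And>m. \<kappa> (z m) = p m" "\<And>m. F (z m) (map p [0..<m]) (h (z m))"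
    by simp_all
  have "\<exists>f b. z m < z (Suc m) \<and> f (z m) = h (z m) \<and> b (z m) \<and> f (z (Suc m)) = h (z (Suc m)) \<and>
      (line St (z m) (z (Suc m)) b f)" for m
  proof -
    have "F (z (Suc m)) (map p [0..<m] @ [p m]) (h (z (Suc m)))" using z(3)[of "Suc m"] by simp
    from segment[OF this] obtain t f b where *: "t < z (Suc m)" "\<kappa> t = p m" "b t"
       "f (z (Suc m)) = h (z (Suc m))"
       "line St t (z (Suc m)) b f" by (elim exE conjE) (rule that)
    then have "St t True (f t) (f (Suc t))" using *(5)[rule_format, of t] by simp
    from unique(1)[OF this] have "t \<in> U" "f t = h t" by auto
    \<comment> \<open>Here freshness is used: both steps append the number
      \<open>p m\<close>.\<close>
    moreover have "t = z m"
      using inj_onD[OF unique(2), of t "z m"] z(1,2)[of m] *(2) \<open>t \<in> U\<close> by simp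
    ultimately show ?thesis using * by (intro exI[of _ f] exI[of _ b]) simp
  qed
  then have "\<forall>m. \<exists>f b. z m < z (Suc m) \<and> f (z m) = h (z m) \<and> b (z m) \<and> f (z (Suc m)) = h (z (Suc m)) \<and>
      (line St (z m) (z (Suc m)) b f)" ..
  from choice[OF this] obtain f where "\<forall>m. \<exists>b. z m < z (Suc m) \<and> f m (z m) = h (z m) \<and> b (z m) \<and>
      f m (z (Suc m)) = h (z (Suc m)) \<and>
      (line St (z m) (z (Suc m)) b (f m))" ..
  from choice[OF this] obtain b where fb: "\<forall>m. z m < z (Suc m) \<and> f m (z m) = h (z m) \<and> b m (z m) \<and>
      f m (z (Suc m)) = h (z (Suc m)) \<and>
      (line St (z m) (z (Suc m)) (b m) (f m))" ..
  have "\<exists>\<sigma> \<beta>. (\<forall>l\<ge>z 0. St l (\<beta> l) (\<sigma> l) (\<sigma> (Suc l))) \<and> infinite {l. z 0 \<le> l \<and> \<beta> l}"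
  proof (rule glue_segments[where f = f and b = b])
    show "\<exists>l. z k \<le> l \<and> l < z (Suc k) \<and> b k l" for k
      using fb by (intro exI[of _ "z k"]) simp
  qed (use fb in simp_all)
  then show ?thesis by blast
qed

text \<open>If the i-th step appends the number i, the label lists the progress steps so far, and
  their enumeration is the limit.\<close>

lemma label_limit:
  fixes \<beta> :: "nat \<Rightarrow> bool" and lab :: "nat \<Rightarrow> nat list"
  assumes inf: "infinite {i. \<beta> i}" and lab: "lab 0 = []" "\<And>i. lab (Suc i) = (if \<beta> i then lab i @ [i] else lab i)"
  shows "\<exists>p. \<forall>m. \<exists>i. lab i = map p [0..<m]"
proof -
  define e where "e = enumerate {i. \<beta> i}"
  have stay: "lab c = lab a" if "a \<le> c" "\<And>j. a \<le> j \<Longrightarrow> j < c \<Longrightarrow> \<not> \<beta> j" for a c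
    using that
  proof (induction c)
    case (Suc c)
    then show ?case using lab(2)[of c] by (cases "a = Suc c") auto
  qed simp
  have "lab (e m) = map e [0..<m]" for m
  proof (induction m)
    case 0
    have "\<not> \<beta> j" if "j < e 0" for j
      using that not_less_Least[of j "\<lambda>n. n \<in> {i. \<beta> i}"] unfolding e_def enumerate_0 by simp
    then show ?case using stay[of 0 "e 0"] lab(1) by simp
  next
    case (Suc m)
    have in_\<beta>: "\<beta> (e m)" using enumerate_in_set[OF inf, of m] unfolding e_def by simp
    have less: "e m < e (Suc m)" unfolding e_def using inf by (rule enumerate_step)
    have "\<not> \<beta> j" if "e m < j" "j < e (Suc m)" for j
      using that not_less_Least[of j "\<lambda>s. s \<in> {i. \<beta> i} \<and> enumerate {i. \<beta> i} m < s"]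
      unfolding e_def enumerate_Suc''[OF inf] by simp
    then have "lab (e (Suc m)) = lab (Suc (e m))" using less by (intro stay) auto
    then show ?case using Suc lab(2)[of "e m"] in_\<beta> by simp
  qed
  then show ?thesis by blast
qed

text \<open>
  Occurrences are checked at inferences only, and signs only where an operator is unfolded: both
  are then inherited along a thread.
\<close>

fun thread_step ::
  "preproof \<Rightarrow> bool \<Rightarrow> node \<Rightarrow> occurrence \<times> nat list \<Rightarrow> node \<Rightarrow> occurrence \<times> nat list \<Rightarrow> bool"
where
  "thread_step (D, R) b p (oc, \<pi>) q (oc', \<pi>') \<longleftrightarrow>
     (case subderiv D p of
        None \<Rightarrow> False
      | Some (Open S) \<Rightarrow> \<not> b \<and> oc' = oc \<and> \<pi>' = \<pi>
      | Some (Inf r ds) \<Rightarrow> snd oc < length (formulas (fst oc) (concl r)) \<and>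
          relevant r (last q) oc oc' \<and> pos_step r (last q) oc oc' b \<pi> \<pi>' \<and> (b \<longrightarrow> good_unfold r))"

abbreviation threaded :: "deriv \<Rightarrow> (node \<Rightarrow> node) \<Rightarrow> (nat \<Rightarrow> node) \<Rightarrow> bool" where
  "threaded D R n \<equiv> \<exists>m s \<beta>.
     (\<forall>i\<ge>m. thread_step (D, R) (\<beta> i) (n i) (s i) (n (Suc i)) (s (Suc i))) \<and> infinite {i. m \<le> i \<and> \<beta> i}"

section \<open>Paths in a pre-proof\<close>

lemma subderiv_append: "subderiv D (p @ q) = Option.bind (subderiv D p) (\<lambda>d. subderiv d q)"
  by (induction D p rule: subderiv.induct) auto

lemma derivation_subderiv: "derivation D \<Longrightarrow> subderiv D p = Some d \<Longrightarrow> derivation d"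
  by (induction D p rule: subderiv.induct) (auto split: if_splits)

lemma subderiv_premise:
  assumes "derivation D" "subderiv D p = Some (Inf r ds)" "j < length ds"
  shows "length ds = length (prems r)" "sequent_at (D, R) p = concl r"
    "sequent_at (D, R) (p @ [j]) = prems r ! j"
proof -
  have "map end_sequent ds = prems r"
    using derivation_subderiv[OF assms(1,2)] by simp
  note * = this
  show "length ds = length (prems r)" using arg_cong[OF *, of length] by simp
  show "sequent_at (D, R) p = concl r" using assms by simp
  show "sequent_at (D, R) (p @ [j]) = prems r ! j"
    using assms arg_cong[OF *, of "\<lambda>xs. xs ! j"] by (simp add: subderiv_append)
qed

context
  fixes D :: deriv and R :: "node \<Rightarrow> node" and n :: "nat \<Rightarrow> node"
  assumes pre: "pre_proof (D, R)" and path: "infinite_path (D, R) n"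
begin

text \<open>The third fact about an open leaf, that the next node is an inference, lets everything
  about a leaf be read off from its companion.\<close>

lemma path_cases [consumes 0, case_names Open Inf]:
  obtains S where "subderiv D (n i) = Some (Open S)" "sequent_at (D, R) (n (Suc i)) = sequent_at (D, R) (n i)"
      "\<exists>r ds. subderiv D (n (Suc i)) = Some (Inf r ds)"
  | r ds j where "subderiv D (n i) = Some (Inf r ds)" "last (n (Suc i)) = j" "j < length (prems r)"
      "sequent_at (D, R) (n i) = concl r" "sequent_at (D, R) (n (Suc i)) = prems r ! j"
proof -
  have step: "path_step (D, R) (n i) (n (Suc i))" using path unfolding infinite_path_def by blast
  show thesis
  proof (cases "subderiv D (n i)")
    case None
    then show ?thesis using step by simp
  next
    case (Some d)
    show ?thesis
    proof (cases d)
      case (Open S)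
      then have "n (Suc i) = R (n i)" using step Some by simp
      moreover have "\<forall>p S. subderiv D p = Some (Open S) \<longrightarrow>
          (\<exists>r ds. subderiv D (R p) = Some (Inf r ds) \<and> ds \<noteq> [] \<and> concl r = S)"
        using pre unfolding pre_proof.simps by (rule conjunct2)
      then have "\<exists>r ds. subderiv D (R (n i)) = Some (Inf r ds) \<and> concl r = S"
        using Some Open by blast
      ultimately show ?thesis using that(1)[of S] Some Open by auto
    next
      case (Inf r ds)
      then obtain j where j: "j < length ds" "n (Suc i) = n i @ [j]" using step Some by auto
      have "derivation D" using pre by simp
      note premise = subderiv_premise[OF this Some[unfolded Inf] j(1)]
      show ?thesis
        using premise(1) premise(2,3)[of R] that(2)[of r ds j] Some Inf j by simp
    qed
  qed
qed

lemma relevant_step_side: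
  assumes "relevant_step (D, R) (n i) (n (Suc i)) oc oc'"
  shows "fst oc' = fst oc"
proof (cases rule: path_cases[of i])
  case (Open S)
  then show ?thesis using assms by simp
next
  case (Inf r ds j)
  obtain d l d' l' where oc: "oc = (d, l)" "oc' = (d', l')" by (cases oc; cases oc')
  then show ?thesis using relevant_side[of r j d l d' l'] Inf assms by simp
qed

lemma ann_step_ex:
  assumes "relevant_step (D, R) (n i) (n (Suc i)) oc oc'" "valid_occ (D, R) (n i) oc"
    "valid_occ (D, R) (n (Suc i)) oc'" "erase \<alpha> = formula_at (D, R) (n i) oc"
  shows "\<exists>\<beta>. erase \<beta> = formula_at (D, R) (n (Suc i)) oc' \<and> ann_step (D, R) (n i) (n (Suc i)) oc oc' k \<alpha> \<beta>"
proof (cases rule: path_cases[of i])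
  case (Open S)
  then show ?thesis using assms by (auto simp: formula_at_def simp del: sequent_at.simps)
next
  case (Inf r ds j)
  obtain d l d' l' where oc: "oc = (d, l)" "oc' = (d', l')" by (cases oc; cases oc')
  have "d' = d" using assms(1) Inf oc relevant_side by auto
  then show ?thesis
    using ann_rule_ex[of r j d l l' \<alpha> k] assms Inf oc
    by (auto simp: formula_at_def valid_occ_def simp del: sequent_at.simps)
qed

text \<open>\<open>ann_rule_fixat\<close> along a path. For operators of the sign that counts on
  their side, the demand of \<open>thread_step\<close> on progress steps is met
  automatically.\<close>

lemma fixat_step:
  assumes "relevant_step (D, R) (n i) (n (Suc i)) oc oc'" "valid_occ (D, R) (n i) oc"
    "erase \<alpha> = formula_at (D, R) (n i) oc"
    "erase \<beta> = formula_at (D, R) (n (Suc i)) oc'" "ann_step (D, R) (n i) (n (Suc i)) oc oc' k \<alpha> \<beta>"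
    and good: "good_sign (fst oc) \<sigma>"
  shows "fixat \<sigma> p' \<beta> \<pi>' \<longleftrightarrow>
    (\<exists>\<pi> p b. fixat \<sigma> p \<alpha> \<pi> \<and> thread_step (D, R) b (n i) (oc, \<pi>) (n (Suc i)) (oc', \<pi>') \<and>
       p' = (if b then p @ [k] else p))"
proof (cases rule: path_cases[of i])
  case (Open S)
  then show ?thesis using assms by (auto simp: ex_bool_eq)
next
  case (Inf r ds j)
  obtain d l d' l' where oc: "oc = (d, l)" "oc' = (d', l')" by (cases oc; cases oc')
  have d': "d' = d" using assms(1) Inf oc relevant_side by auto
  have valid: "l < length (formulas d (concl r))" and \<alpha>: "erase \<alpha> = formulas d (concl r) ! l"
    using assms Inf oc by (auto simp: formula_at_def valid_occ_def simp del: sequent_at.simps)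
  have "thread_step (D, R) b (n i) (oc, \<pi>) (n (Suc i)) (oc', \<pi>') \<longleftrightarrow> pos_step r j (d, l) (d, l') b \<pi> \<pi>'"
    if "fixat \<sigma> p \<alpha> \<pi>" for b p \<pi>
  proof -
    \<comment> \<open>The erased formula and the position determine the sign, so the operator
      unfolded at \<open>\<pi>\<close> is the one of sign \<open>\<sigma>\<close>.\<close>
    have "good_unfold r" if step: "pos_step r j (d, l) (d, l') True \<pi> \<pi>'"
    proof -
      obtain \<tau> where "fixat \<tau> () (erase \<alpha>) \<pi>" "good_unfold r \<longleftrightarrow> good_sign d \<tau>"
        using pos_step_progress(2)[OF step valid] \<alpha> by auto
      then show ?thesis
        using \<open>fixat \<sigma> p \<alpha> \<pi>\<close> fixat_erase fixat_unique good oc by (metis fst_conv)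
    qed
    then show ?thesis using Inf oc d' valid assms(1) by (cases b) auto
  qed
  moreover have "fixat \<sigma> p' \<beta> \<pi>' \<longleftrightarrow>
    (\<exists>\<pi> p b. fixat \<sigma> p \<alpha> \<pi> \<and> pos_step r j (d, l) (d, l') b \<pi> \<pi>' \<and> p' = (if b then p @ [k] else p))"
    using ann_rule_fixat[of r j d l l' k \<alpha> \<beta> \<sigma> p' \<pi>'] assms Inf oc d' valid \<alpha>
    by (auto simp: formula_at_def simp del: sequent_at.simps)
  ultimately show ?thesis by (simp del: thread_step.simps cong: conj_cong)
qed

lemma thread_of_fix_trace:
  assumes tr: "fix_trace \<sigma> (D, R) n \<tau>" and good: "good_sign (fst (\<tau> 0)) \<sigma>"
  shows "threaded D R n"
proof -
  have trace: "\<And>i. valid_occ (D, R) (n i) (\<tau> i)"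
      "\<And>i. relevant_step (D, R) (n i) (n (Suc i)) (\<tau> i) (\<tau> (Suc i))"
    using tr unfolding fix_trace_def is_trace_def by simp_all
  obtain \<alpha> p where "annotation (D, R) n \<tau> \<alpha>" and p: "\<forall>m. \<exists>i. map p [0..<m] \<in> labels \<sigma> (\<alpha> i)"
    using tr unfolding fix_trace_def by (elim exE conjE) (rule that)
  then obtain \<kappa> where ann': "\<forall>i. erase (\<alpha> i) = formula_at (D, R) (n i) (\<tau> i)"
      "\<forall>\<sigma>. labels \<sigma> (\<alpha> 0) \<subseteq> {[]}" "inj_on \<kappa> (unfold_steps (D, R) n \<tau>)"
      "\<forall>i. ann_step (D, R) (n i) (n (Suc i)) (\<tau> i) (\<tau> (Suc i)) (\<kappa> i) (\<alpha> i) (\<alpha> (Suc i))"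
    unfolding annotation_def by (elim exE conjE) (rule that)
  note ann = ann'(1)[rule_format] ann'(2)[rule_format] ann'(3) ann'(4)[rule_format]
  have side: "fst (\<tau> i) = fst (\<tau> 0)" for i
    by (induction i) (simp_all only: relevant_step_side[OF trace(2)])
  have step: "fixat \<sigma> p' (\<alpha> (Suc i)) \<pi>' \<longleftrightarrow> (\<exists>\<pi> p b. fixat \<sigma> p (\<alpha> i) \<pi> \<and>
     thread_step (D, R) b (n i) (\<tau> i, \<pi>) (n (Suc i)) (\<tau> (Suc i), \<pi>') \<and> p' = (if b then p @ [\<kappa> i] else p))" for i p' \<pi>'
    by (rule fixat_step[OF trace(2) trace(1) ann(1) ann(1) ann(4)]) (simp only: side[of i] good)
  \<comment> \<open>\<open>F\<close> is the presence of a label at a position. Labels grow only at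
    unfolding steps, where \<open>\<kappa>\<close> is injective, and only at
    \<open>unfold_pos\<close>; the default \<open>[]\<close> for open leaves is never
    reached.\<close>
  have "\<exists>m f \<beta>. (\<forall>i\<ge>m. thread_step (D, R) (\<beta> i) (n i) (\<tau> i, f i) (n (Suc i)) (\<tau> (Suc i), f (Suc i))) \<and>
     infinite {i. m \<le> i \<and> \<beta> i}"
  proof (rule infinite_descent_line[where F = "\<lambda>i q \<pi>. fixat \<sigma> q (\<alpha> i) \<pi>"
        and St = "\<lambda>i b \<pi> \<pi>'. thread_step (D, R) b (n i) (\<tau> i, \<pi>) (n (Suc i)) (\<tau> (Suc i), \<pi>')" 
        and \<kappa> = \<kappa> and U = "unfold_steps (D, R) n \<tau>" and p = p
        and h = "\<lambda>i. case subderiv D (n i) of Some (Inf r ds) \<Rightarrow> unfold_pos r | _ \<Rightarrow> []"])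
    show "\<exists>\<pi> q0 b. fixat \<sigma> q0 (\<alpha> i) \<pi> \<and>
        thread_step (D, R) b (n i) (\<tau> i, \<pi>) (n (Suc i)) (\<tau> (Suc i), \<pi>') \<and> q = (if b then q0 @ [\<kappa> i] else q0)"
      if "fixat \<sigma> q (\<alpha> (Suc i)) \<pi>'" for i q \<pi>'
      using that unfolding step .
    show "q = []" if "fixat \<sigma> q (\<alpha> 0) \<pi>" for q \<pi>
      using that ann(2)[of \<sigma>] unfolding labels_fixat by blast
    show "\<exists>i \<pi>. fixat \<sigma> (map p [0..<m]) (\<alpha> i) \<pi>" for m
      using p[rule_format, of m] unfolding labels_fixat by simp
    show "i \<in> unfold_steps (D, R) n \<tau> \<and>
        \<pi> = (case subderiv D (n i) of Some (Inf r ds) \<Rightarrow> unfold_pos r | _ \<Rightarrow> [])"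
      if st: "thread_step (D, R) True (n i) (\<tau> i, \<pi>) (n (Suc i)) (\<tau> (Suc i), \<pi>')" for i \<pi> \<pi>'
    proof (cases rule: path_cases[of i])
      case (Open S)
      then show ?thesis using st by simp
    next
      case (Inf r ds j)
      obtain d l where oc: "\<tau> i = (d, l)" by (cases "\<tau> i")
      have "principal r (d, l) \<and> unfolding_rule r \<and> logical r \<and> \<pi> = unfold_pos r"
        by (rule pos_step_progress(1)[of r j d l "\<tau> (Suc i)" \<pi> \<pi>']) (use st Inf oc in auto)
      then show ?thesis using Inf oc unfolding unfold_steps_def by (auto simp del: principal.simps)
    qed
    show "inj_on \<kappa> (unfold_steps (D, R) n \<tau>)" by (rule ann(3))
  qed
  then obtain m f \<beta> where
    "\<forall>i\<ge>m. thread_step (D, R) (\<beta> i) (n i) (\<tau> i, f i) (n (Suc i)) (\<tau> (Suc i), f (Suc i))"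
    "infinite {i. m \<le> i \<and> \<beta> i}" by (elim exE conjE) (rule that)
  then show ?thesis
    by (intro exI[of _ m] exI[of _ "\<lambda>i. (\<tau> i, f i)"] exI[of _ \<beta>]) (simp del: thread_step.simps)
qed

text \<open>The progress step at time 0 provides an operator of the good sign at
  \<open>\<pi> 0\<close>, which \<open>fixat_step\<close> then carries along the thread. Step
  \<open>i\<close> appends the number \<open>i\<close> itself, so freshness is trivial.\<close>

lemma fix_trace_of_thread:
  assumes th: "\<And>i. thread_step (D, R) (\<beta> i) (n i) (\<tau> i, \<pi> i) (n (Suc i)) (\<tau> (Suc i), \<pi> (Suc i))"
    and inf: "infinite {i. \<beta> i}" and "\<beta> 0"
  shows "\<exists>\<sigma>. good_sign (fst (\<tau> 0)) \<sigma> \<and> fix_trace \<sigma> (D, R) n \<tau>"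
    and "valid_occ (D, R) (n i) (\<tau> i)" 
    and "\<exists>\<sigma>. fixat \<sigma> () (formula_at (D, R) (n i) (\<tau> i)) (\<pi> i)"
proof -
  have valid: "valid_occ (D, R) (n i) (\<tau> i)" for i
  proof (cases rule: path_cases[of i])
    case (Open S)
    \<comment> \<open>At an open leaf \<open>thread_step\<close> does not check the occurrence; the
      next node has the same sequent and does.\<close>
    then have \<tau>: "\<tau> (Suc i) = \<tau> i" using th[of i] by simp
    obtain r ds where "subderiv D (n (Suc i)) = Some (Inf r ds)" using Open by blast
    then have "valid_occ (D, R) (n (Suc i)) (\<tau> (Suc i))" using th[of "Suc i"] by (simp add: valid_occ_def)
    then show ?thesis using Open \<tau> by (simp add: valid_occ_def del: sequent_at.simps)
  next
    case (Inf r ds j)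
    then show ?thesis using th[of i] by (simp add: valid_occ_def)
  qed
  have relevant: "relevant_step (D, R) (n i) (n (Suc i)) (\<tau> i) (\<tau> (Suc i))" for i
    by (cases rule: path_cases[of i]) (use th[of i] in auto)
  have progress: "\<exists>r \<sigma>. rule_at (D, R) (n i) r \<and> logical r \<and> principal r (\<tau> i) \<and>
      good_sign (fst (\<tau> i)) \<sigma> \<and> fixat \<sigma> () (formula_at (D, R) (n i) (\<tau> i)) (\<pi> i)" if "\<beta> i" for i
  proof (cases rule: path_cases[of i])
    case (Open S)
    then show ?thesis using th[of i] that by simp
  next
    case (Inf r ds j)
    obtain d l where oc: "\<tau> i = (d, l)" by (cases "\<tau> i")
    have st: "pos_step r j (d, l) (\<tau> (Suc i)) True (\<pi> i) (\<pi> (Suc i))" "l < length (formulas d (concl r))"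
      "good_unfold r" using th[of i] Inf oc that by auto
    obtain \<sigma> where "fixat \<sigma> () (formulas d (concl r) ! l) (\<pi> i)" "good_sign d \<sigma>"
      using pos_step_progress(2)[OF st(1,2)] st(3) by blast
    then show ?thesis
      using pos_step_progress(1)[OF st(1,2)] Inf oc
      by (intro exI[of _ r] exI[of _ \<sigma>]) (simp add: formula_at_def del: principal.simps)
  qed
  obtain \<sigma> where \<sigma>: "good_sign (fst (\<tau> 0)) \<sigma>" "fixat \<sigma> () (formula_at (D, R) (n 0) (\<tau> 0)) (\<pi> 0)"
    using progress[OF \<open>\<beta> 0\<close>] by blast
  have side: "fst (\<tau> i) = fst (\<tau> 0)" for i
    by (induction i) (simp_all only: relevant_step_side[OF relevant])
  define \<alpha>0 :: annotated where "\<alpha>0 = map_fm (\<lambda>_. []) (formula_at (D, R) (n 0) (\<tau> 0))"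
  have "erase \<alpha>0 = map_fm (\<lambda>_. ()) (formula_at (D, R) (n 0) (\<tau> 0))"
    unfolding \<alpha>0_def erase_def by (simp add: fm.map_comp comp_def)
  also have "\<dots> = formula_at (D, R) (n 0) (\<tau> 0)"
  proof -
    have "(\<lambda>_. ()) = (\<lambda>u :: unit. u)" by auto
    then show ?thesis by (simp only: fm.map_ident)
  qed
  finally have \<alpha>0: "erase \<alpha>0 = formula_at (D, R) (n 0) (\<tau> 0)" .
  have labels0: "labels \<sigma> \<alpha>0 \<subseteq> {[]}" for \<sigma>
  proof -
    have "labels \<sigma> (map_fm (\<lambda>_. []) \<phi>) \<subseteq> {[]}" for \<phi> :: form
      by (induction \<phi>) auto
    then show ?thesis unfolding \<alpha>0_def .
  qed
  \<comment> \<open>Dependent choice, starting with empty labels everywhere.\<close>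
  have "\<exists>\<alpha>. \<forall>i. (erase (\<alpha> i) = formula_at (D, R) (n i) (\<tau> i) \<and> (i = 0 \<longrightarrow> \<alpha> i = \<alpha>0)) \<and>
     ann_step (D, R) (n i) (n (Suc i)) (\<tau> i) (\<tau> (Suc i)) i (\<alpha> i) (\<alpha> (Suc i))"
    using \<alpha>0 ann_step_ex[OF relevant valid valid] by (intro dependent_nat_choice) auto
  then obtain \<alpha> where \<alpha>: "\<And>i. erase (\<alpha> i) = formula_at (D, R) (n i) (\<tau> i)" "\<alpha> 0 = \<alpha>0"
     "\<And>i. ann_step (D, R) (n i) (n (Suc i)) (\<tau> i) (\<tau> (Suc i)) i (\<alpha> i) (\<alpha> (Suc i))"
    by blast
  define lab where "lab = rec_nat [] (\<lambda>i q. if \<beta> i then q @ [i] else q)"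
  have lab: "lab 0 = []" "lab (Suc i) = (if \<beta> i then lab i @ [i] else lab i)" for i
    unfolding lab_def by simp_all
  have fixlab: "fixat \<sigma> (lab i) (\<alpha> i) (\<pi> i)" for i
  proof (induction i)
    case 0
    obtain q where "fixat \<sigma> q (\<alpha> 0) (\<pi> 0)" using \<sigma>(2) \<alpha>(1)[of 0] fixat_erase by metis
    moreover from this have "q = []" using labels0[of \<sigma>] unfolding \<alpha>(2) labels_fixat by blast
    ultimately show ?case using lab by simp
  next
    case (Suc i)
    have "good_sign (fst (\<tau> i)) \<sigma>" unfolding side[of i] by (rule \<sigma>(1))
    note step = fixat_step[OF relevant valid \<alpha>(1) \<alpha>(1) \<alpha>(3) this, of "lab (Suc i)" "\<pi> (Suc i)"]
    show ?case
      by (intro iffD2[OF step] exI[of _ "\<pi> i"] exI[of _ "lab i"] exI[of _ "\<beta> i"] conjI)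
        (rule Suc, rule th, rule lab(2))
  qed
  obtain p where "\<forall>m. \<exists>i. lab i = map p [0..<m]" using label_limit[of \<beta> lab] inf lab by blast
  then have "\<forall>m. \<exists>i. map p [0..<m] \<in> labels \<sigma> (\<alpha> i)"
    unfolding labels_fixat mem_Collect_eq
  proof (intro allI)
    fix m
    obtain i where "lab i = map p [0..<m]" using \<open>\<forall>m. \<exists>i. lab i = map p [0..<m]\<close> by blast
    then show "\<exists>i \<pi>. fixat \<sigma> (map p [0..<m]) (\<alpha> i) \<pi>" using fixlab[of i] by auto
  qed
  moreover have "annotation (D, R) n \<tau> \<alpha>"
    unfolding annotation_def
    using \<alpha> labels0 by (auto intro!: exI[of _ "\<lambda>i. i"] simp del: ann_step.simps)
  moreover have "infinite {i. \<exists>r. rule_at (D, R) (n i) r \<and> logical r \<and> principal r (\<tau> i)}"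
    by (rule infinite_super[OF _ inf]) (use progress in blast)
  ultimately show "\<exists>\<sigma>. good_sign (fst (\<tau> 0)) \<sigma> \<and> fix_trace \<sigma> (D, R) n \<tau>"
    unfolding fix_trace_def is_trace_def using \<sigma>(1) valid relevant by blast
  show "valid_occ (D, R) (n i) (\<tau> i)" by (rule valid)
  show "\<exists>\<sigma>. fixat \<sigma> () (formula_at (D, R) (n i) (\<tau> i)) (\<pi> i)"
    using fixlab[of i] \<alpha>(1)[of i] fixat_erase by metis
qed

end

lemma global_trace_condition_threads:
  assumes "pre_proof (D, R)"
  shows "global_trace_condition (D, R) \<longleftrightarrow>
    (\<forall>n. infinite_path (D, R) n \<longrightarrow>
      (threaded D R n))"
proof -
  have "(\<exists>m \<tau>. (fst (\<tau> 0) = Lft \<and> fix_trace Mu (D, R) (\<lambda>i. n (m + i)) \<tau>) \<or>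
               (fst (\<tau> 0) = Rgt \<and> fix_trace Nu (D, R) (\<lambda>i. n (m + i)) \<tau>)) \<longleftrightarrow>
    (threaded D R n)" (is "?L \<longleftrightarrow> ?R") if path: "infinite_path (D, R) n" for n
  proof
    have path': "infinite_path (D, R) (\<lambda>i. n (m + i))" for m
      using path unfolding infinite_path_def by simp
    {
      assume ?L
      then obtain m \<tau> \<sigma> where "good_sign (fst (\<tau> 0)) \<sigma>" "fix_trace \<sigma> (D, R) (\<lambda>i. n (m + i)) \<tau>"
        unfolding good_sign_def by blast
      from thread_of_fix_trace[OF assms path' this(2,1)] obtain m' s \<beta> where
        *: "\<forall>i\<ge>m'. thread_step (D, R) (\<beta> i) (n (m + i)) (s i) (n (m + Suc i)) (s (Suc i))"
        "infinite {i. m' \<le> i \<and> \<beta> i}" by blast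
      have "thread_step (D, R) (\<beta> (i - m)) (n i) (s (i - m)) (n (Suc i)) (s (Suc i - m))" if "i \<ge> m + m'" for i
        using *(1)[rule_format, of "i - m"] that by (simp add: Suc_diff_le)
      moreover have "infinite {i. m + m' \<le> i \<and> \<beta> (i - m)}"
      proof -
        have "(\<lambda>i. m + i) ` {i. m' \<le> i \<and> \<beta> i} \<subseteq> {i. m + m' \<le> i \<and> \<beta> (i - m)}" by auto
        moreover have "infinite ((\<lambda>i. m + i) ` {i. m' \<le> i \<and> \<beta> i})"
          using *(2) by (simp add: finite_image_iff)
        ultimately show ?thesis by (rule infinite_super)
      qed
      ultimately show ?R
        by (intro exI[of _ "m + m'"] exI[of _ "\<lambda>i. s (i - m)"] exI[of _ "\<lambda>i. \<beta> (i - m)"]) blast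
    next
      assume ?R
      then obtain m s \<beta> where
        *: "\<And>i. i \<ge> m \<Longrightarrow> thread_step (D, R) (\<beta> i) (n i) (s i) (n (Suc i)) (s (Suc i))"
        "infinite {i. m \<le> i \<and> \<beta> i}" by blast
      \<comment> \<open>The trace is started at a progress step, as
        \<open>fix_trace_of_thread\<close> requires.\<close>
      obtain m' where m': "m' \<ge> m" "\<beta> m'" using *(2) unfolding infinite_nat_iff_unbounded_le by blast
      have "infinite {i. \<beta> (m' + i)}"
        unfolding infinite_nat_iff_unbounded_le
      proof
        fix k
        obtain i where "i \<ge> m' + k" "\<beta> i" using *(2) unfolding infinite_nat_iff_unbounded_le by blast
        then show "\<exists>i\<ge>k. i \<in> {i. \<beta> (m' + i)}" by (intro exI[of _ "i - m'"]) auto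
      qed
      moreover have "thread_step (D, R) (\<beta> (m' + i)) (n (m' + i)) (fst (s (m' + i)), snd (s (m' + i))) 
          (n (m' + Suc i)) (fst (s (m' + Suc i)), snd (s (m' + Suc i)))" for i
        using *(1)[of "m' + i"] m' by simp
      ultimately obtain \<sigma> where "good_sign (fst (fst (s (m' + 0)))) \<sigma>"
          "fix_trace \<sigma> (D, R) (\<lambda>i. n (m' + i)) (\<lambda>i. fst (s (m' + i)))"
        using fix_trace_of_thread(1)[OF assms path', of "\<lambda>i. \<beta> (m' + i)" m'
            "\<lambda>i. fst (s (m' + i))" "\<lambda>i. snd (s (m' + i))"] m' by auto
      then show ?L
        unfolding good_sign_def
        by (intro exI[of _ m'] exI[of _ "\<lambda>i. fst (s (m' + i))"]) auto
    }
  qed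
  then show ?thesis unfolding global_trace_condition_def by blast
qed

section \<open>Codes of formulas\<close>

text \<open>Walking down a code along a coded path. Such iterations take the place of recursion on
  subformulas and subderivations, for which course-of-values recursion on codes would be
  required.\<close>

definition cfold :: "(nat \<Rightarrow> nat \<Rightarrow> nat) \<Rightarrow> nat \<Rightarrow> nat \<Rightarrow> nat" where
  "cfold F x u = foldl F x (list_decode u)"

lemma cfold_list_encode [simp]: "cfold F x (list_encode \<pi>) = foldl F x \<pi>"
  by (simp add: cfold_def)

lemma rec_fun_cfold:
  assumes "rec_fun x" "rec_fun u" "rec_fun (\<lambda>w. F (pfst w) (psnd w))"
  shows "rec_fun (\<lambda>z. cfold F (x z) (u z))"
proof -
  have "rec_nat y (\<lambda>k r. F r (lnth v k)) k = foldl F y (take k (list_decode v))" if "k \<le> llen v" for y v k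
    using that
  proof (induction k)
    case (Suc k)
    then show ?case by (simp add: take_Suc_conv_app_nth llen_def lnth_def)
  qed simp
  from this[of "llen v" v y for v y]
  have "rec_nat y (\<lambda>k r. F r (lnth v k)) (llen v) = cfold F y v" for y v
    by (simp add: cfold_def llen_def)
  moreover have "rec_fun (\<lambda>z. rec_nat (x z) (\<lambda>k r. F r (lnth (u z) k)) (llen (u z)))"
    by (intro rec_intros_list assms(1,2) rec_fun_comp[OF assms(2)]
      rec_fun_comp[OF assms(3), of "\<lambda>w. pair (pfst (psnd w)) (lnth (u (psnd (psnd w))) (pfst w))", simplified])
  ultimately show ?thesis by simp
qed

lemma aty_code_inject: "aty_code A = aty_code B \<longleftrightarrow> A = B"
  and fty_code_inject: "fty_code T = fty_code U \<longleftrightarrow> T = U"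
proof (induction A and T arbitrary: B and U)
  case NatT then show ?case by (cases B) (auto simp: list_encode_eq simp del: list_encode.simps)
next
  case (FormT T) then show ?case by (cases B) (auto simp: list_encode_eq simp del: list_encode.simps)
next
  case Omega then show ?case by (cases U) (auto simp: list_encode_eq simp del: list_encode.simps)
next
  case (Arrow A T) then show ?case by (cases U) (auto simp: list_encode_eq simp del: list_encode.simps)
qed

definition ftag :: "nat \<Rightarrow> nat" where "ftag f = lnth f 0"

text \<open>The cases follow the tags of \<open>fm_code\<close>: 1, 2 and 6 are binary, and 5, 7 and
  8 have their only child at different places. A missing child gives 0, which has no children
  either.\<close>

definition fchild :: "nat \<Rightarrow> nat \<Rightarrow> nat" where
  "fchild f j =
     (if ftag f = 1 \<or> ftag f = 2 \<or> ftag f = 6 then (if j = 0 then lnth f 1 else if j = 1 then lnth f 2 else 0)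
      else if j = 0 then
        (if ftag f = 5 then lnth f 2 else if ftag f = 7 then lnth f 1 else if ftag f = 8 then lnth f 3 else 0)
      else 0)"

lemma lnth_0 [simp]: "lnth 0 i = 0" by (simp add: lnth_def)

lemma ftag_0 [simp]: "ftag 0 = 0" by (simp add: ftag_def)

lemma fchild_0 [simp]: "fchild 0 j = 0"
  by (simp add: fchild_def)

lemma fchild_fm_code:
  "fchild (fm_code \<phi>) j = (if j < length (kids \<phi>) then fm_code (kids \<phi> ! j) else 0)"
  by (cases \<phi>) (auto simp: fchild_def ftag_def less_length_2 simp del: list_encode.simps)

definition fm_opt_code :: "form option \<Rightarrow> nat" where
  "fm_opt_code x = (case x of None \<Rightarrow> 0 | Some \<phi> \<Rightarrow> fm_code \<phi>)"

lemma foldl_fchild_0: "foldl fchild 0 \<pi> = 0"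
  by (induction \<pi>) auto

lemma foldl_fchild: "foldl fchild (fm_code \<phi>) \<pi> = fm_opt_code (sub \<phi> \<pi>)"
  by (induction \<pi> arbitrary: \<phi>) (auto simp: fchild_fm_code foldl_fchild_0 fm_opt_code_def)

lemma fm_code_neq_0 [simp]: "fm_code \<phi> \<noteq> 0" "0 \<noteq> fm_code \<phi>"
  by (cases \<phi>; simp)+

lemma fm_code_FFree: "fm_code \<phi> = list_encode [3, x, fty_code T] \<longleftrightarrow> \<phi> = FFree x T"
  by (cases \<phi>) (auto simp: list_encode_eq fty_code_inject simp del: list_encode.simps)

lemma fm_code_FBound: "fm_code \<phi> = list_encode [4, i] \<longleftrightarrow> \<phi> = FBound i"
  by (cases \<phi>) (auto simp: list_encode_eq simp del: list_encode.simps)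

lemma ftag_Fix: "ftag (fm_code \<phi>) = 8 \<longleftrightarrow> (\<exists>\<sigma> T \<chi>. \<phi> = Fix \<sigma> () T \<chi>)"
  by (cases \<phi>) (auto simp: ftag_def simp del: list_encode.simps)

lemma fixat_sub: "fixat \<sigma> p \<phi> \<pi> \<longleftrightarrow> (\<exists>T \<chi>. sub \<phi> \<pi> = Some (Fix \<sigma> p T \<chi>))"
  by (induction \<pi> arbitrary: \<phi>) auto

lemma fixat_code: "ftag (foldl fchild (fm_code \<phi>) \<pi>) = 8 \<longleftrightarrow> (\<exists>\<sigma>. fixat \<sigma> () \<phi> \<pi>)"
  unfolding foldl_fchild fixat_sub fm_opt_code_def by (auto split: option.split simp: ftag_Fix)

lemma rec_fun_ftag: "rec_fun f \<Longrightarrow> rec_fun (\<lambda>z. ftag (f z))"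
  unfolding ftag_def by (intro rec_intros_list)

lemma rec_fun_fchild: "rec_fun f \<Longrightarrow> rec_fun g \<Longrightarrow> rec_fun (\<lambda>z. fchild (f z) (g z))"
  unfolding fchild_def by (intro rec_intros_list rec_fun_ftag)

text \<open>The second component counts the binders on the way.\<close>

definition hchild :: "nat \<Rightarrow> nat \<Rightarrow> nat" where
  "hchild x j = pair (fchild (pfst x) j) (if ftag (pfst x) = 5 \<or> ftag (pfst x) = 8 then Suc (psnd x) else psnd x)"

text \<open>\<open>w\<close> is the path to the hole and \<open>v\<close> the rest within the copy.
  \<open>Suc (pair 4 (Suc (pair i 0)))\<close> is the code of \<open>FBound i\<close>, where
  \<open>i\<close> is the number of binders passed on the way.\<close>

definition hole_code :: "nat \<Rightarrow> nat \<Rightarrow> nat \<Rightarrow> bool" where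
  "hole_code f u v \<longleftrightarrow> (\<exists>w<Suc u. u = lapp w v \<and>
     pfst (cfold hchild (pair f 0) w) = Suc (pair 4 (Suc (pair (psnd (cfold hchild (pair f 0) w)) 0))))"

lemma ftag_binds: "ftag (fm_code \<phi>) = 5 \<or> ftag (fm_code \<phi>) = 8 \<longleftrightarrow> binds \<phi>"
  by (cases \<phi>) (auto simp: ftag_def simp del: list_encode.simps)

lemma pfst_foldl_hchild_0: "pfst (foldl hchild (pair 0 k) \<pi>) = 0"
  by (induction \<pi> arbitrary: k) (auto simp: hchild_def)

lemma hchild_fm_code: "hchild (pair (fm_code \<phi>) k) j =
   pair (if j < length (kids \<phi>) then fm_code (kids \<phi> ! j) else 0) (if binds \<phi> then Suc k else k)"
  unfolding hchild_def pfst_pair psnd_pair ftag_binds fchild_fm_code ..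

lemma holeat_append:
  "holeat k \<phi> \<pi> \<rho> \<longleftrightarrow> (\<exists>\<pi>1. \<pi> = \<pi>1 @ \<rho> \<and>
     pfst (foldl hchild (pair (fm_code \<phi>) k) \<pi>1) = list_encode [4, psnd (foldl hchild (pair (fm_code \<phi>) k) \<pi>1)])"
proof (induction k \<phi> \<pi> \<rho> rule: holeat.induct)
  case (1 k \<phi> \<rho>)
  then show ?case using fm_code_FBound[of \<phi> k] by (auto simp del: list_encode.simps)
next
  case (2 k \<phi> j \<pi> \<rho>)
  have "(\<exists>\<pi>1. j # \<pi> = \<pi>1 @ \<rho> \<and> P \<pi>1) \<longleftrightarrow> (\<rho> = j # \<pi> \<and> P []) \<or> (\<exists>\<pi>1. \<pi> = \<pi>1 @ \<rho> \<and> P (j # \<pi>1))" for P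
  proof
    assume "\<exists>\<pi>1. j # \<pi> = \<pi>1 @ \<rho> \<and> P \<pi>1"
    then obtain \<pi>1 where "j # \<pi> = \<pi>1 @ \<rho>" "P \<pi>1" by blast
    then show "(\<rho> = j # \<pi> \<and> P []) \<or> (\<exists>\<pi>1. \<pi> = \<pi>1 @ \<rho> \<and> P (j # \<pi>1))"
      by (cases \<pi>1) auto
  next
    assume "(\<rho> = j # \<pi> \<and> P []) \<or> (\<exists>\<pi>1. \<pi> = \<pi>1 @ \<rho> \<and> P (j # \<pi>1))"
    then show "\<exists>\<pi>1. j # \<pi> = \<pi>1 @ \<rho> \<and> P \<pi>1"
    proof (elim disjE exE)
      assume "\<rho> = j # \<pi> \<and> P []" then show ?thesis by (intro exI[of _ "[]"]) simp
    next
      fix \<pi>1 assume "\<pi> = \<pi>1 @ \<rho> \<and> P (j # \<pi>1)" then show ?thesis by (intro exI[of _ "j # \<pi>1"]) simp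
    qed
  qed
  note split = this
  have zero: "pfst (foldl hchild (pair 0 m) \<pi>1) \<noteq> list_encode [4, i]" for m \<pi>1 i
    unfolding pfst_foldl_hchild_0 by simp
  show ?case
  proof (cases "j < length (kids \<phi>)")
    case True
    then show ?thesis
      unfolding split holeat.simps 2 foldl_Cons foldl_Nil hchild_fm_code
      by (simp add: fm_code_FBound del: list_encode.simps) blast
  next
    case False
    then show ?thesis
      unfolding split holeat.simps foldl_Cons foldl_Nil hchild_fm_code
      by (simp add: fm_code_FBound zero del: list_encode.simps) blast
  qed
qed

text \<open>As \<open>list_encode\<close> is onto, a bounded search over numbers is a search over
  lists whenever all solutions respect the bound.\<close>

lemma ex_list_encode:
  "(\<exists>w<Suc (list_encode \<pi>). P w) \<longleftrightarrow> (\<exists>\<rho>. P (list_encode \<rho>))"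
  if "\<And>\<rho>. P (list_encode \<rho>) \<Longrightarrow> list_encode \<rho> \<le> list_encode \<pi>"
proof
  assume "\<exists>w<Suc (list_encode \<pi>). P w"
  then obtain w where "P w" by blast
  then show "\<exists>\<rho>. P (list_encode \<rho>)" by (intro exI[of _ "list_decode w"]) simp
next
  assume "\<exists>\<rho>. P (list_encode \<rho>)"
  then obtain \<rho> where "P (list_encode \<rho>)" by blast
  then show "\<exists>w<Suc (list_encode \<pi>). P w"
    using that by (intro exI[of _ "list_encode \<rho>"]) (simp add: less_Suc_eq_le)
qed

lemma hole_code: "hole_code (fm_code \<phi>) (list_encode \<pi>) (list_encode \<rho>) \<longleftrightarrow> holeat 0 \<phi> \<pi> \<rho>"
proof -
  have code4: "Suc (pair 4 (Suc (pair i 0))) = list_encode [4, i]" for i by simp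
  show ?thesis
    unfolding hole_code_def holeat_append code4
    by (subst ex_list_encode) (auto simp: list_encode_prefix_le list_encode_eq simp del: list_encode.simps)
qed

lemma rec_pred_hole_code: "rec_fun f \<Longrightarrow> rec_fun g \<Longrightarrow> rec_fun h \<Longrightarrow> rec_pred (\<lambda>z. hole_code (f z) (g z) (h z))"
proof -
  have 1: "rec_fun (\<lambda>w. hchild (pfst w) (psnd w))"
    unfolding hchild_def by (intro rec_intros_list rec_fun_fchild rec_fun_ftag)
  have 2: "rec_pred (\<lambda>z. hole_code (pfst z) (pfst (psnd z)) (psnd (psnd z)))"
    unfolding hole_code_def by (intro rec_intros_list rec_fun_cfold 1)
  show "rec_fun f \<Longrightarrow> rec_fun g \<Longrightarrow> rec_fun h \<Longrightarrow> ?thesis"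
    using rec_pred_comp[OF 2, of "\<lambda>z. pair (f z) (pair (g z) (h z))"] by (simp add: rec_fun_pair)
qed

subsection \<open>Counting occurrences\<close>

text \<open>Occurrences are counted through the paths that lead to them, which needs a bounded sum
  but no recursion on formulas. A path has entries 0 and 1 and is no longer than the height, hence
  than the code \<open>f\<close>.\<close>

definition count_code :: "nat \<Rightarrow> nat \<Rightarrow> nat" where
  "count_code f v = (\<Sum>u<Suc (lrep f 1). if cfold fchild f u = v then 1 else 0)"

primrec height :: "'a fm \<Rightarrow> nat" where
  "height (Eq s t) = 0"
| "height (Or \<phi> \<psi>) = Suc (max (height \<phi>) (height \<psi>))"
| "height (And \<phi> \<psi>) = Suc (max (height \<phi>) (height \<psi>))"
| "height (FFree x T) = 0"
| "height (FBound i) = 0"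
| "height (Lam A \<phi>) = Suc (height \<phi>)"
| "height (AppF \<phi> \<psi>) = Suc (max (height \<phi>) (height \<psi>))"
| "height (AppT \<phi> t) = Suc (height \<phi>)"
| "height (Fix \<sigma> a T \<phi>) = Suc (height \<phi>)"

lemma kids_height: "\<psi> \<in> set (kids \<phi>) \<Longrightarrow> height \<psi> < height \<phi>"
  by (cases \<phi>) auto

lemma length_kids: "length (kids \<phi>) \<le> 2"
  by (cases \<phi>) auto

lemma sub_bounds: "sub \<phi> \<pi> = Some \<chi> \<Longrightarrow> length \<pi> \<le> height \<phi> \<and> (\<forall>j\<in>set \<pi>. j \<le> 1)"
proof (induction \<pi> arbitrary: \<phi>)
  case (Cons j \<pi>)
  then have j: "j < length (kids \<phi>)" "sub (kids \<phi> ! j) \<pi> = Some \<chi>" by (auto split: if_splits)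
  then have "length \<pi> \<le> height (kids \<phi> ! j)" "\<forall>j\<in>set \<pi>. j \<le> 1" using Cons.IH by auto
  moreover have "height (kids \<phi> ! j) < height \<phi>" by (rule kids_height[OF nth_mem[OF j(1)]])
  ultimately show ?case using j(1) length_kids[of \<phi>] by auto
qed simp

lemma height_le_fm_code: "height \<phi> \<le> fm_code \<phi>"
proof -
  have *: "x \<in> set xs \<Longrightarrow> h \<le> x \<Longrightarrow> Suc h \<le> list_encode xs" for x h xs
    using mem_less_list_encode[of x xs] by simp
  show ?thesis
  proof (induction \<phi>)
    case (Or \<phi> \<psi>)
    then show ?case using *[of "fm_code \<phi>" "[1, fm_code \<phi>, fm_code \<psi>]"] *[of "fm_code \<psi>" "[1, fm_code \<phi>, fm_code \<psi>]"]
      by (simp add: max_def del: list_encode.simps)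
  next
    case (And \<phi> \<psi>)
    then show ?case using *[of "fm_code \<phi>" "[2, fm_code \<phi>, fm_code \<psi>]"] *[of "fm_code \<psi>" "[2, fm_code \<phi>, fm_code \<psi>]"]
      by (simp add: max_def del: list_encode.simps)
  next
    case (AppF \<phi> \<psi>)
    then show ?case using *[of "fm_code \<phi>" "[6, fm_code \<phi>, fm_code \<psi>]"] *[of "fm_code \<psi>" "[6, fm_code \<phi>, fm_code \<psi>]"]
      by (simp add: max_def del: list_encode.simps)
  next
    case (Lam A \<phi>)
    then show ?case using *[of "fm_code \<phi>" "[5, aty_code A, fm_code \<phi>]"] by (simp del: list_encode.simps)
  next
    case (AppT \<phi> t)
    then show ?case using *[of "fm_code \<phi>" "[7, fm_code \<phi>, tm_code t]"] by (simp del: list_encode.simps)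
  next
    case (Fix \<sigma> a T \<phi>)
    then show ?case using *[of "fm_code \<phi>" "[8, sgn_code \<sigma>, fty_code T, fm_code \<phi>]"] by (simp del: list_encode.simps)
  qed simp_all
qed

lemma finite_occ_paths: "finite {\<pi>. sub \<phi> \<pi> = Some \<chi>}"
proof (rule finite_subset)
  show "{\<pi>. sub \<phi> \<pi> = Some \<chi>} \<subseteq> {\<pi>. set \<pi> \<subseteq> {..1} \<and> length \<pi> \<le> height \<phi>}"
    using sub_bounds[of \<phi> _ \<chi>] by auto
  show "finite {\<pi> :: nat list. set \<pi> \<subseteq> {..1} \<and> length \<pi> \<le> height \<phi>}"
    by (rule finite_lists_length_le) simp
qed

lemma occs_card: "occs x T \<phi> = card {\<pi>. sub \<phi> \<pi> = Some (FFree x T)}"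
proof (induction \<phi>)
  have cons: "card {\<pi>. sub \<chi> \<pi> = Some (FFree x T)} =
      sum_list (map (\<lambda>\<phi>. card {\<pi>. sub \<phi> \<pi> = Some (FFree x T)}) (kids \<chi>))" if "kids \<chi> \<noteq> []" for \<chi> :: "'a fm"
  proof -
    let ?P = "\<lambda>\<phi>. {\<pi>. sub \<phi> \<pi> = Some (FFree x T)}"
    have "?P \<chi> = (\<Union>j<length (kids \<chi>). (#) j ` ?P (kids \<chi> ! j))"
    proof (intro set_eqI)
      fix \<pi> show "\<pi> \<in> ?P \<chi> \<longleftrightarrow> \<pi> \<in> (\<Union>j<length (kids \<chi>). (#) j ` ?P (kids \<chi> ! j))"
        using that by (cases \<pi>) auto
    qed
    also have "card \<dots> = (\<Sum>j<length (kids \<chi>). card ((#) j ` ?P (kids \<chi> ! j)))"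
      by (rule card_UN_disjoint) (auto simp: finite_occ_paths)
    also have "\<dots> = (\<Sum>j<length (kids \<chi>). card (?P (kids \<chi> ! j)))"
      by (simp add: card_image)
    also have "\<dots> = sum_list (map (\<lambda>\<phi>. card (?P \<phi>)) (kids \<chi>))"
      by (simp add: sum_list_sum_nth atLeast0LessThan)
    finally show ?thesis .
  qed
  have atom: "{\<pi>. sub \<chi> \<pi> = Some (FFree x T)} = (if \<chi> = FFree x T then {[]} else {})" if "kids \<chi> = []" for \<chi> :: "'a fm"
  proof (intro set_eqI)
    fix \<pi> show "\<pi> \<in> {\<pi>. sub \<chi> \<pi> = Some (FFree x T)} \<longleftrightarrow> \<pi> \<in> (if \<chi> = FFree x T then {[]} else {})"
      using that by (cases \<pi>) auto
  qed
  {
    case (Eq s t) show ?case by (simp add: atom)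
  next
    case (FFree y U) show ?case by (simp add: atom)
  next
    case (FBound y) show ?case by (simp add: atom)
  next
    case (Or \<phi> \<psi>) then show ?case by (simp add: cons[of "Or \<phi> \<psi>"] del: sub.simps)
  next
    case (And \<phi> \<psi>) then show ?case by (simp add: cons[of "And \<phi> \<psi>"] del: sub.simps)
  next
    case (AppF \<phi> \<psi>) then show ?case by (simp add: cons[of "AppF \<phi> \<psi>"] del: sub.simps)
  next
    case (Lam A \<phi>) then show ?case by (simp add: cons[of "Lam A \<phi>"] del: sub.simps)
  next
    case (AppT \<phi> t) then show ?case by (simp add: cons[of "AppT \<phi> t"] del: sub.simps)
  next
    case (Fix \<sigma> a U \<phi>) then show ?case by (simp add: cons[of "Fix \<sigma> a U \<phi>"] del: sub.simps)
  }
qed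

lemma count_code: "count_code (fm_code \<phi>) (list_encode [3, x, fty_code T]) = occs x T \<phi>"
proof -
  let ?N = "Suc (lrep (fm_code \<phi>) 1)"
  have iff: "foldl fchild (fm_code \<phi>) \<pi> = list_encode [3, x, fty_code T] \<longleftrightarrow> sub \<phi> \<pi> = Some (FFree x T)" for \<pi>
  proof (cases "sub \<phi> \<pi>")
    case None
    then show ?thesis unfolding foldl_fchild fm_opt_code_def by simp
  next
    case (Some \<chi>)
    then show ?thesis unfolding foldl_fchild fm_opt_code_def using fm_code_FFree[of \<chi> x T]
      by (simp del: list_encode.simps)
  qed
  have count: "(\<Sum>u<n. if P u then 1 else 0 :: nat) = card {u. u < n \<and> P u}" for n :: nat and P
    using sum.inter_filter[OF finite_lessThan[of n], of "\<lambda>_. 1 :: nat" P] by simp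
  have "count_code (fm_code \<phi>) (list_encode [3, x, fty_code T]) =
      card {u. u < ?N \<and> cfold fchild (fm_code \<phi>) u = list_encode [3, x, fty_code T]}"
    unfolding count_code_def count ..
  also have "{u. u < ?N \<and> cfold fchild (fm_code \<phi>) u = list_encode [3, x, fty_code T]} =
      list_encode ` {\<pi>. sub \<phi> \<pi> = Some (FFree x T)}"
  proof (intro set_eqI iffI)
    fix u assume "u \<in> {u. u < ?N \<and> cfold fchild (fm_code \<phi>) u = list_encode [3, x, fty_code T]}"
    then have "list_decode u \<in> {\<pi>. sub \<phi> \<pi> = Some (FFree x T)}"
      unfolding cfold_def iff by simp
    then show "u \<in> list_encode ` {\<pi>. sub \<phi> \<pi> = Some (FFree x T)}"
      by (rule rev_image_eqI) simp
  next
    fix u assume "u \<in> list_encode ` {\<pi>. sub \<phi> \<pi> = Some (FFree x T)}"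
    then obtain \<pi> where \<pi>: "u = list_encode \<pi>" "sub \<phi> \<pi> = Some (FFree x T)" by blast
    have "u \<le> lrep (fm_code \<phi>) 1" unfolding \<pi>(1)
      by (rule list_encode_le_lrep) (use sub_bounds[OF \<pi>(2)] height_le_fm_code[of \<phi>] in auto)
    then show "u \<in> {u. u < ?N \<and> cfold fchild (fm_code \<phi>) u = list_encode [3, x, fty_code T]}"
      using \<pi> iff by (simp del: list_encode.simps)
  qed
  also have "card \<dots> = card {\<pi>. sub \<phi> \<pi> = Some (FFree x T)}"
    by (rule card_image) (rule inj_list_encode)
  finally show ?thesis unfolding occs_card .
qed

text \<open>The state is a subformula with the number of occurrences passed on the left. Only a move
  to child 1 passes any, namely those in child 0.\<close>

definition lchild :: "nat \<Rightarrow> nat \<Rightarrow> nat \<Rightarrow> nat" where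
  "lchild v x j = pair (fchild (pfst x) j)
     (psnd x + (if j = 1 then count_code (fchild (pfst x) 0) v else 0))"

lemma left_occs_code_aux:
  "sub \<phi> \<pi> = Some \<chi> \<Longrightarrow> foldl (lchild (list_encode [3, x, fty_code T])) (pair (fm_code \<phi>) k) \<pi> =
     pair (fm_code \<chi>) (k + left_occs x T \<phi> \<pi>)"
proof (induction \<pi> arbitrary: \<phi> k)
  case (Cons j \<pi>)
  then have j: "j < length (kids \<phi>)" "sub (kids \<phi> ! j) \<pi> = Some \<chi>" by (auto split: if_splits)
  have "j = 0 \<or> j = 1" using j(1) length_kids[of \<phi>] by auto
  moreover have "take 1 (kids \<phi>) = [kids \<phi> ! 0]" using j(1) by (cases "kids \<phi>") auto
  ultimately have "sum_list (map (occs x T) (take j (kids \<phi>))) = (if j = 1 then occs x T (kids \<phi> ! 0) else 0)"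
    by auto
  moreover have "0 < length (kids \<phi>)" using j(1) by linarith
  ultimately have "lchild (list_encode [3, x, fty_code T]) (pair (fm_code \<phi>) k) j =
      pair (fm_code (kids \<phi> ! j)) (k + sum_list (map (occs x T) (take j (kids \<phi>))))"
    unfolding lchild_def using j(1) by (simp add: fchild_fm_code count_code del: list_encode.simps)
  then show ?case using Cons.IH[OF j(2)] j(1) by (simp del: list_encode.simps)
qed simp

lemma pfst_foldl_lchild: "pfst (foldl (lchild v) (pair f k) \<pi>) = foldl fchild f \<pi>"
  by (induction \<pi> arbitrary: f k) (auto simp: lchild_def)

lemma left_occs_code:
  "foldl (lchild (list_encode [3, x, fty_code T])) (pair (fm_code \<phi>) 0) \<pi> = pair (list_encode [3, x, fty_code T]) j
    \<longleftrightarrow> sub \<phi> \<pi> = Some (FFree x T) \<and> left_occs x T \<phi> \<pi> = j"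
proof (cases "sub \<phi> \<pi>")
  case None
  then have "pfst (foldl (lchild (list_encode [3, x, fty_code T])) (pair (fm_code \<phi>) 0) \<pi>) = 0"
    unfolding pfst_foldl_lchild foldl_fchild by (simp add: fm_opt_code_def)
  then show ?thesis using None by (metis list_encode.simps(2) nat.distinct(1) option.distinct(1) pfst_pair)
next
  case (Some \<chi>)
  from left_occs_code_aux[OF this, of x T 0] show ?thesis
    using fm_code_FFree[of \<chi> x T] Some by (auto simp del: list_encode.simps)
qed

lemma rec_fun_lchild_fold:
  assumes "rec_fun f" "rec_fun g" "rec_fun h"
  shows "rec_fun (\<lambda>z. cfold (lchild (f z)) (g z) (h z))"
proof -
  have 1: "rec_fun (\<lambda>z. count_code (f z) (g z))" if "rec_fun f" "rec_fun g" for f g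
    unfolding count_code_def
    by (intro rec_intros_list rec_fun_cfold rec_fun_fchild that rec_fun_comp[OF that(1)] rec_fun_comp[OF that(2)])
  have 2: "rec_fun (\<lambda>z. lchild (f z) (g z) (h z))" if "rec_fun f" "rec_fun g" "rec_fun h" for f g h
    unfolding lchild_def
    by (intro rec_intros_list rec_fun_fchild 1 that)
  \<comment> \<open>\<open>rec_fun_cfold\<close> allows no parameter in the step function, so it is carried along in the state\<close>
  have "foldl (\<lambda>x j. pair (pfst x) (lchild (pfst x) (psnd x) j)) (pair v x) xs = pair v (foldl (lchild v) x xs)" for v x xs
    by (induction xs arbitrary: x) auto
  then have "psnd (cfold (\<lambda>x j. pair (pfst x) (lchild (pfst x) (psnd x) j)) (pair v x) u) = cfold (lchild v) x u" for v x u
    by (simp add: cfold_def)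
  moreover have "rec_fun (\<lambda>z. psnd (cfold (\<lambda>x j. pair (pfst x) (lchild (pfst x) (psnd x) j)) (pair (f z) (g z)) (h z)))"
    by (intro rec_intros_list rec_fun_cfold 2 assms)
  ultimately show ?thesis by simp
qed

section \<open>Codes of rules\<close>

primrec side_code :: "side \<Rightarrow> nat" where
  "side_code Lft = 0"
| "side_code Rgt = 1"

lemma llen_fms_code [simp]: "llen (fms_code \<Gamma>) = length \<Gamma>"
  by (simp add: fms_code_def)

lemma lnth_fms_code [simp]: "lnth (fms_code \<Gamma>) i = (if i < length \<Gamma> then fm_code (\<Gamma> ! i) else 0)"
  by (simp add: fms_code_def)

lemma llen_args_code [simp]: "llen (args_code as) = length as"
  by (simp add: args_code_def)

text \<open>
  The numbers of formulas that are not side formulas, depending on the tag of the rule: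
  on the left and right of the conclusion, and on the right of the premise \<open>j\<close>.
\<close>

definition lconcl :: "nat \<Rightarrow> nat" where
  "lconcl t = (if t = 2 \<or> t = 4 \<or> t = 10 \<or> t = 11 \<or> t = 13 \<or> t = 15 \<or> t = 17 \<or> t = 19 \<or> t = 23 then 1 else 0)"

definition rconcl :: "nat \<Rightarrow> nat" where
  "rconcl t = (if t = 3 \<or> t = 5 \<or> t = 10 \<or> t = 14 \<or> t = 16 \<or> t = 18 \<or> t = 20 then 1 else 0)"

definition rprem :: "nat \<Rightarrow> nat \<Rightarrow> nat" where
  "rprem t j = (if t = 1 then (if j = 0 then 1 else 0) else if t = 5 \<or> t = 14 then 2
     else if t = 10 \<or> t = 16 \<or> t = 18 \<or> t = 20 then 1 else 0)"

definition swap_code :: "nat \<Rightarrow> nat \<Rightarrow> nat" where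
  "swap_code n i = (if i = n then Suc n else if i = Suc n then n else i)"

text \<open>Except for exchange, tags 6 and 7, entries 1 and 2 of a code of a rule with premises are
  the side formulas. On the right these form a suffix, hence the subtractions. Validity of
  \<open>i\<close> is included.\<close>

definition relevant_code :: "nat \<Rightarrow> nat \<Rightarrow> nat \<Rightarrow> nat \<Rightarrow> nat \<Rightarrow> bool" where
  "relevant_code rc j d i i' \<longleftrightarrow>
     (if lnth rc 0 = 6 then
        (if d = 0 then i < llen (lnth rc 1) + 2 + llen (lnth rc 4) \<and> i' = swap_code (llen (lnth rc 1)) i
         else i < llen (lnth rc 5) \<and> i' = i)
      else if lnth rc 0 = 7 then
        (if d = 0 then i < llen (lnth rc 1) \<and> i' = i
         else i < llen (lnth rc 2) + 2 + llen (lnth rc 5) \<and> i' = swap_code (llen (lnth rc 2)) i)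
      else if d = 0 then i < llen (lnth rc 1) + lconcl (lnth rc 0) \<and>
          ((i < llen (lnth rc 1) \<and> i' = i) \<or> (llen (lnth rc 1) \<le> i \<and> llen (lnth rc 1) \<le> i'))
      else i < rconcl (lnth rc 0) + llen (lnth rc 2) \<and>
          ((rconcl (lnth rc 0) \<le> i \<and> rprem (lnth rc 0) j \<le> i' \<and>
              i - rconcl (lnth rc 0) = i' - rprem (lnth rc 0) j) \<or>
           (i < rconcl (lnth rc 0) \<and> i' < rprem (lnth rc 0) j)))"

lemma relevant_code:
  assumes "j < length (prems r)"
  shows "relevant_code (rule_code r) j (side_code d) i i' \<longleftrightarrow>
     i < length (formulas d (concl r)) \<and> relevant r j (d, i) (d, i')"
  using assms
  by (cases r; cases d; simp add: relevant_code_def lconcl_def rconcl_def rprem_def swap_code_def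
      less_length_2 numeral_2_eq_2 Let_def del: list_encode.simps; (elim disjE; simp; fail)?; auto)

definition principal_code :: "nat \<Rightarrow> nat \<Rightarrow> nat \<Rightarrow> bool" where
  "principal_code rc d i \<longleftrightarrow> (if d = 0 then llen (lnth rc 1) \<le> i else i < rconcl (lnth rc 0))"

definition is_exchange :: "rule \<Rightarrow> bool" where
  "is_exchange r \<longleftrightarrow> (\<exists>\<Gamma> \<phi> \<psi> \<Gamma>' \<Delta>. r = ExchL \<Gamma> \<phi> \<psi> \<Gamma>' \<Delta>) \<or> (\<exists>\<Gamma> \<Delta> \<phi> \<psi> \<Delta>'. r = ExchR \<Gamma> \<Delta> \<phi> \<psi> \<Delta>')"

lemma principal_code:
  assumes "\<not> is_exchange r" "prems r \<noteq> []"
  shows "principal_code (rule_code r) (side_code d) i \<longleftrightarrow> principal r (d, i)"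
  using assms
  by (cases r; cases d; simp add: principal_code_def rconcl_def is_exchange_def Let_def not_less not_le
      del: list_encode.simps)

text \<open>Here and below \<open>Suc (pair j v)\<close> is the code of the list with head
  \<open>j\<close> whose tail has code \<open>v\<close>.\<close>

definition argpos_code :: "nat \<Rightarrow> nat \<Rightarrow> bool" where
  "argpos_code n u \<longleftrightarrow> (\<exists>k<n. \<exists>v<Suc u. u = lapp (lrep k 0) (Suc (pair 1 v)))"

definition head_code :: "nat \<Rightarrow> (nat \<Rightarrow> nat \<Rightarrow> nat \<Rightarrow> bool) \<Rightarrow> nat \<Rightarrow> nat \<Rightarrow> nat \<Rightarrow> bool" where
  "head_code n H b u u' \<longleftrightarrow> (b = 0 \<and> u = u' \<and> argpos_code n u) \<or>
     (\<exists>v<Suc u. \<exists>v'<Suc u'. u = lapp (lrep n 0) v \<and> u' = lapp (lrep n 0) v' \<and> H b v v')"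

definition beta_code :: "nat \<Rightarrow> nat \<Rightarrow> nat \<Rightarrow> nat \<Rightarrow> bool" where
  "beta_code f b v v' \<longleftrightarrow> b = 0 \<and> (v = Suc (pair 0 (Suc (pair 0 v'))) \<or>
     (\<exists>w<Suc v. v = Suc (pair 1 w) \<and> hole_code f v' w))"

definition unfold_code :: "nat \<Rightarrow> nat \<Rightarrow> nat \<Rightarrow> nat \<Rightarrow> bool" where
  "unfold_code f b v v' \<longleftrightarrow> (b = 0 \<and> v = Suc (pair 0 v')) \<or> ((b \<noteq> 0 \<longleftrightarrow> v = 0) \<and> hole_code f v' v)"

definition mono_code :: "nat \<Rightarrow> nat \<Rightarrow> nat \<Rightarrow> nat \<Rightarrow> nat \<Rightarrow> nat \<Rightarrow> nat \<Rightarrow> bool" where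
  "mono_code n f x j b u u' \<longleftrightarrow> b = 0 \<and> (\<exists>v<Suc u. \<exists>v'<Suc u'.
     u' = lapp (lrep n 0) v' \<and> u = lapp v v' \<and> cfold (lchild x) (pair f 0) v = pair x j)"

lemma lapp_lrep [simp]: "lapp (lrep n x) (list_encode \<rho>) = list_encode (replicate n x @ \<rho>)"
  by (simp add: lrep_def)

lemma lapp_lrep_cons [simp]: "lapp (lrep n x) (Suc (pair y (list_encode \<rho>))) = list_encode (replicate n x @ y # \<rho>)"
  using lapp_lrep[of n x "y # \<rho>"] by simp

lemma list_encode_suffix_le': "list_encode \<rho> \<le> list_encode (xs @ y # \<rho>)"
  using list_encode_suffix_le[of \<rho> "xs @ [y]"] by simp

lemma list_encode_inject [simp]: "list_encode xs = list_encode ys \<longleftrightarrow> xs = ys"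
  by (rule list_encode_eq)

lemma argpos_code: "argpos_code n (list_encode \<pi>) \<longleftrightarrow> argpos n \<pi>"
proof -
  have "(\<exists>v<Suc (list_encode \<pi>). list_encode \<pi> = lapp (lrep k 0) (Suc (pair 1 v))) \<longleftrightarrow>
      (\<exists>\<rho>. list_encode \<pi> = list_encode (replicate k 0 @ 1 # \<rho>))" for k
    by (subst ex_list_encode) (auto simp: list_encode_suffix_le' simp del: list_encode.simps)
  then show ?thesis unfolding argpos_code_def argpos_def by simp
qed

lemma head_code:
  assumes "\<And>\<rho> \<rho>'. H (flag b) (list_encode \<rho>) (list_encode \<rho>') \<longleftrightarrow> H' b \<rho> \<rho>'"
  shows "head_code n H (flag b) (list_encode \<pi>) (list_encode \<pi>') \<longleftrightarrow> head_step n H' b \<pi> \<pi>'"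
proof -
  have 1: "(\<exists>v'<Suc (list_encode \<pi>'). u = lapp (lrep n 0) v \<and> list_encode \<pi>' = lapp (lrep n 0) v' \<and> H (flag b) v v')
     \<longleftrightarrow> (\<exists>\<rho>'. u = lapp (lrep n 0) v \<and> \<pi>' = replicate n 0 @ \<rho>' \<and> H (flag b) v (list_encode \<rho>'))" for u v
    by (subst ex_list_encode) (auto simp: list_encode_suffix_le simp del: list_encode.simps)
  have 2: "(\<exists>v<Suc (list_encode \<pi>). \<exists>\<rho>'. list_encode \<pi> = lapp (lrep n 0) v \<and> \<pi>' = replicate n 0 @ \<rho>' \<and> H (flag b) v (list_encode \<rho>'))
     \<longleftrightarrow> (\<exists>\<rho> \<rho>'. \<pi> = replicate n 0 @ \<rho> \<and> \<pi>' = replicate n 0 @ \<rho>' \<and> H (flag b) (list_encode \<rho>) (list_encode \<rho>'))"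
    by (subst ex_list_encode) (auto simp: list_encode_suffix_le simp del: list_encode.simps)
  have "flag b = 0 \<longleftrightarrow> \<not> b" by (simp add: flag_def)
  then show ?thesis
    unfolding head_code_def head_step_def 1 2 assms argpos_code list_encode_inject by simp
qed

lemma flag_0 [simp]: "flag b = 0 \<longleftrightarrow> \<not> b" "flag b \<noteq> 0 \<longleftrightarrow> b" "0 < flag b \<longleftrightarrow> b"
  by (simp_all add: flag_def)

lemma list_encode_0 [simp]: "list_encode \<rho> = 0 \<longleftrightarrow> \<rho> = []"
  by (cases \<rho>) auto

lemma list_encode_eq_Cons: "list_encode \<rho> = Suc (pair x (list_encode \<rho>')) \<longleftrightarrow> \<rho> = x # \<rho>'"
  using list_encode_inject[of \<rho> "x # \<rho>'"] by simp

lemma beta_code: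
  "beta_code (fm_code \<phi>) (flag b) (list_encode \<rho>) (list_encode \<rho>') \<longleftrightarrow>
     \<not> b \<and> (\<rho> = 0 # 0 # \<rho>' \<or> (\<exists>\<rho>2. \<rho> = 1 # \<rho>2 \<and> holeat 0 \<phi> \<rho>' \<rho>2))"
proof -
  have "(\<exists>w<Suc (list_encode \<rho>). list_encode \<rho> = Suc (pair 1 w) \<and> hole_code (fm_code \<phi>) (list_encode \<rho>') w) \<longleftrightarrow>
    (\<exists>\<rho>2. \<rho> = 1 # \<rho>2 \<and> holeat 0 \<phi> \<rho>' \<rho>2)"
    by (subst ex_list_encode)
      (auto simp: list_encode_eq_Cons hole_code simp del: list_encode.simps intro: list_encode_suffix_le'[of _ "[]", simplified])
  moreover have "list_encode \<rho> = Suc (pair 0 (Suc (pair 0 (list_encode \<rho>')))) \<longleftrightarrow> \<rho> = 0 # 0 # \<rho>'"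
    using list_encode_eq_Cons[of \<rho> 0 "0 # \<rho>'"] by simp
  ultimately show ?thesis unfolding beta_code_def by simp
qed

lemma unfold_code:
  "unfold_code (fm_code \<phi>) (flag b) (list_encode \<rho>) (list_encode \<rho>') \<longleftrightarrow>
     (\<not> b \<and> \<rho> = 0 # \<rho>') \<or> ((b \<longleftrightarrow> \<rho> = []) \<and> holeat 0 \<phi> \<rho>' \<rho>)"
  unfolding unfold_code_def hole_code list_encode_eq_Cons by simp

lemma mono_code:
  "mono_code n (fm_code \<phi>) (list_encode [3, x, fty_code T]) j (flag b) (list_encode \<pi>) (list_encode \<pi>') \<longleftrightarrow>
     \<not> b \<and> (\<exists>\<rho> \<rho>'. \<pi>' = replicate n 0 @ \<rho>' \<and> \<pi> = \<rho> @ \<rho>' \<and> sub \<phi> \<rho> = Some (FFree x T) \<and>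
        left_occs x T \<phi> \<rho> = j)"
proof -
  let ?C = "\<lambda>v. cfold (lchild (list_encode [3, x, fty_code T])) (pair (fm_code \<phi>) 0) v =
    pair (list_encode [3, x, fty_code T]) j"
  have 1: "(\<exists>v'<Suc (list_encode \<pi>'). list_encode \<pi>' = lapp (lrep n 0) v' \<and> list_encode \<pi> = lapp v v' \<and> ?C v)
     \<longleftrightarrow> (\<exists>\<rho>'. \<pi>' = replicate n 0 @ \<rho>' \<and> list_encode \<pi> = lapp v (list_encode \<rho>') \<and> ?C v)" for v
    by (subst ex_list_encode) (auto simp: list_encode_suffix_le simp del: list_encode.simps)
  have 2: "(\<exists>v<Suc (list_encode \<pi>). \<exists>\<rho>'. \<pi>' = replicate n 0 @ \<rho>' \<and> list_encode \<pi> = lapp v (list_encode \<rho>') \<and> ?C v)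
     \<longleftrightarrow> (\<exists>\<rho> \<rho>'. \<pi>' = replicate n 0 @ \<rho>' \<and> \<pi> = \<rho> @ \<rho>' \<and> ?C (list_encode \<rho>))"
    by (subst ex_list_encode) (auto simp: list_encode_prefix_le simp del: list_encode.simps)
  show ?thesis
    unfolding mono_code_def 1 2 cfold_list_encode left_occs_code by (simp del: list_encode.simps)
qed

text \<open>The numbers are the tags and entry places of \<open>rule_code\<close>. The argument with
  \<open>pair 3\<close> is the code of the variable \<open>FFree x T\<close> that
  \<open>Mono\<close> replaces.\<close>

definition pos_principal_code :: "nat \<Rightarrow> nat \<Rightarrow> nat \<Rightarrow> nat \<Rightarrow> nat \<Rightarrow> nat \<Rightarrow> bool" where
  "pos_principal_code rc j i' b u u' \<longleftrightarrow>
     (if lnth rc 0 = 13 \<or> lnth rc 0 = 16 then b = 0 \<and> u = Suc (pair (if j = 0 then 0 else 1) u')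
      else if lnth rc 0 = 14 then b = 0 \<and> u = Suc (pair (if i' = 0 then 0 else 1) u')
      else if lnth rc 0 = 15 then b = 0 \<and> u = Suc (pair (if i' = llen (lnth rc 1) then 0 else 1) u')
      else if lnth rc 0 = 17 \<or> lnth rc 0 = 18 then
        head_code (llen (lnth rc 6)) (beta_code (lnth rc 4)) b u u'
      else if lnth rc 0 = 19 \<or> lnth rc 0 = 20 then
        head_code (llen (lnth rc 6)) (unfold_code (lnth rc 5)) b u u'
      else if lnth rc 0 = 10 then
        mono_code (llen (lnth rc 8)) (lnth rc 5)
          (Suc (pair 3 (Suc (pair (lnth rc 3) (Suc (pair (lnth rc 4) 0)))))) j b u u'
      else if lnth rc 0 = 23 then False
      else b = 0 \<and> u = u')"

lemma head_beta_code:
  "head_code n (beta_code (fm_code \<phi>)) (flag b) (list_encode \<pi>) (list_encode \<pi>') \<longleftrightarrow> head_step n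
     (\<lambda>b \<rho> \<rho>'. \<not> b \<and> (\<rho> = 0 # 0 # \<rho>' \<or> (\<exists>\<rho>2. \<rho> = 1 # \<rho>2 \<and> holeat 0 \<phi> \<rho>' \<rho>2))) b \<pi> \<pi>'"
  by (rule head_code) (rule beta_code)

lemma head_unfold_code:
  "head_code n (unfold_code (fm_code \<phi>)) (flag b) (list_encode \<pi>) (list_encode \<pi>') \<longleftrightarrow> head_step n
     (\<lambda>b \<rho> \<rho>'. (\<not> b \<and> \<rho> = 0 # \<rho>') \<or> ((b \<longleftrightarrow> \<rho> = []) \<and> holeat 0 \<phi> \<rho>' \<rho>)) b \<pi> \<pi>'"
  by (rule head_code) (rule unfold_code)

lemma pos_principal_code:
  "pos_principal_code (rule_code r) j i' (flag b) (list_encode \<pi>) (list_encode \<pi>') \<longleftrightarrow>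
     pos_principal r j i' b \<pi> \<pi>'"
proof -
  have code3: "Suc (pair 3 (Suc (pair x (Suc (pair y 0))))) = list_encode [3, x, y]" for x y by simp
  show ?thesis
    unfolding pos_principal_code_def code3
    by (cases r)
      (simp_all add: list_encode_eq_Cons mono_code head_beta_code head_unfold_code
        del: list_encode.simps)
qed

text \<open>The two numbers 8 differ in meaning: the first is the tag of the rule
  \<open>SubstF\<close>, the second the tag of a fixed-point formula, so together they express
  \<open>pos_side\<close>. The last line is \<open>good_unfold\<close>, with sign codes 0 and
  1.\<close>

definition rule_step_code ::
  "nat \<Rightarrow> nat \<Rightarrow> nat \<Rightarrow> nat \<Rightarrow> nat \<Rightarrow> nat \<Rightarrow> nat \<Rightarrow> nat \<Rightarrow> bool" where
  "rule_step_code rc j b d i u i' u' \<longleftrightarrow> relevant_code rc j d i i' \<and>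
     (if lnth rc 0 = 6 \<or> lnth rc 0 = 7 then b = 0 \<and> u = u'
      else if principal_code rc d i then pos_principal_code rc j i' b u u'
      else b = 0 \<and> u = u' \<and>
        (lnth rc 0 = 8 \<longrightarrow> ftag (cfold fchild (lnth (if d = 0 then lnth rc 1 else lnth rc 2) i') u) = 8)) \<and>
     (b \<noteq> 0 \<longrightarrow> (lnth rc 0 = 19 \<and> lnth rc 3 = 0) \<or> (lnth rc 0 = 20 \<and> lnth rc 3 = 1))"

lemma sgn_code_iff: "sgn_code \<sigma> = 0 \<longleftrightarrow> \<sigma> = Mu" "sgn_code \<sigma> = 1 \<longleftrightarrow> \<sigma> = Nu"
  "sgn_code \<sigma> = Suc 0 \<longleftrightarrow> \<sigma> = Nu"
  by (cases \<sigma>; simp)+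

lemma rule_step_code:
  assumes "j < length (prems r)"
  shows "rule_step_code (rule_code r) j (flag b) (side_code d) i (list_encode \<pi>) i' (list_encode \<pi>') \<longleftrightarrow>
     i < length (formulas d (concl r)) \<and> relevant r j (d, i) (d, i') \<and>
     pos_step r j (d, i) (d, i') b \<pi> \<pi>' \<and> (b \<longrightarrow> good_unfold r)"
proof (cases "i < length (formulas d (concl r)) \<and> relevant r j (d, i) (d, i')")
  case False
  then show ?thesis unfolding rule_step_code_def relevant_code[OF assms] by blast
next
  case rel: True
  have good: "(lnth (rule_code r) 0 = 19 \<and> lnth (rule_code r) 3 = 0) \<or>
      (lnth (rule_code r) 0 = 20 \<and> lnth (rule_code r) 3 = 1) \<longleftrightarrow> good_unfold r"
    by (cases r) (simp_all add: sgn_code_iff del: list_encode.simps)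
  have exch: "lnth (rule_code r) 0 = 6 \<or> lnth (rule_code r) 0 = 7 \<longleftrightarrow> is_exchange r"
    by (cases r) (simp_all add: is_exchange_def del: list_encode.simps)
  have prems: "prems r \<noteq> []" using assms by auto
  show ?thesis
  proof (cases "is_exchange r")
    \<comment> \<open>In an exchange, principal and side occurrences are treated alike: positions
      are kept.\<close>
    case True
    then have "pos_step r j (d, i) (d, i') b \<pi> \<pi>' \<longleftrightarrow> \<not> b \<and> \<pi> = \<pi>'"
      unfolding pos_step_def is_exchange_def by (auto simp del: principal.simps)
    then show ?thesis
      unfolding rule_step_code_def relevant_code[OF assms] good exch using True rel
      by (simp del: principal.simps relevant.simps)
  next
    case False
    have side: "(lnth (rule_code r) 0 = 8 \<longrightarrow> ftag (cfold fchild (lnth (if side_code d = 0 then lnth (rule_code r) 1 else lnth (rule_code r) 2) i') (list_encode \<pi>)) = 8)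
      \<longleftrightarrow> pos_side r (d, i') \<pi>" if "\<not> principal r (d, i)"
    proof (cases "\<exists>\<Gamma> \<Delta> x T \<phi>. r = SubstF \<Gamma> \<Delta> x T \<phi>")
      case True
      then obtain \<Gamma> \<Delta> x T \<phi> where r: "r = SubstF \<Gamma> \<Delta> x T \<phi>" by blast
      \<comment> \<open>All formulas of this rule are side formulas; equality of the indices keeps
        \<open>i'\<close> within the list, so that its code is that of a formula.\<close>
      have "i' = i" using rel that r assms by (cases d) (auto split: if_splits)
      then show ?thesis using rel r fixat_code
        by (cases d) (simp_all del: list_encode.simps)
    next
      case False
      then have "lnth (rule_code r) 0 \<noteq> 8" "pos_side r (d, i') \<pi>"
        by (cases r; simp del: list_encode.simps)+
      then show ?thesis by simp
    qed
    show ?thesis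
      unfolding rule_step_code_def relevant_code[OF assms] good exch pos_step_def
        principal_code[OF False prems] pos_principal_code
      using False rel side by (simp del: principal.simps relevant.simps pos_side.simps cfold_list_encode)
  qed
qed

lemma rec_pred_rule_step_code:
  assumes "rec_fun f1" "rec_fun f2" "rec_fun f3" "rec_fun f4" "rec_fun f5" "rec_fun f6" "rec_fun f7" "rec_fun f8"
  shows "rec_pred (\<lambda>z. rule_step_code (f1 z) (f2 z) (f3 z) (f4 z) (f5 z) (f6 z) (f7 z) (f8 z))"
  unfolding rule_step_code_def relevant_code_def lconcl_def rconcl_def rprem_def swap_code_def
    principal_code_def pos_principal_code_def head_code_def argpos_code_def beta_code_def
    unfold_code_def mono_code_def
  by (intro rec_intros_list rec_fun_cfold rec_fun_fchild rec_fun_ftag rec_pred_hole_code rec_fun_lchild_fold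
      assms assms[THEN rec_fun_comp])

section \<open>Codes of derivations\<close>

text \<open>As for formulas, 0 is the code of no derivation and absorbs every further step.\<close>

definition dchild :: "nat \<Rightarrow> nat \<Rightarrow> nat" where
  "dchild d j = (if lnth d 0 = 1 \<and> j < llen (lnth d 2) then lnth (lnth d 2) j else 0)"

lemma dchild_code:
  "dchild 0 j = 0"
  "dchild (deriv_code (Open S)) j = 0"
  "dchild (deriv_code (Inf r ds)) j = (if j < length ds then deriv_code (ds ! j) else 0)"
  by (simp_all add: dchild_def del: list_encode.simps)

lemma foldl_dchild_0: "foldl dchild 0 p = 0"
  by (induction p) (simp_all add: dchild_code)

lemma foldl_dchild:
  "foldl dchild (deriv_code D) p = (case subderiv D p of None \<Rightarrow> 0 | Some d \<Rightarrow> deriv_code d)"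
  by (induction D p rule: subderiv.induct)
    (simp_all add: dchild_code foldl_dchild_0 del: deriv_code.simps)

lemma set_open_leaves: "p \<in> set (open_leaves D) \<longleftrightarrow> (\<exists>S. subderiv D p = Some (Open S))"
proof (induction D arbitrary: p)
  case (Open S)
  then show ?case by (cases p) auto
next
  case (Inf r ds)
  have "p \<in> set (open_leaves (Inf r ds)) \<longleftrightarrow>
      (\<exists>j q. p = j # q \<and> j < length ds \<and> q \<in> set (open_leaves (ds ! j)))"
  proof
    assume "p \<in> set (open_leaves (Inf r ds))"
    then show "\<exists>j q. p = j # q \<and> j < length ds \<and> q \<in> set (open_leaves (ds ! j))"
      by (auto simp: in_set_enumerate_eq)
  next
    assume "\<exists>j q. p = j # q \<and> j < length ds \<and> q \<in> set (open_leaves (ds ! j))"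
    then obtain j q where *: "p = j # q" "j < length ds" "q \<in> set (open_leaves (ds ! j))" by blast
    then have "(j, open_leaves (ds ! j)) \<in> set (List.enumerate 0 (map open_leaves ds))"
      by (simp add: in_set_enumerate_eq)
    then show "p \<in> set (open_leaves (Inf r ds))"
      unfolding open_leaves.simps set_concat set_map * by (rule UN_I[OF imageI]) (use * in simp)
  qed
  note leaves = this
  show ?case
  proof (cases p)
    case Nil
    then show ?thesis unfolding leaves by simp
  next
    case (Cons j q)
    then show ?thesis unfolding leaves using Inf[OF nth_mem, of j q] by auto
  qed
qed

definition leaf_code :: "nat \<Rightarrow> nat \<Rightarrow> nat \<Rightarrow> bool" where
  "leaf_code c p q \<longleftrightarrow> (\<exists>k<llen (psnd c). lnth (psnd c) k = pair p q)"

definition step_code :: "nat \<Rightarrow> nat \<Rightarrow> nat \<Rightarrow> bool" where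
  "step_code c p q \<longleftrightarrow> leaf_code c p q \<or>
     (lnth (cfold dchild (pfst c) p) 0 = 1 \<and>
      (\<exists>j<llen (lnth (cfold dchild (pfst c) p) 2). q = lapp p (Suc (pair j 0))))"

text \<open>\<open>pfst s < 2\<close> ensures that the source is the code of a state. Nothing of the
  kind is asked of \<open>t\<close>, which is the source of the next edge of a thread.\<close>

definition edge_code :: "nat \<Rightarrow> nat \<Rightarrow> nat \<Rightarrow> nat \<Rightarrow> nat \<Rightarrow> nat \<Rightarrow> bool" where
  "edge_code c b p s q t \<longleftrightarrow> pfst s < 2 \<and> ((leaf_code c p q \<and> b = 0 \<and> s = t) \<or>
     (lnth (cfold dchild (pfst c) p) 0 = 1 \<and>
      (\<exists>j<llen (lnth (cfold dchild (pfst c) p) 2). q = lapp p (Suc (pair j 0)) \<and> pfst t = pfst s \<and>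
         rule_step_code (lnth (cfold dchild (pfst c) p) 1) j b (pfst s) (pfst (psnd s)) (psnd (psnd s))
           (pfst (psnd t)) (psnd (psnd t)))))"

definition state_code :: "occurrence \<times> nat list \<Rightarrow> nat" where
  "state_code s = pair (side_code (fst (fst s))) (pair (snd (fst s)) (list_encode (snd s)))"

lemma leaf_code_mem: "leaf_code (pair a (list_encode xs)) u v \<longleftrightarrow> pair u v \<in> set xs"
  unfolding leaf_code_def in_set_conv_nth psnd_pair llen_list_encode
  by (simp add: lnth_list_encode cong: conj_cong)

lemma leaf_code:
  "leaf_code (preproof_code (D, R)) (list_encode p) (list_encode q) \<longleftrightarrow>
     (\<exists>S. subderiv D p = Some (Open S)) \<and> q = R p"
proof -
  have "pair (list_encode p) (list_encode q) \<in>
      set (map (\<lambda>p. pair (list_encode p) (list_encode (R p))) (open_leaves D)) \<longleftrightarrow>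
      p \<in> set (open_leaves D) \<and> q = R p"
    by (auto simp: image_iff list_encode_eq)
  then show ?thesis unfolding preproof_code.simps leaf_code_mem set_open_leaves .
qed

lemma snoc_code: "lapp (list_encode p) (Suc (pair j 0)) = list_encode (p @ [j])"
  using lapp_list_encode[of p "[j]"] by simp

lemma step_code:
  "step_code (preproof_code (D, R)) (list_encode p) (list_encode q) \<longleftrightarrow> path_step (D, R) p q"
proof (cases "subderiv D p")
  case None
  then show ?thesis unfolding step_code_def leaf_code by (simp add: foldl_dchild)
next
  case (Some d)
  then show ?thesis unfolding step_code_def leaf_code snoc_code
    by (cases d) (simp_all add: foldl_dchild list_encode_eq del: list_encode.simps)
qed

lemma edge_code:
  assumes "derivation D"
  shows "edge_code (preproof_code (D, R)) (flag b) (list_encode p) (state_code s) (list_encode q) (state_code t) \<longleftrightarrow>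
     path_step (D, R) p q \<and> thread_step (D, R) b p s q t"
proof -
  obtain d i \<pi> where s1: "s = ((d, i), \<pi>)" by (cases s) auto
  obtain d' i' \<pi>' where s2: "t = ((d', i'), \<pi>')" by (cases t) auto
  note s = s1 s2
  have side: "side_code d < 2" "side_code d' = side_code d \<longleftrightarrow> d' = d" for d d'
    by (cases d; cases d'; simp)+
  have inj: "state_code s = state_code t \<longleftrightarrow> s = t"
    unfolding state_code_def s by (auto simp: side list_encode_eq)
  show ?thesis
  proof (cases "subderiv D p")
    case None
    then show ?thesis unfolding edge_code_def leaf_code by (simp add: foldl_dchild)
  next
    case (Some d0)
    show ?thesis
    proof (cases d0)
      case (Open S)
      have "pfst (state_code s) < 2" using side by (simp add: state_code_def)
      then show ?thesis unfolding edge_code_def leaf_code inj using Some Open s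
        by (auto simp: foldl_dchild simp del: list_encode.simps)
    next
      case (Inf r ds)
      have "length ds = length (prems r)"
        using derivation_subderiv[OF assms Some] Inf by (auto dest: arg_cong[of _ _ length])
      show ?thesis
      proof (cases "d' = d")
        case True
        then show ?thesis
          unfolding edge_code_def leaf_code snoc_code
          using Some Inf s side \<open>length ds = length (prems r)\<close>
          by (auto simp: foldl_dchild state_code_def rule_step_code list_encode_eq
              simp del: list_encode.simps relevant.simps)
      next
        case False
        then show ?thesis
          unfolding edge_code_def leaf_code snoc_code
          using Some Inf s side relevant_side[of r _ d i d' i']
          by (auto simp: foldl_dchild state_code_def
              simp del: list_encode.simps relevant.simps)
      qed
    qed
  qed
qed

subsection \<open>Bounds\<close>

lemma height_fsubst: "height (fsubst x T \<psi> \<phi>) \<le> height \<phi> + height \<psi>"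
  by (induction \<phi>) auto

lemma height_tsubst [simp]: "height (tsubst \<rho> \<phi>) = height \<phi>"
  by (induction \<phi>) auto

lemma height_apps:
  assumes "height h \<le> m" "\<And>\<psi>. FArg \<psi> \<in> set as \<Longrightarrow> height \<psi> \<le> m"
  shows "height (apps h as) \<le> m + length as"
  using assms(2)
proof (induction as rule: rev_induct)
  case Nil
  then show ?case using assms(1) by simp
next
  case (snoc a as)
  then have "height (apps h as) \<le> m + length as" by simp
  then show ?case using snoc.prems by (cases a) (auto simp: apps_snoc intro: le_SucI trans_le_add1)
qed

lemma height_mem: "\<psi> \<in> set \<Gamma> \<Longrightarrow> height \<psi> \<le> fms_code \<Gamma>"
  using height_le_fm_code[of \<psi>] mem_less_list_encode[of "fm_code \<psi>" "map fm_code \<Gamma>"]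
  by (simp add: fms_code_def)

lemma height_arg: "FArg \<psi> \<in> set as \<Longrightarrow> height \<psi> \<le> args_code as"
  using height_le_fm_code[of \<psi>] mem_less_list_encode[of "arg_code (FArg \<psi>)" "map arg_code as"]
    mem_less_list_encode[of "fm_code \<psi>" "[0, fm_code \<psi>]"]
  by (force simp: args_code_def simp del: list_encode.simps)

lemma length_fms_code: "length \<Gamma> \<le> fms_code \<Gamma>"
  using length_le_list_encode[of "map fm_code \<Gamma>"] by (simp add: fms_code_def)

lemma length_args_code: "length as \<le> args_code as"
  using length_le_list_encode[of "map arg_code as"] by (simp add: args_code_def)

lemma height_apps_bound:
  assumes "height h \<le> N" "args_code as < N"
  shows "height (apps h as) \<le> N + N"
  using height_apps[of h N as] height_arg[of _ as] length_args_code[of as] assms by force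

lemma height_arg_code: "arg_code (FArg \<psi>) < N \<Longrightarrow> height \<psi> \<le> N"
  using height_le_fm_code[of \<psi>] mem_less_list_encode[of "fm_code \<psi>" "[0, fm_code \<psi>]"]
  by (simp del: list_encode.simps)

text \<open>Heights bound the lengths of positions. Each parameter of a rule has a code below
  \<open>N\<close>, hence height at most \<open>N\<close>; the worst conclusion, an abstraction
  applied to arguments, has height at most \<open>2 * N + 4\<close>, so the constants leave
  room.\<close>

lemma concl_bounds:
  assumes N: "rule_code r = N" and \<phi>: "\<phi> \<in> set (formulas d (concl r))"
  shows "height \<phi> \<le> 4 * N + 4"
proof -
  have less: "\<forall>x \<in> set (list_decode (rule_code r)). x < N"
    using mem_less_list_encode[of _ "list_decode (rule_code r)"] N by simp
  have mem: "height \<psi> \<le> 4 * N + 4" if "\<psi> \<in> set \<Gamma>" "fms_code \<Gamma> < N" for \<psi> \<Gamma>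
    using height_mem[OF that(1)] that(2) by simp
  have fm: "height \<psi> \<le> N" if "fm_code \<psi> < N" for \<psi>
    using height_le_fm_code[of \<psi>] that by simp
  have sub: "height (fsubst x T \<psi> \<chi>) \<le> 4 * N + 4" if "\<chi> \<in> set \<Gamma>" "fms_code \<Gamma> < N" "fm_code \<psi> < N" for x T \<psi> \<chi> \<Gamma>
    using height_fsubst[of x T \<psi> \<chi>] height_mem[OF that(1)] that fm[of \<psi>] by simp
  have sub': "height (fsubst x T \<psi> \<chi>) \<le> 4 * N + 4" if "fm_code \<chi> < N" "fm_code \<psi> < N" for x T \<psi> \<chi>
    using height_fsubst[of x T \<psi> \<chi>] fm[OF that(1)] fm[OF that(2)] by simp
  have lam: "height (apps (Lam A \<psi>) (a # as)) \<le> 4 * N + 4" if "fm_code \<psi> < N" "arg_code a < N" "args_code as < N" for A \<psi> a as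
  proof -
    have "height (app (Lam A \<psi>) a) \<le> Suc (Suc N)"
      using fm[OF that(1)] height_arg_code[of _ N] that(2) by (cases a) (auto simp: le_SucI)
    then have "height (apps (app (Lam A \<psi>) a) as) \<le> Suc (Suc N) + Suc (Suc N)"
      by (rule height_apps_bound) (use that in simp)
    then show ?thesis by (simp add: apps_Cons)
  qed
  have fix_apps: "height (apps (Fix \<sigma> () T \<psi>) as) \<le> 4 * N + 4" if "fm_code \<psi> < N" "args_code as < N" for \<sigma> T \<psi> as
  proof -
    have "height (apps (Fix \<sigma> () T \<psi>) as) \<le> Suc N + Suc N"
      by (rule height_apps_bound) (use that fm[OF that(1)] in simp_all)
    then show ?thesis by simp
  qed
  have fm4: "height \<psi> \<le> 4 * N + 4" "height \<psi> \<le> 3 + 4 * N" if "fm_code \<psi> < N" for \<psi>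
    using fm[OF that] by simp_all
  show ?thesis
    using less \<phi>
    by (cases r; cases d; simp del: list_encode.simps)
      (auto simp del: list_encode.simps dest: fm intro: mem sub sub' lam fix_apps fm4)
qed

lemma concl_length:
  "length (formulas d (concl r)) \<le> 2 * rule_code r + 2"
proof -
  have less: "\<forall>x \<in> set (list_decode (rule_code r)). x < N" if "rule_code r = N" for N
    using mem_less_list_encode[of _ "list_decode (rule_code r)"] that by simp
  have len: "length \<Gamma> \<le> N" if "fms_code \<Gamma> < N" for \<Gamma> N
    using length_fms_code[of \<Gamma>] that by simp
  have "length (formulas d (concl r)) \<le> 2 * N + 2" if N: "rule_code r = N" for N
    using less[OF N]
    by (cases r; cases d; simp del: list_encode.simps) (auto simp del: list_encode.simps dest!: len)
  then show ?thesis by simp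
qed

text \<open>Every step down lowers the code of the subderivation, so depth plus remaining code
  cannot exceed the code at the root.\<close>

lemma subderiv_bounds:
  "subderiv D p = Some d \<Longrightarrow> length p + deriv_code d \<le> deriv_code D \<and> (\<forall>j \<in> set p. j \<le> deriv_code D)"
proof (induction D p rule: subderiv.induct)
  case (3 r ds j p)
  then have j: "j < length ds" "subderiv (ds ! j) p = Some d" by (auto split: if_splits)
  let ?ds = "list_encode (map deriv_code ds)"
  have "deriv_code (ds ! j) < ?ds" using mem_less_list_encode[of "deriv_code (ds ! j)" "map deriv_code ds"] j(1) by simp
  moreover have "?ds < deriv_code (Inf r ds)"
    using mem_less_list_encode[of ?ds "[1, rule_code r, ?ds]"] by (simp del: list_encode.simps)
  moreover have "length ds \<le> ?ds" using length_le_list_encode[of "map deriv_code ds"] by simp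
  moreover have IH: "length p + deriv_code d \<le> deriv_code (ds ! j)" "\<And>x. x \<in> set p \<Longrightarrow> x \<le> deriv_code (ds ! j)"
    using 3(1)[OF j] by auto
  ultimately have less: "deriv_code (ds ! j) < deriv_code (Inf r ds)" "j \<le> deriv_code (Inf r ds)"
    using j(1) by linarith+
  show ?case
  proof (intro conjI ballI)
    show "length (j # p) + deriv_code d \<le> deriv_code (Inf r ds)"
      using IH(1) less(1) unfolding list.size by linarith
    fix x assume "x \<in> set (j # p)"
    then show "x \<le> deriv_code (Inf r ds)" using IH(2)[of x] less by (cases "x = j") auto
  qed
qed auto

lemma rule_code_less: "rule_code r < deriv_code (Inf r ds)"
  using mem_less_list_encode[of "rule_code r" "[1, rule_code r, list_encode (map deriv_code ds)]"]
  by (simp del: list_encode.simps)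

text \<open>The three components bound side, index and position of a state. The last one alone also
  bounds the code of a node.\<close>

definition code_bound :: "nat \<Rightarrow> nat" where
  "code_bound c = Suc (pair (4 * c + 4) (pair (4 * c + 4) (lrep (4 * c + 4) (4 * c + 4))))"

lemma lrep_less_code_bound: "lrep (4 * c + 4) (4 * c + 4) < code_bound c"
  unfolding code_bound_def less_Suc_eq_le using le_prod_encode_2 le_trans by blast

lemma node_bound:
  assumes "subderiv D p = Some d"
  shows "list_encode p < code_bound (preproof_code (D, R))"
proof -
  have "deriv_code D \<le> preproof_code (D, R)" using le_prod_encode_1 by simp
  then have "list_encode p \<le> lrep (4 * preproof_code (D, R) + 4) (4 * preproof_code (D, R) + 4)"
    using subderiv_bounds[OF assms] by (intro list_encode_le_lrep) force+
  then show ?thesis using lrep_less_code_bound le_less_trans by blast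
qed

text \<open>An operator at \<open>\<pi>\<close> is essential: it confines \<open>\<pi>\<close> to
  the formula, while \<open>thread_step\<close> lets arbitrary positions pass through most side
  formulas.\<close>

lemma state_bound:
  assumes "subderiv D p = Some (Inf r ds)" "S = concl r" "i < length (formulas d S)"
    "fixat \<sigma> () (formulas d S ! i) \<pi>"
  shows "state_code ((d, i), \<pi>) < code_bound (preproof_code (D, R))"
proof -
  let ?c = "preproof_code (D, R)"
  have "deriv_code D \<le> ?c" using le_prod_encode_1 by simp
  then have r: "rule_code r \<le> ?c"
    using subderiv_bounds[OF assms(1)] rule_code_less[of r ds] by linarith
  have "formulas d S ! i \<in> set (formulas d (concl r))" using assms by simp
  then have "height (formulas d S ! i) \<le> 4 * ?c + 4"
    using concl_bounds[of r _ "formulas d S ! i" d] r by (meson add_le_mono1 le_trans mult_le_mono2)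
  then have "list_encode \<pi> \<le> lrep (4 * ?c + 4) (4 * ?c + 4)"
    using sub_bounds[of "formulas d S ! i" \<pi>] assms(4) unfolding fixat_sub
    by (intro list_encode_le_lrep) force+
  moreover have "i \<le> 4 * ?c + 4"
    using concl_length[of d r] assms(3)[unfolded assms(2)] r by linarith
  moreover have "side_code d \<le> 4 * ?c + 4" by (cases d) simp_all
  ultimately show ?thesis
    unfolding state_code_def code_bound_def less_Suc_eq_le fst_conv snd_conv by (intro pair_mono)
qed

subsection \<open>The decision procedure\<close>

lemma state_code_surj:
  assumes "pfst s < 2"
  shows "\<exists>x. s = state_code x"
proof -
  have "s = state_code ((if pfst s = 0 then Lft else Rgt, pfst (psnd s)), list_decode (psnd (psnd s)))"
  proof -
    have "side_code (if pfst s = 0 then Lft else Rgt) = pfst s"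
      using assms by (auto simp: numeral_2_eq_2 less_Suc_eq)
    then show ?thesis unfolding state_code_def fst_conv snd_conv by simp
  qed
  then show ?thesis by blast
qed

lemma global_trace_condition_code:
  assumes pre: "pre_proof P" and c: "c = preproof_code P"
  shows "global_trace_condition P \<longleftrightarrow>
     thread_condition (bounded_step (code_bound c) (step_code c)) (bounded_graph (code_bound c) (edge_code c))"
proof -
  obtain D R where P: "P = (D, R)" by (cases P)
  have "derivation D" using pre P by simp
  note edge = edge_code[OF this, of R]
  have pre': "pre_proof (D, R)" using pre P by simp
  show ?thesis
    unfolding P global_trace_condition_threads[OF pre'] thread_condition_def
  proof (intro iffI allI impI)
    fix u :: "nat \<Rightarrow> nat"
    assume L: "\<forall>n. infinite_path (D, R) n \<longrightarrow>
      (threaded D R n)"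
      and u: "\<forall>i. bounded_step (code_bound c) (step_code c) (u i) (u (Suc i))"
    define n where "n i = list_decode (u i)" for i
    have u_n: "u i = list_encode (n i)" for i by (simp add: n_def)
    have path: "infinite_path (D, R) n"
      unfolding infinite_path_def
    proof
      fix i
      have "step_code c (u i) (u (Suc i))" using u unfolding bounded_step_def by blast
      then show "path_step (D, R) (n i) (n (Suc i))" unfolding u_n c P step_code .
    qed
    then obtain m s \<beta> where
      th: "\<And>i. i \<ge> m \<Longrightarrow> thread_step (D, R) (\<beta> i) (n i) (s i) (n (Suc i)) (s (Suc i))"
      and inf: "infinite {i. m \<le> i \<and> \<beta> i}"
      using L by blast
    \<comment> \<open>Only from a progress step on is the thread known to sit on operators, and
      hence to stay below the bound.\<close>
    obtain m' where m': "m' \<ge> m" "\<beta> m'" using inf unfolding infinite_nat_iff_unbounded_le by blast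
    have path': "infinite_path (D, R) (\<lambda>i. n (m' + i))" using path unfolding infinite_path_def by simp
    have inf': "infinite {i. \<beta> (m' + i)}"
      unfolding infinite_nat_iff_unbounded_le
    proof
      fix k
      obtain i where "i \<ge> m' + k" "\<beta> i" using inf unfolding infinite_nat_iff_unbounded_le by blast
      then show "\<exists>i\<ge>k. i \<in> {i. \<beta> (m' + i)}" by (intro exI[of _ "i - m'"]) auto
    qed
    have th': "thread_step (D, R) (\<beta> (m' + i)) (n (m' + i)) (fst (s (m' + i)), snd (s (m' + i)))
        (n (m' + Suc i)) (fst (s (m' + Suc i)), snd (s (m' + Suc i)))" for i
      using th[of "m' + i"] m' by simp
    have "\<beta> (m' + 0)" using m'(2) by simp
    note thread = fix_trace_of_thread[OF pre' path', of "\<lambda>i. \<beta> (m' + i)" "\<lambda>i. fst (s (m' + i))"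
        "\<lambda>i. snd (s (m' + i))", OF th' inf' this]
    have bound: "state_code (s (m' + i)) < code_bound c" for i
    proof -
      obtain d l \<pi> where s: "s (m' + i) = ((d, l), \<pi>)" by (cases "s (m' + i)") auto
      have valid: "l < length (formulas d (sequent_at (D, R) (n (m' + i))))"
        using thread(2)[of i] s by (simp add: valid_occ_def del: sequent_at.simps)
      obtain \<sigma> where fix_at: "fixat \<sigma> () (formulas d (sequent_at (D, R) (n (m' + i))) ! l) \<pi>"
        using thread(3)[of i] s by (auto simp: formula_at_def simp del: sequent_at.simps)
      \<comment> \<open>An open leaf has the sequent of its companion, so bounds for conclusions of
        rules cover all nodes of the path.\<close>
      have "\<exists>q r ds. subderiv D q = Some (Inf r ds) \<and> sequent_at (D, R) (n (m' + i)) = concl r"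
      proof (cases rule: path_cases[OF pre' path, of "m' + i"])
        case (1 S)
        then obtain r ds where "subderiv D (n (Suc (m' + i))) = Some (Inf r ds)" by blast
        then show ?thesis using 1(2) by (intro exI[of _ "n (Suc (m' + i))"]) auto
      next
        case (2 r ds j)
        then show ?thesis by blast
      qed
      then obtain q r ds where "subderiv D q = Some (Inf r ds)" "sequent_at (D, R) (n (m' + i)) = concl r"
        by blast
      from state_bound[OF this valid fix_at] show ?thesis unfolding s c P .
    qed
    have "(state_code (s i), \<beta> i, state_code (s (Suc i))) \<in> bounded_graph (code_bound c) (edge_code c) (u i) (u (Suc i))"
      if "i \<ge> m'" for i
    proof -
      have "path_step (D, R) (n i) (n (Suc i))" using path unfolding infinite_path_def by blast
      then have "edge_code c (flag (\<beta> i)) (u i) (state_code (s i)) (u (Suc i)) (state_code (s (Suc i)))"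
        unfolding c P u_n edge using th[of i] that m' by simp
      moreover have "state_code (s i) < code_bound c" "state_code (s (Suc i)) < code_bound c"
        using bound[of "i - m'"] bound[of "Suc i - m'"] that by simp_all
      ultimately show ?thesis unfolding bounded_graph_def by simp
    qed
    moreover have "infinite {i. m' \<le> i \<and> \<beta> i}"
    proof -
      have "(\<lambda>i. m' + i) ` {i. \<beta> (m' + i)} \<subseteq> {i. m' \<le> i \<and> \<beta> i}" by auto
      moreover have "infinite ((\<lambda>i. m' + i) ` {i. \<beta> (m' + i)})"
        using inf' by (simp add: finite_image_iff)
      ultimately show ?thesis by (rule infinite_super)
    qed
    ultimately show "\<exists>m \<sigma> \<beta>. (\<forall>i\<ge>m. (\<sigma> i, \<beta> i, \<sigma> (Suc i)) \<in>
          bounded_graph (code_bound c) (edge_code c) (u i) (u (Suc i))) \<and> infinite {i. m \<le> i \<and> \<beta> i}"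
      by (intro exI[of _ m'] exI[of _ "\<lambda>i. state_code (s i)"] exI[of _ \<beta>]) simp
  next
    fix n
    assume R: "\<forall>n. (\<forall>i. bounded_step (code_bound c) (step_code c) (n i) (n (Suc i))) \<longrightarrow>
        (\<exists>m \<sigma> \<beta>. (\<forall>i\<ge>m. (\<sigma> i, \<beta> i, \<sigma> (Suc i)) \<in>
          bounded_graph (code_bound c) (edge_code c) (n i) (n (Suc i))) \<and> infinite {i. m \<le> i \<and> \<beta> i})"
      and path: "infinite_path (D, R) n"
    have step: "path_step (D, R) (n i) (n (Suc i))" for i using path unfolding infinite_path_def by blast
    have node: "list_encode (n i) < code_bound c" for i
    proof -
      obtain d where "subderiv D (n i) = Some d" using step[of i] by (cases "subderiv D (n i)") auto
      then show ?thesis unfolding c P by (rule node_bound)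
    qed
    have "bounded_step (code_bound c) (step_code c) (list_encode (n i)) (list_encode (n (Suc i)))" for i
      unfolding bounded_step_def using node step[of i] by (simp only: c P step_code)
    then obtain m \<sigma> \<beta> where
      th: "\<forall>i\<ge>m. (\<sigma> i, \<beta> i, \<sigma> (Suc i)) \<in> bounded_graph (code_bound c) (edge_code c)
          (list_encode (n i)) (list_encode (n (Suc i)))" and inf: "infinite {i. m \<le> i \<and> \<beta> i}"
      using R[rule_format, of "\<lambda>i. list_encode (n i)"] by blast
    have edges: "edge_code c (flag (\<beta> i)) (list_encode (n i)) (\<sigma> i) (list_encode (n (Suc i))) (\<sigma> (Suc i))"
      if "i \<ge> m" for i using th that unfolding bounded_graph_def by auto
    \<comment> \<open>From \<open>m\<close> on every number in the thread is the code of a state,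
      since it is the source of an edge.\<close>
    define s where "s i = (SOME x. \<sigma> i = state_code x)" for i
    have \<sigma>: "\<sigma> i = state_code (s i)" if "i \<ge> m" for i
    proof -
      have "pfst (\<sigma> i) < 2" using edges[OF that] unfolding edge_code_def by blast
      from someI_ex[OF state_code_surj[OF this]] show ?thesis unfolding s_def .
    qed
    have "thread_step (D, R) (\<beta> i) (n i) (s i) (n (Suc i)) (s (Suc i))" if "i \<ge> m" for i
      using edges[OF that] that unfolding \<sigma>[OF that] \<sigma>[OF le_SucI[OF that]] c P edge by blast
    then show "threaded D R n"
      using inf by blast
  qed
qed

lemma rec_pred_decision:
  "rec_pred (\<lambda>c. thread_condition (bounded_step (code_bound c) (step_code c))
     (bounded_graph (code_bound c) (edge_code c)))"
proof (rule rec_pred_thread_condition)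
  \<comment> \<open>The closure rules contain addition, so the product is written as a sum.\<close>
  have mult: "4 * c + 4 = c + c + c + c + 4" for c :: nat by simp
  show "rec_fun code_bound"
    unfolding code_bound_def mult by (intro rec_intros_list)
  have dchild: "rec_fun (\<lambda>w. dchild (pfst w) (psnd w))"
    unfolding dchild_def by (intro rec_intros_list)
  have leaf: "rec_pred (\<lambda>z. leaf_code (f z) (g z) (h z))" if "rec_fun f" "rec_fun g" "rec_fun h" for f g h
    unfolding leaf_code_def by (intro rec_intros_list that that[THEN rec_fun_comp])
  show "rec_pred (\<lambda>z. step_code (pfst z) (pfst (psnd z)) (psnd (psnd z)))"
    unfolding step_code_def by (intro rec_intros_list rec_fun_cfold dchild leaf)
  show "rec_pred (\<lambda>z. edge_code (pfst z) (pfst (psnd z)) (pfst (psnd (psnd z)))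
      (pfst (psnd (psnd (psnd z)))) (pfst (psnd (psnd (psnd (psnd z))))) (psnd (psnd (psnd (psnd (psnd z))))))"
    unfolding edge_code_def by (intro rec_intros_list rec_fun_cfold dchild leaf rec_pred_rule_step_code)
qed

theorem theorem19:
  shows "decidable preproof_code pre_proof global_trace_condition"
proof -
  obtain f where "recursive 1 f" "\<And>xs. length xs = 1 \<Longrightarrow> f xs =
     (if thread_condition (bounded_step (code_bound (xs ! 0)) (step_code (xs ! 0)))
        (bounded_graph (code_bound (xs ! 0)) (edge_code (xs ! 0))) then 1 else 0)"
    using rec_pred_decision unfolding rec_pred_def rec_fun_def rec_n_def by blast
  then show ?thesis
    unfolding decidable_def using global_trace_condition_code by (intro exI[of _ f]) simp
qed

end
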